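(* The universal commuting dilation constant $C_3$ satisfies $$C_3\le 3\sqrt{\frac{2}{1+\sqrt{7+2\sqrt5}}}\ (\approx 2.025).$$
   Context: For a positive integer $d$, the universal commuting dilation constant $C_d$ is the smallest constant $\alpha$ such that for every Hilbert space $\mathcal{H}$ and every $d$-tuple of contractions $A=(A_1,\dots,A_d)\in B(\mathcal{H})^d$ there are a Hilbert space $\mathcal{K}\supseteq\mathcal{H}$ and a $d$-tuple $B=(B_1,\dots,B_d)\in B(\mathcal{K})^d$ of commuting normal operators, each of norm at most $\alpha$, with $A_i=P_{\mathcal{H}}B_i|_{\mathcal{H}}$ for $i=1,\dots,d$, where $P_{\mathcal{H}}:\mathcal{K}\to\mathcal{H}$ is the orthogonal projection. *)

theory Defs
  imports "HOL-Analysis.Analysis" "HOL-Algebra.Module"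
begin

definition complex_ring :: "complex ring" where
  "complex_ring = \<lparr>carrier = UNIV, mult = (*), one = 1, zero = 0, add = (+)\<rparr>"

text \<open>
  Hilbert spaces are carrier-based, so that one can quantify over all Hilbert spaces inside a
  formula. The record inherits the fields \<open>mult\<close> and \<open>one\<close> from the module record of HOL-Algebra;
  they play no role. The inner product is linear in its second argument.
\<close>

record 'a inner_module = "(complex, 'a) module" +
  cinner :: "'a \<Rightarrow> 'a \<Rightarrow> complex"

definition hnorm :: "'a inner_module \<Rightarrow> 'a \<Rightarrow> real" where
  "hnorm H x = sqrt (Re (cinner H x x))"

locale complex_hilbert_space = module complex_ring H for H :: "'a inner_module" (structure) +
  assumes cinner_add_right:
      "\<lbrakk>x \<in> carrier H; y \<in> carrier H; z \<in> carrier H\<rbrakk>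
        \<Longrightarrow> cinner H x (y \<oplus>\<^bsub>H\<^esub> z) = cinner H x y + cinner H x z"
    and cinner_smult_right:
      "\<lbrakk>x \<in> carrier H; y \<in> carrier H\<rbrakk> \<Longrightarrow> cinner H x (a \<odot>\<^bsub>H\<^esub> y) = a * cinner H x y"
    and cinner_commute:
      "\<lbrakk>x \<in> carrier H; y \<in> carrier H\<rbrakk> \<Longrightarrow> cinner H x y = cnj (cinner H y x)"
    and cinner_pos:
      "\<lbrakk>x \<in> carrier H; x \<noteq> \<zero>\<^bsub>H\<^esub>\<rbrakk> \<Longrightarrow> 0 < Re (cinner H x x)"
    and complete:
      "Metric_space.mcomplete (carrier H) (\<lambda>x y. hnorm H (x \<ominus>\<^bsub>H\<^esub> y))"

definition linear_op :: "'a inner_module \<Rightarrow> 'b inner_module \<Rightarrow> ('a \<Rightarrow> 'b) \<Rightarrow> bool" where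
  "linear_op H K T \<longleftrightarrow>
     T \<in> carrier H \<rightarrow> carrier K \<and>
     (\<forall>x\<in>carrier H. \<forall>y\<in>carrier H. T (x \<oplus>\<^bsub>H\<^esub> y) = T x \<oplus>\<^bsub>K\<^esub> T y) \<and>
     (\<forall>a. \<forall>x\<in>carrier H. T (a \<odot>\<^bsub>H\<^esub> x) = a \<odot>\<^bsub>K\<^esub> T x)"

text \<open>Operators are total functions whose values outside the carrier are irrelevant.\<close>

definition bounded_op :: "'a inner_module \<Rightarrow> ('a \<Rightarrow> 'a) \<Rightarrow> bool" where
  "bounded_op H T \<longleftrightarrow>
     linear_op H H T \<and> (\<exists>C. \<forall>x\<in>carrier H. hnorm H (T x) \<le> C * hnorm H x)"

definition opnorm :: "'a inner_module \<Rightarrow> ('a \<Rightarrow> 'a) \<Rightarrow> real" where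
  "opnorm H T = Sup {hnorm H (T x) | x. x \<in> carrier H \<and> hnorm H x \<le> 1}"

definition contraction :: "'a inner_module \<Rightarrow> ('a \<Rightarrow> 'a) \<Rightarrow> bool" where
  "contraction H T \<longleftrightarrow> bounded_op H T \<and> opnorm H T \<le> 1"

definition adjoint_op :: "'a inner_module \<Rightarrow> ('a \<Rightarrow> 'a) \<Rightarrow> 'a \<Rightarrow> 'a" where
  "adjoint_op H T y =
     (THE z. z \<in> carrier H \<and> (\<forall>x\<in>carrier H. cinner H (T x) y = cinner H x z))"

definition normal_op :: "'a inner_module \<Rightarrow> ('a \<Rightarrow> 'a) \<Rightarrow> bool" where
  "normal_op H T \<longleftrightarrow> bounded_op H T \<and>
     (\<forall>x\<in>carrier H. adjoint_op H T (T x) = T (adjoint_op H T x))"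

definition orth_proj :: "'a inner_module \<Rightarrow> 'a set \<Rightarrow> 'a \<Rightarrow> 'a" where
  "orth_proj H M x = (THE p. p \<in> M \<and> (\<forall>m\<in>M. cinner H m (x \<ominus>\<^bsub>H\<^esub> p) = 0))"

definition isometric_embedding :: "'a inner_module \<Rightarrow> 'b inner_module \<Rightarrow> ('a \<Rightarrow> 'b) \<Rightarrow> bool" where
  "isometric_embedding H K V \<longleftrightarrow>
     linear_op H K V \<and>
     (\<forall>x\<in>carrier H. \<forall>y\<in>carrier H. cinner K (V x) (V y) = cinner H x y)"

text \<open>
  The inclusion of \<open>H\<close> in \<open>K\<close> is an isometric embedding \<open>V\<close>; under the identification of \<open>H\<close> with
  \<open>V ` carrier H\<close> the last clause says that \<open>A i\<close> is the compression of \<open>B i\<close> to \<open>H\<close>.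
\<close>

definition commuting_normal_dilation ::
    "'a inner_module \<Rightarrow> nat \<Rightarrow> (nat \<Rightarrow> 'a \<Rightarrow> 'a) \<Rightarrow> real \<Rightarrow>
     'b inner_module \<Rightarrow> ('a \<Rightarrow> 'b) \<Rightarrow> (nat \<Rightarrow> 'b \<Rightarrow> 'b) \<Rightarrow> bool" where
  "commuting_normal_dilation H d A \<alpha> K V B \<longleftrightarrow>
     complex_hilbert_space K \<and> isometric_embedding H K V \<and>
     (\<forall>i<d. normal_op K (B i) \<and> opnorm K (B i) \<le> \<alpha>) \<and>
     (\<forall>i<d. \<forall>j<d. \<forall>x\<in>carrier K. B i (B j x) = B j (B i x)) \<and>
     (\<forall>i<d. \<forall>x\<in>carrier H. orth_proj K (V ` carrier H) (B i (V x)) = V (A i x))"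

text \<open>
  \<open>H\<close> ranges over all Hilbert spaces with carrier in the type \<open>'a\<close>, which is arbitrary. HOL cannot
  quantify existentially over the type of \<open>K\<close>, but the type \<open>nat \<times> 'a \<Rightarrow> complex\<close> loses no dilation:
  restrict a dilation \<open>(K, V, B)\<close> to the closed span of the spaces \<open>W n (V ` carrier H)\<close>, where \<open>W n\<close>
  enumerates the words in the operators \<open>B i\<close> and their adjoints. This subspace reduces all \<open>B i\<close>
  and contains \<open>V ` carrier H\<close>, and its elements \<open>k\<close> are determined by the function that maps
  \<open>(n, x)\<close>, with \<open>x\<close> in \<open>H\<close>, to the inner product of \<open>W n (V x)\<close> and \<open>k\<close>. The structure of \<open>K\<close> on
  its carrier is not otherwise restricted.
\<close>

definition dilates_all_contractions :: "'a itself \<Rightarrow> nat \<Rightarrow> real \<Rightarrow> bool" where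
  "dilates_all_contractions _ d \<alpha> \<longleftrightarrow>
     (\<forall>(H :: 'a inner_module) A.
        complex_hilbert_space H \<longrightarrow> (\<forall>i<d. contraction H (A i)) \<longrightarrow>
        (\<exists>(K :: (nat \<times> 'a \<Rightarrow> complex) inner_module) V B.
           commuting_normal_dilation H d A \<alpha> K V B))"

text \<open>
  The smallest admissible constant is written as an infimum. For \<open>d > 0\<close> the admissible constants
  are bounded below by 0, because operator norms are nonnegative.
\<close>

definition universal_commuting_dilation_constant :: "'a itself \<Rightarrow> nat \<Rightarrow> real" where
  "universal_commuting_dilation_constant T d = Inf {\<alpha>. dilates_all_contractions T d \<alpha>}"

end

theory Submission
  imports Defs
begin

text \<open>
  The dilation is built from lattice shifts. Suppose that \<open>N\<close> is a finite set of points of the lattice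
  \<open>\<int>\<^sup>3\<close>, that \<open>X p\<close> for \<open>p \<in> N\<close> are isometries of \<open>H\<close> into some Hilbert space \<open>L\<close>, and that \<open>c\<close> is a unit vector of
  real weights on \<open>N\<close>. Then \<open>V x = (c p \<cdot> X p x)\<^sub>p\<close> embeds \<open>H\<close> isometrically in the square-summable families
  \<open>\<int>\<^sup>3 \<rightarrow> L\<close>, on which the three lattice shifts \<open>U i\<close> are commuting unitaries. If
  \<open>(X p)\<^sup>* (X (p + e i)) = A i\<close> whenever \<open>p\<close> and \<open>p + e i\<close> lie in \<open>N\<close>, then \<open>V\<^sup>* (U i) V = \<kappa> i \<cdot> A i\<close> with
  \<open>\<kappa> i = (\<Sum>p. c p \<cdot> c (p + e i))\<close>. If all \<open>\<kappa> i\<close> have the same value \<open>\<kappa>\<close>, then the operators \<open>U i / \<kappa>\<close> are a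
  dilation of norm \<open>1 / \<kappa>\<close>. So two things are needed: the isometries \<open>X p\<close>, and weights with a large \<open>\<kappa>\<close>.

  The isometries exist if \<open>N\<close> is an induced tree of the lattice graph (\<open>tree_isometries\<close>). A new point then has one
  neighbour in the part of \<open>N\<close> that is already treated, so only one inner product is prescribed, and a Gram--Schmidt
  step solves it (\<open>isometry_extension_step\<close>): the new isometry is \<open>X p S\<close>, with \<open>S = A i\<close> or its adjoint, plus a
  component in fresh coordinates whose Gram operator is \<open>1 - S\<^sup>* S\<close>. An operator with this Gram operator is written
  down without square roots, from the identity \<open>\<Sum>k. t^k (1 - t)\<^sup>2 = 1 - t\<close> (\<open>defect_has_sum\<close>).

  The weights come from subdividing trees (\<open>tree_weight_subdivision\<close>). Doubling all points of an induced tree and adding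
  the six neighbours of every doubled point gives an induced tree again: points that were adjacent now share a midpoint.
  If the old tree has weights with correlation \<open>\<kappa>\<close>, then putting \<open>c p\<close> on doubled points and a multiple of
  \<open>c p + c q\<close> on the midpoint of \<open>p\<close> and \<open>q\<close>, with the squares of the two kinds of weights adding up to the same
  total, gives the correlation \<open>sqrt (6 + 6 \<kappa>) / 6\<close>. Starting from a single point, three subdivisions reach
  \<open>1 / \<kappa> = 6 / sqrt (6 + sqrt (6 + sqrt 6)) \<approx> 2.0104\<close>, which is below the bound of the theorem. (The fixed point of
  the recursion is \<open>\<kappa> = 1 / 2\<close>, so that further subdivisions give constants arbitrarily close to \<open>2\<close>.)

  The operators live on families with values in the dual \<open>H'\<close> of \<open>H\<close>, the bounded antilinear functionals, in which \<open>H\<close>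
  embeds by \<open>x \<mapsto> \<langle>\<cdot>, x\<rangle>\<close> and to which contractions extend. The dual is complete, and as its elements are functions
  from \<open>'a\<close> to the complex numbers, countable families of them are functions on \<open>nat \<times> 'a\<close>.
\<close>

section \<open>Inner product modules\<close>

lemma complex_ring_simps [simp]:
  "carrier complex_ring = UNIV" "a \<otimes>\<^bsub>complex_ring\<^esub> b = a * b" "a \<oplus>\<^bsub>complex_ring\<^esub> b = a + b"
  "\<one>\<^bsub>complex_ring\<^esub> = 1" "\<zero>\<^bsub>complex_ring\<^esub> = 0"
  by (simp_all add: complex_ring_def)

lemma cring_complex_ring: "cring complex_ring"
proof (rule cringI)
  show "abelian_group complex_ring"
  proof (rule abelian_groupI)
    fix x assume "x \<in> carrier complex_ring"
    show "\<exists>y\<in>carrier complex_ring. y \<oplus>\<^bsub>complex_ring\<^esub> x = \<zero>\<^bsub>complex_ring\<^esub>"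
      by (rule bexI[of _ "- x"]) auto
  qed auto
  show "comm_monoid complex_ring"
    by (rule comm_monoidI) auto
qed (auto simp: algebra_simps)

locale inner_product_module = module complex_ring H for H :: "'a inner_module" (structure) +
  assumes cinner_add_right:
      "\<lbrakk>x \<in> carrier H; y \<in> carrier H; z \<in> carrier H\<rbrakk>
        \<Longrightarrow> cinner H x (y \<oplus>\<^bsub>H\<^esub> z) = cinner H x y + cinner H x z"
    and cinner_smult_right:
      "\<lbrakk>x \<in> carrier H; y \<in> carrier H\<rbrakk> \<Longrightarrow> cinner H x (a \<odot>\<^bsub>H\<^esub> y) = a * cinner H x y"
    and cinner_commute:
      "\<lbrakk>x \<in> carrier H; y \<in> carrier H\<rbrakk> \<Longrightarrow> cinner H x y = cnj (cinner H y x)"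
    and cinner_pos:
      "\<lbrakk>x \<in> carrier H; x \<noteq> \<zero>\<^bsub>H\<^esub>\<rbrakk> \<Longrightarrow> 0 < Re (cinner H x x)"

lemma hilbert_space_inner_product_module:
  "complex_hilbert_space H \<Longrightarrow> inner_product_module H"
  unfolding complex_hilbert_space_def complex_hilbert_space_axioms_def
    inner_product_module_def inner_product_module_axioms_def by blast

context inner_product_module
begin

lemma smult_in_carrier [simp, intro]: "x \<in> carrier H \<Longrightarrow> a \<odot>\<^bsub>H\<^esub> x \<in> carrier H"
  by (rule smult_closed) auto

lemma minus_eq_smult: "x \<in> carrier H \<Longrightarrow> \<ominus>\<^bsub>H\<^esub> x = (-1) \<odot>\<^bsub>H\<^esub> x"
  using smult_l_distr[of "-1" 1 x] smult_one[of x] smult_l_null[of x]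
  by (intro minus_equality) auto

lemma diff_eq_smult: "x \<in> carrier H \<Longrightarrow> y \<in> carrier H \<Longrightarrow> x \<ominus>\<^bsub>H\<^esub> y = x \<oplus>\<^bsub>H\<^esub> (-1) \<odot>\<^bsub>H\<^esub> y"
  by (simp add: minus_eq_smult a_minus_def)

lemma diff_in_carrier [simp, intro]: "x \<in> carrier H \<Longrightarrow> y \<in> carrier H \<Longrightarrow> x \<ominus>\<^bsub>H\<^esub> y \<in> carrier H"
  by (rule minus_closed)

lemma cinner_add_left:
  assumes "x \<in> carrier H" "y \<in> carrier H" "z \<in> carrier H"
  shows "cinner H (x \<oplus>\<^bsub>H\<^esub> y) z = cinner H x z + cinner H y z"
proof -
  have "cinner H (x \<oplus>\<^bsub>H\<^esub> y) z = cnj (cinner H z (x \<oplus>\<^bsub>H\<^esub> y))"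
    using assms by (intro cinner_commute) auto
  also have "\<dots> = cnj (cinner H z x) + cnj (cinner H z y)"
    using assms by (simp add: cinner_add_right)
  finally show ?thesis
    using assms cinner_commute[of x z] cinner_commute[of y z] by simp
qed

lemma cinner_smult_left:
  assumes "x \<in> carrier H" "y \<in> carrier H"
  shows "cinner H (a \<odot>\<^bsub>H\<^esub> x) y = cnj a * cinner H x y"
proof -
  have "cinner H (a \<odot>\<^bsub>H\<^esub> x) y = cnj (cinner H y (a \<odot>\<^bsub>H\<^esub> x))"
    using assms by (intro cinner_commute) auto
  then show ?thesis
    using assms cinner_commute[of x y] by (simp add: cinner_smult_right)
qed

lemma cinner_diff_right:
  "\<lbrakk>x \<in> carrier H; y \<in> carrier H; z \<in> carrier H\<rbrakk>
    \<Longrightarrow> cinner H x (y \<ominus>\<^bsub>H\<^esub> z) = cinner H x y - cinner H x z"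
  by (simp add: diff_eq_smult cinner_add_right cinner_smult_right)

lemma cinner_diff_left:
  "\<lbrakk>x \<in> carrier H; y \<in> carrier H; z \<in> carrier H\<rbrakk>
    \<Longrightarrow> cinner H (x \<ominus>\<^bsub>H\<^esub> y) z = cinner H x z - cinner H y z"
  by (simp add: diff_eq_smult cinner_add_left cinner_smult_left)

lemma cinner_zero_right [simp]: "x \<in> carrier H \<Longrightarrow> cinner H x \<zero>\<^bsub>H\<^esub> = 0"
  using cinner_smult_right[of x "\<zero>\<^bsub>H\<^esub>" 0] by simp

lemma cinner_zero_left [simp]: "x \<in> carrier H \<Longrightarrow> cinner H \<zero>\<^bsub>H\<^esub> x = 0"
  using cinner_smult_left[of "\<zero>\<^bsub>H\<^esub>" x 0] by simp

lemmas cinner_simps = cinner_add_right cinner_add_left cinner_smult_right cinner_smult_left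
  cinner_diff_right cinner_diff_left

lemma Re_cinner_nonneg: "x \<in> carrier H \<Longrightarrow> 0 \<le> Re (cinner H x x)"
  using cinner_pos[of x] by (cases "x = \<zero>\<^bsub>H\<^esub>") auto

lemma hnorm_nonneg: "x \<in> carrier H \<Longrightarrow> 0 \<le> hnorm H x"
  by (simp add: hnorm_def Re_cinner_nonneg)

lemma hnorm_sq: "x \<in> carrier H \<Longrightarrow> (hnorm H x)\<^sup>2 = Re (cinner H x x)"
  by (simp add: hnorm_def Re_cinner_nonneg)

lemma cinner_self: "x \<in> carrier H \<Longrightarrow> cinner H x x = of_real ((hnorm H x)\<^sup>2)"
  using cinner_commute[of x x] by (simp add: hnorm_sq complex_eq_iff)

lemma hnorm_zero [simp]: "hnorm H \<zero>\<^bsub>H\<^esub> = 0"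
  by (simp add: hnorm_def)

lemma hnorm_eq_0_iff: "x \<in> carrier H \<Longrightarrow> hnorm H x = 0 \<longleftrightarrow> x = \<zero>\<^bsub>H\<^esub>"
  using cinner_pos[of x] by (cases "x = \<zero>\<^bsub>H\<^esub>") (auto simp: hnorm_def)

lemma diff_eq_zero_iff:
  assumes "x \<in> carrier H" "y \<in> carrier H"
  shows "x \<ominus>\<^bsub>H\<^esub> y = \<zero>\<^bsub>H\<^esub> \<longleftrightarrow> x = y"
proof
  assume "x \<ominus>\<^bsub>H\<^esub> y = \<zero>\<^bsub>H\<^esub>"
  then show "x = y" using assms by (simp add: a_minus_def add.inv_solve_right')
qed (use assms in \<open>simp add: a_minus_def r_neg\<close>)

text \<open>Vectors are compared through their inner products, which turns vector identities into
  identities between complex numbers.\<close>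

lemma cinner_ext:
  assumes "x \<in> carrier H" "y \<in> carrier H" "\<And>z. z \<in> carrier H \<Longrightarrow> cinner H z x = cinner H z y"
  shows "x = y"
proof -
  have "cinner H (x \<ominus>\<^bsub>H\<^esub> y) (x \<ominus>\<^bsub>H\<^esub> y) = 0"
    using assms by (subst cinner_diff_right) auto
  then have "hnorm H (x \<ominus>\<^bsub>H\<^esub> y) = 0" by (simp add: hnorm_def)
  then show ?thesis using assms hnorm_eq_0_iff diff_eq_zero_iff by auto
qed

lemma hnorm_smult: "x \<in> carrier H \<Longrightarrow> hnorm H (a \<odot>\<^bsub>H\<^esub> x) = cmod a * hnorm H x"
proof -
  assume x: "x \<in> carrier H"
  have "cinner H (a \<odot>\<^bsub>H\<^esub> x) (a \<odot>\<^bsub>H\<^esub> x) = of_real ((cmod a)\<^sup>2) * cinner H x x"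
    using x complex_norm_square[of a] by (simp add: cinner_simps)
  then have "(hnorm H (a \<odot>\<^bsub>H\<^esub> x))\<^sup>2 = (cmod a * hnorm H x)\<^sup>2"
    using x by (simp add: hnorm_sq power_mult_distrib)
  then show ?thesis by (rule power2_eq_imp_eq) (simp_all add: x hnorm_nonneg)
qed

lemma hnorm_add_sq:
  assumes "x \<in> carrier H" "y \<in> carrier H"
  shows "(hnorm H (x \<oplus>\<^bsub>H\<^esub> y))\<^sup>2 = (hnorm H x)\<^sup>2 + 2 * Re (cinner H x y) + (hnorm H y)\<^sup>2"
  using assms cinner_commute[of y x] by (simp add: hnorm_sq cinner_simps)

lemma hnorm_diff_sq:
  assumes "x \<in> carrier H" "y \<in> carrier H"
  shows "(hnorm H (x \<ominus>\<^bsub>H\<^esub> y))\<^sup>2 = (hnorm H x)\<^sup>2 - 2 * Re (cinner H x y) + (hnorm H y)\<^sup>2"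
  using assms cinner_commute[of y x] by (simp add: hnorm_sq cinner_simps)

lemma Cauchy_Schwarz:
  assumes "x \<in> carrier H" "y \<in> carrier H"
  shows "cmod (cinner H x y) \<le> hnorm H x * hnorm H y"
proof (cases "hnorm H y = 0")
  case True
  then show ?thesis using assms hnorm_eq_0_iff by simp
next
  case False
  define a where "a = cinner H y x / of_real ((hnorm H y)\<^sup>2)"
  have yx: "cinner H y x = cnj (cinner H x y)" using assms cinner_commute by blast
  have "0 \<le> Re (cinner H (x \<ominus>\<^bsub>H\<^esub> a \<odot>\<^bsub>H\<^esub> y) (x \<ominus>\<^bsub>H\<^esub> a \<odot>\<^bsub>H\<^esub> y))"
    using assms by (intro Re_cinner_nonneg) auto
  also have "cinner H (x \<ominus>\<^bsub>H\<^esub> a \<odot>\<^bsub>H\<^esub> y) (x \<ominus>\<^bsub>H\<^esub> a \<odot>\<^bsub>H\<^esub> y)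
      = cinner H x x - a * cinner H x y - cnj a * (cinner H y x - a * cinner H y y)"
    using assms by (simp add: cinner_simps algebra_simps)
  also have "cinner H y x - a * cinner H y y = 0"
    using False assms by (simp add: a_def cinner_self)
  also have "a * cinner H x y = of_real ((cmod (cinner H x y))\<^sup>2 / (hnorm H y)\<^sup>2)"
    using complex_norm_square[of "cinner H x y"] by (simp add: a_def yx mult.commute)
  finally have "(cmod (cinner H x y))\<^sup>2 / (hnorm H y)\<^sup>2 \<le> (hnorm H x)\<^sup>2"
    using assms by (simp add: cinner_self)
  then have "(cmod (cinner H x y))\<^sup>2 \<le> (hnorm H x * hnorm H y)\<^sup>2"
    using False by (simp add: divide_le_eq power_mult_distrib)
  then show ?thesis
    by (rule power2_le_imp_le) (simp add: assms hnorm_nonneg)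
qed

lemma hnorm_triangle:
  assumes "x \<in> carrier H" "y \<in> carrier H"
  shows "hnorm H (x \<oplus>\<^bsub>H\<^esub> y) \<le> hnorm H x + hnorm H y"
proof -
  have "Re (cinner H x y) \<le> hnorm H x * hnorm H y"
    using Cauchy_Schwarz[OF assms] complex_Re_le_cmod order_trans by blast
  then have "(hnorm H (x \<oplus>\<^bsub>H\<^esub> y))\<^sup>2 \<le> (hnorm H x + hnorm H y)\<^sup>2"
    using assms by (simp add: hnorm_add_sq power2_sum)
  then show ?thesis by (rule power2_le_imp_le) (simp add: assms hnorm_nonneg)
qed

lemma hnorm_diff_commute:
  assumes "x \<in> carrier H" "y \<in> carrier H"
  shows "hnorm H (x \<ominus>\<^bsub>H\<^esub> y) = hnorm H (y \<ominus>\<^bsub>H\<^esub> x)"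
  using assms cinner_commute[of y x]
  by (intro power2_eq_imp_eq[of "hnorm H (x \<ominus>\<^bsub>H\<^esub> y)"]) (simp_all add: hnorm_diff_sq hnorm_nonneg)

lemma hnorm_diff_triangle:
  assumes "x \<in> carrier H" "y \<in> carrier H" "z \<in> carrier H"
  shows "hnorm H (x \<ominus>\<^bsub>H\<^esub> z) \<le> hnorm H (x \<ominus>\<^bsub>H\<^esub> y) + hnorm H (y \<ominus>\<^bsub>H\<^esub> z)"
proof -
  have "x \<ominus>\<^bsub>H\<^esub> z = (x \<ominus>\<^bsub>H\<^esub> y) \<oplus>\<^bsub>H\<^esub> (y \<ominus>\<^bsub>H\<^esub> z)"
    using assms by (intro cinner_ext) (auto simp: cinner_simps)
  then show ?thesis using assms hnorm_triangle[of "x \<ominus>\<^bsub>H\<^esub> y" "y \<ominus>\<^bsub>H\<^esub> z"] by simp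
qed

lemma diff_zero [simp]: "x \<in> carrier H \<Longrightarrow> x \<ominus>\<^bsub>H\<^esub> \<zero>\<^bsub>H\<^esub> = x"
  by (rule cinner_ext) (auto simp: cinner_simps)

lemma hnorm_diff_le:
  assumes "x \<in> carrier H" "y \<in> carrier H"
  shows "\<bar>hnorm H x - hnorm H y\<bar> \<le> hnorm H (x \<ominus>\<^bsub>H\<^esub> y)"
  using assms hnorm_diff_triangle[of x y "\<zero>\<^bsub>H\<^esub>"] hnorm_diff_triangle[of y x "\<zero>\<^bsub>H\<^esub>"]
    hnorm_diff_commute[of x y]
  by simp

lemma cinner_diff_bound:
  assumes "x \<in> carrier H" "y \<in> carrier H" "x' \<in> carrier H" "y' \<in> carrier H"
  shows "cmod (cinner H x y - cinner H x' y')
    \<le> hnorm H (x \<ominus>\<^bsub>H\<^esub> x') * hnorm H y + hnorm H x' * hnorm H (y \<ominus>\<^bsub>H\<^esub> y')"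
proof -
  have "cinner H x y - cinner H x' y' = cinner H (x \<ominus>\<^bsub>H\<^esub> x') y + cinner H x' (y \<ominus>\<^bsub>H\<^esub> y')"
    using assms by (simp add: cinner_simps)
  then show ?thesis
    using assms norm_triangle_ineq[of "cinner H (x \<ominus>\<^bsub>H\<^esub> x') y" "cinner H x' (y \<ominus>\<^bsub>H\<^esub> y')"]
      Cauchy_Schwarz[of "x \<ominus>\<^bsub>H\<^esub> x'" y] Cauchy_Schwarz[of x' "y \<ominus>\<^bsub>H\<^esub> y'"]
    by (smt (verit) diff_in_carrier)
qed

end

text \<open>Completeness refers to norms of vectors of the carrier only, whereas a metric space in the sense of the library
  constrains its distance function on the whole type.\<close>

locale hilbert_module = inner_product_module H for H :: "'a inner_module" (structure) +
  assumes Cauchy_limit: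
    "\<lbrakk>\<And>n. s n \<in> carrier H; \<And>e. 0 < e \<Longrightarrow> \<exists>N::nat. \<forall>m\<ge>N. \<forall>n\<ge>N. hnorm H (s m \<ominus>\<^bsub>H\<^esub> s n) < e\<rbrakk>
      \<Longrightarrow> \<exists>x\<in>carrier H. (\<lambda>n. hnorm H (s n \<ominus>\<^bsub>H\<^esub> x)) \<longlonglongrightarrow> 0"

section \<open>The Riesz representation theorem\<close>

definition bounded_antilinear :: "'a inner_module \<Rightarrow> ('a \<Rightarrow> complex) \<Rightarrow> bool" where
  "bounded_antilinear H \<phi> \<longleftrightarrow>
     (\<forall>x\<in>carrier H. \<forall>y\<in>carrier H. \<phi> (x \<oplus>\<^bsub>H\<^esub> y) = \<phi> x + \<phi> y) \<and>
     (\<forall>a. \<forall>x\<in>carrier H. \<phi> (a \<odot>\<^bsub>H\<^esub> x) = cnj a * \<phi> x) \<and>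
     (\<exists>M. \<forall>x\<in>carrier H. cmod (\<phi> x) \<le> M * hnorm H x)"

text \<open>The vector \<open>x\<close> represents \<open>\<phi>\<close> up to an error \<open>e\<close> in the dual norm.\<close>

definition represents_within :: "'a inner_module \<Rightarrow> ('a \<Rightarrow> complex) \<Rightarrow> real \<Rightarrow> 'a \<Rightarrow> bool" where
  "represents_within H \<phi> e x \<longleftrightarrow>
     x \<in> carrier H \<and> (\<forall>y\<in>carrier H. cmod (\<phi> y - cinner H y x) \<le> e * hnorm H y)"

context inner_product_module
begin

text \<open>An almost-minimiser \<open>x\<close> of \<open>J x = \<parallel>x\<parallel>\<^sup>2 - 2 Re (\<phi> x)\<close> almost represents \<open>\<phi>\<close>: moving from \<open>x\<close> in the
  direction \<open>y\<close> lowers \<open>J\<close> by up to \<open>|\<phi> y - \<langle>y, x\<rangle>|\<^sup>2 / \<parallel>y\<parallel>\<^sup>2\<close>.\<close>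

lemma Riesz_approximate:
  assumes phi: "bounded_antilinear H \<phi>" and e: "0 < e"
  obtains x where "represents_within H \<phi> e x"
proof -
  from phi obtain M where add: "\<And>x y. x \<in> carrier H \<Longrightarrow> y \<in> carrier H \<Longrightarrow> \<phi> (x \<oplus>\<^bsub>H\<^esub> y) = \<phi> x + \<phi> y"
    and scale: "\<And>a x. x \<in> carrier H \<Longrightarrow> \<phi> (a \<odot>\<^bsub>H\<^esub> x) = cnj a * \<phi> x"
    and M: "\<And>x. x \<in> carrier H \<Longrightarrow> cmod (\<phi> x) \<le> M * hnorm H x"
    unfolding bounded_antilinear_def by blast
  define J where "J x = (hnorm H x)\<^sup>2 - 2 * Re (\<phi> x)" for x
  have lower: "- M\<^sup>2 \<le> J x" if x: "x \<in> carrier H" for x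
  proof -
    have "Re (\<phi> x) \<le> M * hnorm H x"
      using M[OF x] complex_Re_le_cmod order_trans by blast
    moreover have "0 \<le> (hnorm H x - M)\<^sup>2" by simp
    ultimately show ?thesis by (simp add: J_def power2_diff algebra_simps)
  qed
  have bdd: "bdd_below (J ` carrier H)" using lower by (auto intro!: bdd_belowI2)
  have ne: "J ` carrier H \<noteq> {}" by auto
  define m where "m = Inf (J ` carrier H)"
  have m: "m \<le> J x" if "x \<in> carrier H" for x
    unfolding m_def using that bdd by (intro cInf_lower) auto
  have "m < m + e\<^sup>2" using e by simp
  then obtain x where x: "x \<in> carrier H" "J x < m + e\<^sup>2"
    using cInf_lessD[OF ne, of "m + e\<^sup>2"] unfolding m_def by blast
  have "cmod (\<phi> y - cinner H y x) \<le> e * hnorm H y" if y: "y \<in> carrier H" for y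
  proof (cases "hnorm H y = 0")
    case True
    then have "y = \<zero>\<^bsub>H\<^esub>" using y hnorm_eq_0_iff by simp
    then have "cmod (\<phi> y) \<le> 0" using M[OF y] True by simp
    with \<open>y = \<zero>\<^bsub>H\<^esub>\<close> x show ?thesis by simp
  next
    case False
    define w where "w = cinner H y x - \<phi> y"
    define t where "t = - w / of_real ((hnorm H y)\<^sup>2)"
    have "m \<le> J (x \<oplus>\<^bsub>H\<^esub> t \<odot>\<^bsub>H\<^esub> y)" using x y by (intro m) auto
    also have "J (x \<oplus>\<^bsub>H\<^esub> t \<odot>\<^bsub>H\<^esub> y) = J x + 2 * Re (cnj t * w) + (cmod t)\<^sup>2 * (hnorm H y)\<^sup>2"
      using x y cinner_commute[of x y]
      by (simp add: J_def hnorm_add_sq hnorm_smult add scale w_def cinner_simps power_mult_distrib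
          algebra_simps)
    also have "Re (cnj t * w) = - (cmod w)\<^sup>2 / (hnorm H y)\<^sup>2"
    proof -
      have "cnj t * w = - of_real ((cmod w)\<^sup>2 / (hnorm H y)\<^sup>2)"
        using complex_norm_square[of w] by (simp add: t_def mult.commute)
      then show ?thesis by simp
    qed
    also have "(cmod t)\<^sup>2 * (hnorm H y)\<^sup>2 = (cmod w)\<^sup>2 / (hnorm H y)\<^sup>2"
      using False by (simp add: t_def norm_divide power_divide norm_power field_simps flip: of_real_power)
    finally have "(cmod w)\<^sup>2 / (hnorm H y)\<^sup>2 < e\<^sup>2" using x by simp
    then have "(cmod w)\<^sup>2 < (e * hnorm H y)\<^sup>2" using False by (simp add: divide_less_eq power_mult_distrib)
    then have "cmod w \<le> e * hnorm H y"
      using e hnorm_nonneg[OF y] by (intro power2_le_imp_le[of "cmod w"]) (simp_all only: less_imp_le zero_le_mult_iff simp_thms)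
    then show ?thesis by (simp add: w_def norm_minus_commute)
  qed
  then show ?thesis using that x unfolding represents_within_def by blast
qed

text \<open>Test the two representations on the vector \<open>x - y\<close> itself.\<close>

lemma represents_within_close:
  assumes "represents_within H \<phi> d x" "represents_within H \<phi> e y"
    and d: "0 \<le> d" and e: "0 \<le> e"
  shows "hnorm H (x \<ominus>\<^bsub>H\<^esub> y) \<le> d + e"
proof -
  define z where "z = x \<ominus>\<^bsub>H\<^esub> y"
  have in_H: "x \<in> carrier H" "y \<in> carrier H" "z \<in> carrier H"
    using assms by (auto simp: represents_within_def z_def)
  have "of_real ((hnorm H z)\<^sup>2) = (\<phi> z - cinner H z y) - (\<phi> z - cinner H z x)"
    using in_H unfolding cinner_self[OF in_H(3), symmetric] by (simp add: z_def cinner_simps)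
  then have "(hnorm H z)\<^sup>2 \<le> cmod (\<phi> z - cinner H z y) + cmod (\<phi> z - cinner H z x)"
    by (metis norm_of_real abs_power2 norm_triangle_ineq4)
  also have "\<dots> \<le> e * hnorm H z + d * hnorm H z"
    using assms in_H unfolding represents_within_def by (intro add_mono) auto
  finally have "hnorm H z * hnorm H z \<le> (d + e) * hnorm H z" by (simp add: power2_eq_square algebra_simps)
  then show ?thesis
    using d e hnorm_nonneg[OF in_H(3)] unfolding z_def[symmetric]
    by (cases "hnorm H z = 0") (auto simp: mult_le_cancel_right)
qed

end

section \<open>The dual of an inner product module\<close>

text \<open>Vectors that converge to \<open>\<phi>\<close> in the dual norm. They are used to define the inner product of functionals as a
  limit of inner products.\<close>

definition dual_seq :: "'a inner_module \<Rightarrow> ('a \<Rightarrow> complex) \<Rightarrow> nat \<Rightarrow> 'a" where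
  "dual_seq H \<phi> n = (SOME x. represents_within H \<phi> (1 / Suc n) x)"

text \<open>Functionals vanish off the carrier, so that equal functionals are equal functions.\<close>

definition dual_space :: "'a inner_module \<Rightarrow> ('a \<Rightarrow> complex) inner_module" where
  "dual_space H =
    \<lparr>carrier = {\<phi>. bounded_antilinear H \<phi> \<and> (\<forall>y. y \<notin> carrier H \<longrightarrow> \<phi> y = 0)},
     mult = undefined, one = undefined, zero = (\<lambda>_. 0), add = (\<lambda>\<phi> \<psi> y. \<phi> y + \<psi> y),
     smult = (\<lambda>a \<phi> y. a * \<phi> y),
     cinner = (\<lambda>\<phi> \<psi>. lim (\<lambda>n. cinner H (dual_seq H \<phi> n) (dual_seq H \<psi> n)))\<rparr>"

definition dual_embedding :: "'a inner_module \<Rightarrow> 'a \<Rightarrow> 'a \<Rightarrow> complex" where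
  "dual_embedding H x y = (if y \<in> carrier H then cinner H y x else 0)"

lemma dual_space_simps [simp]:
  "\<zero>\<^bsub>dual_space H\<^esub> = (\<lambda>_. 0)"
  "\<phi> \<oplus>\<^bsub>dual_space H\<^esub> \<psi> = (\<lambda>y. \<phi> y + \<psi> y)"
  "a \<odot>\<^bsub>dual_space H\<^esub> \<phi> = (\<lambda>y. a * \<phi> y)"
  by (simp_all add: dual_space_def)

lemma dual_carrier_iff:
  "\<phi> \<in> carrier (dual_space H) \<longleftrightarrow> bounded_antilinear H \<phi> \<and> (\<forall>y. y \<notin> carrier H \<longrightarrow> \<phi> y = 0)"
  by (simp add: dual_space_def)

lemma bounded_antilinearI:
  assumes "\<And>x y. x \<in> carrier H \<Longrightarrow> y \<in> carrier H \<Longrightarrow> \<phi> (x \<oplus>\<^bsub>H\<^esub> y) = \<phi> x + \<phi> y"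
    and "\<And>a x. x \<in> carrier H \<Longrightarrow> \<phi> (a \<odot>\<^bsub>H\<^esub> x) = cnj a * \<phi> x"
    and "\<And>x. x \<in> carrier H \<Longrightarrow> cmod (\<phi> x) \<le> M * hnorm H x"
  shows "bounded_antilinear H \<phi>"
  using assms unfolding bounded_antilinear_def by blast

lemma bounded_antilinear_add:
  assumes "bounded_antilinear H \<phi>" "bounded_antilinear H \<psi>"
  shows "bounded_antilinear H (\<lambda>y. \<phi> y + \<psi> y)"
proof -
  obtain M where M: "\<And>x. x \<in> carrier H \<Longrightarrow> cmod (\<phi> x) \<le> M * hnorm H x"
    using assms(1) unfolding bounded_antilinear_def by blast
  obtain N where N: "\<And>x. x \<in> carrier H \<Longrightarrow> cmod (\<psi> x) \<le> N * hnorm H x"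
    using assms(2) unfolding bounded_antilinear_def by blast
  show ?thesis
  proof (rule bounded_antilinearI)
    show "cmod (\<phi> x + \<psi> x) \<le> (M + N) * hnorm H x" if "x \<in> carrier H" for x
      using M[OF that] N[OF that] norm_triangle_ineq[of "\<phi> x" "\<psi> x"] by (simp add: algebra_simps)
  qed (use assms in \<open>auto simp: bounded_antilinear_def algebra_simps\<close>)
qed

lemma bounded_antilinear_mult:
  assumes "bounded_antilinear H \<phi>"
  shows "bounded_antilinear H (\<lambda>y. a * \<phi> y)"
proof -
  obtain M where M: "\<And>x. x \<in> carrier H \<Longrightarrow> cmod (\<phi> x) \<le> M * hnorm H x"
    using assms unfolding bounded_antilinear_def by blast
  show ?thesis
  proof (rule bounded_antilinearI)
    show "cmod (a * \<phi> x) \<le> (cmod a * M) * hnorm H x" if "x \<in> carrier H" for x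
      using M[OF that] by (simp add: norm_mult mult.assoc mult_left_mono)
  qed (use assms in \<open>auto simp: bounded_antilinear_def algebra_simps\<close>)
qed

context inner_product_module
begin

lemma represents_within_add:
  assumes "represents_within H \<phi> d x" "represents_within H \<psi> e y"
  shows "represents_within H (\<lambda>z. \<phi> z + \<psi> z) (d + e) (x \<oplus>\<^bsub>H\<^esub> y)"
  unfolding represents_within_def
proof (intro conjI ballI)
  have xy: "x \<in> carrier H" "y \<in> carrier H" using assms by (auto simp: represents_within_def)
  then show "x \<oplus>\<^bsub>H\<^esub> y \<in> carrier H" by simp
  fix z assume z: "z \<in> carrier H"
  have "\<phi> z + \<psi> z - cinner H z (x \<oplus>\<^bsub>H\<^esub> y) = (\<phi> z - cinner H z x) + (\<psi> z - cinner H z y)"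
    using xy z by (simp add: cinner_simps)
  moreover have "cmod (\<phi> z - cinner H z x) \<le> d * hnorm H z" "cmod (\<psi> z - cinner H z y) \<le> e * hnorm H z"
    using assms z by (auto simp: represents_within_def)
  ultimately show "cmod (\<phi> z + \<psi> z - cinner H z (x \<oplus>\<^bsub>H\<^esub> y)) \<le> (d + e) * hnorm H z"
    using norm_triangle_ineq[of "\<phi> z - cinner H z x" "\<psi> z - cinner H z y"] by (simp add: algebra_simps)
qed

lemma represents_within_smult:
  assumes "represents_within H \<phi> e x"
  shows "represents_within H (\<lambda>z. a * \<phi> z) (cmod a * e) (a \<odot>\<^bsub>H\<^esub> x)"
  unfolding represents_within_def
proof (intro conjI ballI)
  have x: "x \<in> carrier H" using assms by (auto simp: represents_within_def)
  then show "a \<odot>\<^bsub>H\<^esub> x \<in> carrier H" by simp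
  fix z assume z: "z \<in> carrier H"
  have "a * \<phi> z - cinner H z (a \<odot>\<^bsub>H\<^esub> x) = a * (\<phi> z - cinner H z x)"
    using x z by (simp add: cinner_simps algebra_simps)
  then show "cmod (a * \<phi> z - cinner H z (a \<odot>\<^bsub>H\<^esub> x)) \<le> cmod a * e * hnorm H z"
    using assms z by (auto simp: represents_within_def norm_mult mult.assoc intro!: mult_left_mono)
qed

definition represented_by :: "('a \<Rightarrow> complex) \<Rightarrow> (nat \<Rightarrow> 'a) \<Rightarrow> bool" where
  "represented_by \<phi> x \<longleftrightarrow> (\<exists>e. e \<longlonglongrightarrow> 0 \<and> (\<forall>n. 0 \<le> e n \<and> represents_within H \<phi> (e n) (x n)))"

lemma represented_byI:
  "e \<longlonglongrightarrow> 0 \<Longrightarrow> (\<And>n. 0 \<le> e n) \<Longrightarrow> (\<And>n. represents_within H \<phi> (e n) (x n)) \<Longrightarrow> represented_by \<phi> x"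
  unfolding represented_by_def by blast

lemma represented_by_carrier: "represented_by \<phi> x \<Longrightarrow> x n \<in> carrier H"
  by (auto simp: represented_by_def represents_within_def)

lemma represented_by_dual_seq:
  assumes "bounded_antilinear H \<phi>"
  shows "represented_by \<phi> (dual_seq H \<phi>)"
proof (rule represented_byI)
  show "(\<lambda>n. 1 / real (Suc n)) \<longlonglongrightarrow> 0" by (rule LIMSEQ_Suc[OF lim_1_over_n])
  show "represents_within H \<phi> (1 / real (Suc n)) (dual_seq H \<phi> n)" for n
  proof -
    obtain x where "represents_within H \<phi> (1 / Suc n) x"
      by (rule Riesz_approximate[OF assms, of "1 / Suc n"]) auto
    then show ?thesis unfolding dual_seq_def by (rule someI)
  qed
qed simp

lemma represented_by_const:
  "x \<in> carrier H \<Longrightarrow> represented_by (dual_embedding H x) (\<lambda>_. x)"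
  by (rule represented_byI[of "\<lambda>_. 0"]) (auto simp: represents_within_def dual_embedding_def)

lemma represented_by_add:
  assumes "represented_by \<phi> x" "represented_by \<psi> y"
  shows "represented_by (\<lambda>z. \<phi> z + \<psi> z) (\<lambda>n. x n \<oplus>\<^bsub>H\<^esub> y n)"
proof -
  from assms obtain d e where d: "d \<longlonglongrightarrow> 0" "\<And>n. 0 \<le> d n" "\<And>n. represents_within H \<phi> (d n) (x n)"
    and e: "e \<longlonglongrightarrow> 0" "\<And>n. 0 \<le> e n" "\<And>n. represents_within H \<psi> (e n) (y n)"
    unfolding represented_by_def by blast
  show ?thesis
    by (rule represented_byI[of "\<lambda>n. d n + e n"])
      (use d e tendsto_add[OF d(1) e(1)] in \<open>auto intro: represents_within_add\<close>)
qed

lemma represented_by_smult: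
  assumes "represented_by \<phi> x"
  shows "represented_by (\<lambda>z. a * \<phi> z) (\<lambda>n. a \<odot>\<^bsub>H\<^esub> x n)"
proof -
  from assms obtain e where e: "e \<longlonglongrightarrow> 0" "\<And>n. 0 \<le> e n" "\<And>n. represents_within H \<phi> (e n) (x n)"
    unfolding represented_by_def by blast
  show ?thesis
    by (rule represented_byI[of "\<lambda>n. cmod a * e n"])
      (use e tendsto_mult_right_zero[OF e(1)] in \<open>auto intro: represents_within_smult\<close>)
qed

lemma represented_by_bounded:
  assumes "represented_by \<phi> x"
  obtains C where "0 \<le> C" "\<And>n. hnorm H (x n) \<le> C"
proof -
  from assms obtain e where e: "e \<longlonglongrightarrow> 0" "\<And>n. 0 \<le> e n" "\<And>n. represents_within H \<phi> (e n) (x n)"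
    unfolding represented_by_def by blast
  obtain E where E: "\<And>n. e n \<le> E"
    using convergent_imp_Bseq[OF convergentI[OF e(1)]] unfolding Bseq_def by (auto intro: order_trans[OF abs_ge_self])
  have "hnorm H (x n) \<le> (E + E) + hnorm H (x 0)" for n
  proof -
    have "hnorm H (x n) - hnorm H (x 0) \<le> hnorm H (x n \<ominus>\<^bsub>H\<^esub> x 0)"
      using hnorm_diff_le[of "x n" "x 0"] represented_by_carrier[OF assms] by (simp add: abs_le_iff)
    also have "\<dots> \<le> e n + e 0" using e by (intro represents_within_close) auto
    finally show ?thesis using E[of n] E[of 0] by simp
  qed
  moreover have "0 \<le> (E + E) + hnorm H (x 0)"
    using E[of 0] e(2)[of 0] hnorm_nonneg[OF represented_by_carrier[OF assms, of 0]] by simp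
  ultimately show ?thesis using that by blast
qed

text \<open>Along approximating sequences the inner products form a Cauchy sequence, and two choices of the sequences
  give the same limit; both follow from one estimate.\<close>

lemma cinner_represented_close:
  assumes x: "represented_by \<phi> x" and y: "represented_by \<psi> y"
    and x': "represented_by \<phi> x'" and y': "represented_by \<psi> y'"
  obtains f where "f \<longlonglongrightarrow> 0"
    "\<And>m n. cmod (cinner H (x m) (y m) - cinner H (x' n) (y' n)) \<le> f m + f n"
proof -
  obtain C where C: "0 \<le> C" "\<And>n. hnorm H (y n) \<le> C" using represented_by_bounded[OF y] by metis
  obtain D where D: "0 \<le> D" "\<And>n. hnorm H (x' n) \<le> D" using represented_by_bounded[OF x'] by metis
  from x obtain d where d: "d \<longlonglongrightarrow> 0" "\<And>n. 0 \<le> d n" "\<And>n. represents_within H \<phi> (d n) (x n)"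
    unfolding represented_by_def by blast
  from y obtain e where e: "e \<longlonglongrightarrow> 0" "\<And>n. 0 \<le> e n" "\<And>n. represents_within H \<psi> (e n) (y n)"
    unfolding represented_by_def by blast
  from x' obtain d' where d': "d' \<longlonglongrightarrow> 0" "\<And>n. 0 \<le> d' n" "\<And>n. represents_within H \<phi> (d' n) (x' n)"
    unfolding represented_by_def by blast
  from y' obtain e' where e': "e' \<longlonglongrightarrow> 0" "\<And>n. 0 \<le> e' n" "\<And>n. represents_within H \<psi> (e' n) (y' n)"
    unfolding represented_by_def by blast
  define f where "f n = (d n + d' n) * C + D * (e n + e' n)" for n
  have "cmod (cinner H (x m) (y m) - cinner H (x' n) (y' n)) \<le> f m + f n" for m n
  proof -
    have "cmod (cinner H (x m) (y m) - cinner H (x' n) (y' n))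
        \<le> hnorm H (x m \<ominus>\<^bsub>H\<^esub> x' n) * hnorm H (y m) + hnorm H (x' n) * hnorm H (y m \<ominus>\<^bsub>H\<^esub> y' n)"
      by (intro cinner_diff_bound represented_by_carrier[OF x] represented_by_carrier[OF y]
          represented_by_carrier[OF x'] represented_by_carrier[OF y'])
    also have "\<dots> \<le> (d m + d' n) * C + D * (e m + e' n)"
      using C D d e d' e' represented_by_carrier[OF x'] represented_by_carrier[OF y]
        represented_by_carrier[OF x] represented_by_carrier[OF y']
      by (intro add_mono mult_mono represents_within_close hnorm_nonneg) auto
    also have "\<dots> \<le> f m + f n"
    proof -
      have "0 \<le> d' m * C" "0 \<le> d n * C" "0 \<le> D * e' m" "0 \<le> D * e n"
        using C(1) D(1) d(2) e(2) d'(2) e'(2) by simp_all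
      then show ?thesis by (simp add: f_def algebra_simps)
    qed
    finally show ?thesis .
  qed
  moreover have "f \<longlonglongrightarrow> (0 + 0) * C + D * (0 + 0)"
    unfolding f_def by (intro tendsto_intros d e d' e')
  ultimately show ?thesis using that[of f] by simp
qed

lemma cinner_dual:
  assumes "represented_by \<phi> x" "represented_by \<psi> y"
    and "\<phi> \<in> carrier (dual_space H)" "\<psi> \<in> carrier (dual_space H)"
  shows "(\<lambda>n. cinner H (x n) (y n)) \<longlonglongrightarrow> cinner (dual_space H) \<phi> \<psi>"
proof -
  let ?x = "dual_seq H \<phi>" and ?y = "dual_seq H \<psi>"
  have r: "represented_by \<phi> ?x" "represented_by \<psi> ?y"
    using assms by (auto simp: dual_carrier_iff intro: represented_by_dual_seq)
  have "Cauchy (\<lambda>n. cinner H (?x n) (?y n))"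
  proof (rule CauchyI)
    obtain f where f: "f \<longlonglongrightarrow> 0" "\<And>m n. cmod (cinner H (?x m) (?y m) - cinner H (?x n) (?y n)) \<le> f m + f n"
      using cinner_represented_close[OF r r] by blast
    fix e :: real assume "0 < e"
    then obtain N where N: "\<And>n. n \<ge> N \<Longrightarrow> \<bar>f n\<bar> < e / 2" using LIMSEQ_D[OF f(1), of "e / 2"] by auto
    have "cmod (cinner H (?x m) (?y m) - cinner H (?x n) (?y n)) < e" if "m \<ge> N" "n \<ge> N" for m n
      using f(2)[of m n] N[OF that(1)] N[OF that(2)] by linarith
    then show "\<exists>N. \<forall>m\<ge>N. \<forall>n\<ge>N. cmod (cinner H (?x m) (?y m) - cinner H (?x n) (?y n)) < e" by blast
  qed
  then have lim: "(\<lambda>n. cinner H (?x n) (?y n)) \<longlonglongrightarrow> cinner (dual_space H) \<phi> \<psi>"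
    by (simp add: Cauchy_convergent_iff convergent_LIMSEQ_iff dual_space_def)
  obtain f where f: "f \<longlonglongrightarrow> 0" "\<And>m n. cmod (cinner H (x m) (y m) - cinner H (?x n) (?y n)) \<le> f m + f n"
    using cinner_represented_close[OF assms(1,2) r] by blast
  have "(\<lambda>n. cinner H (x n) (y n) - cinner H (?x n) (?y n)) \<longlonglongrightarrow> 0"
  proof (rule Lim_null_comparison)
    show "\<forall>\<^sub>F n in sequentially. cmod (cinner H (x n) (y n) - cinner H (?x n) (?y n)) \<le> f n + f n"
      by (intro always_eventually allI f(2))
    show "(\<lambda>n. f n + f n) \<longlonglongrightarrow> 0" using tendsto_add[OF f(1) f(1)] by simp
  qed
  from tendsto_add[OF lim this] show ?thesis by simp
qed

lemma dual_embedding_carrier: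
  assumes "x \<in> carrier H"
  shows "dual_embedding H x \<in> carrier (dual_space H)"
  unfolding dual_carrier_iff
proof
  show "bounded_antilinear H (dual_embedding H x)"
    using assms Cauchy_Schwarz[OF _ assms]
    by (intro bounded_antilinearI[of _ _ "hnorm H x"])
      (auto simp: dual_embedding_def cinner_simps mult.commute)
qed (simp add: dual_embedding_def)

lemma dual_module: "module complex_ring (dual_space H)"
proof (rule moduleI[OF cring_complex_ring])
  note mem = dual_carrier_iff bounded_antilinear_add bounded_antilinear_mult
  have zero: "(\<lambda>_. 0) \<in> carrier (dual_space H)"
    by (auto simp: dual_carrier_iff intro!: bounded_antilinearI[of _ _ 0])
  show "abelian_group (dual_space H)"
  proof (rule abelian_groupI)
    fix \<phi> assume "\<phi> \<in> carrier (dual_space H)"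
    then show "\<exists>\<psi>\<in>carrier (dual_space H). \<psi> \<oplus>\<^bsub>dual_space H\<^esub> \<phi> = \<zero>\<^bsub>dual_space H\<^esub>"
      by (intro bexI[of _ "\<lambda>y. (-1) * \<phi> y"]) (auto simp: mem intro: bounded_antilinear_mult[of _ _ "-1", simplified])
  qed (use zero in \<open>auto simp: mem algebra_simps\<close>)
qed (auto simp: dual_carrier_iff bounded_antilinear_mult algebra_simps)

text \<open>All axioms are inherited from \<open>H\<close> by passing to limits along approximating sequences.\<close>

lemma dual_inner_product_module: "inner_product_module (dual_space H)"
  unfolding inner_product_module_def inner_product_module_axioms_def
proof (intro conjI allI impI dual_module)
  interpret D: module complex_ring "dual_space H" by (rule dual_module)
  let ?D = "dual_space H"
  have smult: "a \<odot>\<^bsub>?D\<^esub> \<phi> \<in> carrier ?D" if "\<phi> \<in> carrier ?D" for a \<phi>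
    using that by (intro D.smult_closed) auto
  have rep: "represented_by \<phi> (dual_seq H \<phi>)" if "\<phi> \<in> carrier ?D" for \<phi>
    using that by (simp add: dual_carrier_iff represented_by_dual_seq)
  fix \<phi> \<psi> \<theta> assume \<phi>: "\<phi> \<in> carrier ?D"
  {
    assume \<psi>: "\<psi> \<in> carrier ?D" and \<theta>: "\<theta> \<in> carrier ?D"
    note in_H = represented_by_carrier[OF rep[OF \<phi>]] represented_by_carrier[OF rep[OF \<psi>]]
      represented_by_carrier[OF rep[OF \<theta>]]
    have "(\<lambda>n. cinner H (dual_seq H \<phi> n) (dual_seq H \<psi> n \<oplus>\<^bsub>H\<^esub> dual_seq H \<theta> n)) \<longlonglongrightarrow> cinner ?D \<phi> (\<psi> \<oplus>\<^bsub>?D\<^esub> \<theta>)"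
      using \<phi> \<psi> \<theta> represented_by_add[OF rep[OF \<psi>] rep[OF \<theta>]] D.a_closed[OF \<psi> \<theta>] by (intro cinner_dual rep) auto
    moreover have "(\<lambda>n. cinner H (dual_seq H \<phi> n) (dual_seq H \<psi> n) + cinner H (dual_seq H \<phi> n) (dual_seq H \<theta> n))
        \<longlonglongrightarrow> cinner ?D \<phi> \<psi> + cinner ?D \<phi> \<theta>"
      using \<phi> \<psi> \<theta> by (intro tendsto_add cinner_dual rep)
    ultimately show "cinner ?D \<phi> (\<psi> \<oplus>\<^bsub>?D\<^esub> \<theta>) = cinner ?D \<phi> \<psi> + cinner ?D \<phi> \<theta>"
      using in_H by (simp add: cinner_add_right LIMSEQ_unique)
  }
  {
    assume \<psi>: "\<psi> \<in> carrier ?D"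
    note in_H = represented_by_carrier[OF rep[OF \<phi>]] represented_by_carrier[OF rep[OF \<psi>]]
    have lim: "(\<lambda>n. cinner H (dual_seq H \<phi> n) (dual_seq H \<psi> n)) \<longlonglongrightarrow> cinner ?D \<phi> \<psi>"
      "(\<lambda>n. cinner H (dual_seq H \<psi> n) (dual_seq H \<phi> n)) \<longlonglongrightarrow> cinner ?D \<psi> \<phi>"
      using \<phi> \<psi> by (auto intro: cinner_dual rep)
    have "(\<lambda>n. cinner H (dual_seq H \<phi> n) (a \<odot>\<^bsub>H\<^esub> dual_seq H \<psi> n)) \<longlonglongrightarrow> cinner ?D \<phi> (a \<odot>\<^bsub>?D\<^esub> \<psi>)" for a
      using \<phi> \<psi> represented_by_smult[OF rep[OF \<psi>]] smult[OF \<psi>] by (intro cinner_dual rep) auto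
    with tendsto_mult_left[OF lim(1)] show "cinner ?D \<phi> (a \<odot>\<^bsub>?D\<^esub> \<psi>) = a * cinner ?D \<phi> \<psi>" for a
      using in_H LIMSEQ_unique by (fastforce simp: cinner_smult_right)
    have "cinner H (dual_seq H \<phi> n) (dual_seq H \<psi> n) = cnj (cinner H (dual_seq H \<psi> n) (dual_seq H \<phi> n))" for n
      using in_H by (intro cinner_commute) auto
    then show "cinner ?D \<phi> \<psi> = cnj (cinner ?D \<psi> \<phi>)"
      using lim(1) tendsto_cnj[OF lim(2)] by (simp add: LIMSEQ_unique)
  }
  {
    assume ne: "\<phi> \<noteq> \<zero>\<^bsub>?D\<^esub>"
    define x where "x = dual_seq H \<phi>"
    have x: "represented_by \<phi> x" using rep[OF \<phi>] by (simp add: x_def)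
    have x_in: "x n \<in> carrier H" for n using represented_by_carrier[OF x] .
    have lim: "(\<lambda>n. (hnorm H (x n))\<^sup>2) \<longlonglongrightarrow> Re (cinner ?D \<phi> \<phi>)"
      using tendsto_Re[OF cinner_dual[OF x x \<phi> \<phi>]] x_in by (simp add: hnorm_sq)
    show "0 < Re (cinner ?D \<phi> \<phi>)"
    proof (rule ccontr)
      assume "\<not> 0 < Re (cinner ?D \<phi> \<phi>)"
      moreover have "0 \<le> Re (cinner ?D \<phi> \<phi>)" using lim by (rule LIMSEQ_le_const) auto
      ultimately have "(\<lambda>n. sqrt ((hnorm H (x n))\<^sup>2)) \<longlonglongrightarrow> sqrt 0"
        using lim by (intro tendsto_real_sqrt) simp
      then have x0: "(\<lambda>n. hnorm H (x n)) \<longlonglongrightarrow> 0" using x_in by (simp add: hnorm_nonneg)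
      from x obtain e where e: "e \<longlonglongrightarrow> 0" "\<And>n. represents_within H \<phi> (e n) (x n)"
        unfolding represented_by_def by blast
      have "\<phi> y = 0" for y
      proof (cases "y \<in> carrier H")
        case y: True
        have "cmod (\<phi> y) \<le> e n * hnorm H y + hnorm H y * hnorm H (x n)" for n
        proof -
          have "cmod (\<phi> y) \<le> cmod (\<phi> y - cinner H y (x n)) + cmod (cinner H y (x n))"
            using norm_triangle_ineq[of "\<phi> y - cinner H y (x n)" "cinner H y (x n)"] by simp
          also have "\<dots> \<le> e n * hnorm H y + hnorm H y * hnorm H (x n)"
            using e(2)[of n] y x_in by (intro add_mono Cauchy_Schwarz) (auto simp: represents_within_def)
          finally show ?thesis .
        qed
        moreover have "(\<lambda>n. e n * hnorm H y + hnorm H y * hnorm H (x n)) \<longlonglongrightarrow> 0 * hnorm H y + hnorm H y * 0"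
          by (intro tendsto_intros e x0)
        ultimately have "cmod (\<phi> y) \<le> 0 * hnorm H y + hnorm H y * 0"
          by (intro LIMSEQ_le_const) auto
        then show ?thesis by simp
      qed (use \<phi> in \<open>simp add: dual_carrier_iff\<close>)
      then show False using ne by auto
    qed
  }
qed

text \<open>The reproducing property: the vector \<open>y\<close>, seen as a functional, evaluates functionals at \<open>y\<close>.\<close>

lemma cinner_dual_embedding:
  assumes "y \<in> carrier H" "\<phi> \<in> carrier (dual_space H)"
  shows "cinner (dual_space H) (dual_embedding H y) \<phi> = \<phi> y"
proof -
  obtain x where x: "represented_by \<phi> x"
    using assms by (auto simp: dual_carrier_iff intro: represented_by_dual_seq)
  obtain e where e: "e \<longlonglongrightarrow> 0" "\<And>n. represents_within H \<phi> (e n) (x n)"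
    using x unfolding represented_by_def by blast
  have "(\<lambda>n. cinner H y (x n)) \<longlonglongrightarrow> cinner (dual_space H) (dual_embedding H y) \<phi>"
    using assms x represented_by_const dual_embedding_carrier by (intro cinner_dual) auto
  moreover have "(\<lambda>n. cinner H y (x n) - \<phi> y) \<longlonglongrightarrow> 0"
  proof (rule Lim_null_comparison)
    show "\<forall>\<^sub>F n in sequentially. cmod (cinner H y (x n) - \<phi> y) \<le> e n * hnorm H y"
      using e(2) assms(1) by (auto simp: represents_within_def norm_minus_commute)
    show "(\<lambda>n. e n * hnorm H y) \<longlonglongrightarrow> 0" by (rule tendsto_mult_left_zero[OF e(1)])
  qed
  ultimately show ?thesis using LIMSEQ_unique Lim_transform by (metis Lim_null)
qed

lemma cinner_dual_embedding_both:
  assumes "x \<in> carrier H" "y \<in> carrier H"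
  shows "cinner (dual_space H) (dual_embedding H x) (dual_embedding H y) = cinner H x y"
  using assms cinner_dual_embedding[OF assms(1) dual_embedding_carrier[OF assms(2)]]
  by (simp add: dual_embedding_def)

lemma dual_norm_bound:
  assumes "\<phi> \<in> carrier (dual_space H)" "y \<in> carrier H"
  shows "cmod (\<phi> y) \<le> hnorm (dual_space H) \<phi> * hnorm H y"
proof -
  interpret D: inner_product_module "dual_space H" by (rule dual_inner_product_module)
  have "hnorm (dual_space H) (dual_embedding H y) = hnorm H y"
    using assms by (simp add: hnorm_def cinner_dual_embedding_both)
  then show ?thesis
    using D.Cauchy_Schwarz[OF dual_embedding_carrier[OF assms(2)] assms(1)] assms
    by (simp add: cinner_dual_embedding mult.commute)
qed

text \<open>Together with the previous lemma this identifies the Hilbert space norm of a functional with its dual norm.\<close>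

lemma dual_norm_least:
  assumes \<phi>: "\<phi> \<in> carrier (dual_space H)" and M: "0 \<le> M" "\<And>y. y \<in> carrier H \<Longrightarrow> cmod (\<phi> y) \<le> M * hnorm H y"
  shows "hnorm (dual_space H) \<phi> \<le> M"
proof -
  obtain x where x: "represented_by \<phi> x"
    using assms by (auto simp: dual_carrier_iff intro: represented_by_dual_seq)
  obtain e where e: "e \<longlonglongrightarrow> 0" "\<And>n. 0 \<le> e n" "\<And>n. represents_within H \<phi> (e n) (x n)"
    using x unfolding represented_by_def by blast
  have x_in: "x n \<in> carrier H" for n using represented_by_carrier[OF x] .
  have le: "hnorm H (x n) \<le> M + e n" for n
  proof -
    have "(hnorm H (x n))\<^sup>2 = cmod (cinner H (x n) (x n))"
      using x_in by (simp add: cinner_self norm_power hnorm_nonneg)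
    also have "\<dots> \<le> cmod (\<phi> (x n)) + cmod (\<phi> (x n) - cinner H (x n) (x n))"
      using norm_triangle_ineq4[of "\<phi> (x n)" "\<phi> (x n) - cinner H (x n) (x n)"] by simp
    also have "\<dots> \<le> M * hnorm H (x n) + e n * hnorm H (x n)"
      using e(3)[of n] M(2) x_in by (intro add_mono) (auto simp: represents_within_def)
    finally have "hnorm H (x n) * hnorm H (x n) \<le> (M + e n) * hnorm H (x n)"
      by (simp add: power2_eq_square algebra_simps)
    then show ?thesis
      using M(1) e(2)[of n] hnorm_nonneg[OF x_in, of n]
      by (cases "hnorm H (x n) = 0") (auto simp: mult_le_cancel_right)
  qed
  have "(\<lambda>n. sqrt (Re (cinner H (x n) (x n)))) \<longlonglongrightarrow> hnorm (dual_space H) \<phi>"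
    unfolding hnorm_def by (intro tendsto_real_sqrt tendsto_Re cinner_dual x \<phi>)
  moreover have "(\<lambda>n. M + e n) \<longlonglongrightarrow> M + 0" by (intro tendsto_intros e)
  ultimately show ?thesis
    using LIMSEQ_le[of "\<lambda>n. hnorm H (x n)" "hnorm (dual_space H) \<phi>" "\<lambda>n. M + e n" "M + 0"] le
    by (auto simp: hnorm_def)
qed

text \<open>A Cauchy sequence for the dual norm converges pointwise, uniformly on the unit ball.\<close>

theorem dual_hilbert_module: "hilbert_module (dual_space H)"
proof -
  interpret D: inner_product_module "dual_space H" by (rule dual_inner_product_module)
  let ?D = "dual_space H"
  show ?thesis
  proof (unfold_locales)
    fix s :: "nat \<Rightarrow> 'a \<Rightarrow> complex"
    assume s: "\<And>n. s n \<in> carrier ?D"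
      and Cauchy: "\<And>e. 0 < e \<Longrightarrow> \<exists>N. \<forall>m\<ge>N. \<forall>n\<ge>N. hnorm ?D (s m \<ominus>\<^bsub>?D\<^esub> s n) < e"
    have diff: "(s m \<ominus>\<^bsub>?D\<^esub> s n) y = s m y - s n y" for m n y
      using s by (simp add: D.diff_eq_smult)
    have bound: "cmod (s m y - s n y) \<le> hnorm ?D (s m \<ominus>\<^bsub>?D\<^esub> s n) * hnorm H y" if "y \<in> carrier H" for m n y
      using dual_norm_bound[OF D.diff_in_carrier[OF s s] that, of m n] by (simp add: diff)
    have conv: "convergent (\<lambda>n. s n y)" for y
    proof (cases "y \<in> carrier H")
      case y: True
      have "Cauchy (\<lambda>n. s n y)"
      proof (rule CauchyI)
        fix r :: real assume r: "0 < r"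
        have pos: "0 < r / (hnorm H y + 1)" using r hnorm_nonneg[OF y] by simp
        obtain N where N: "\<And>m n. m \<ge> N \<Longrightarrow> n \<ge> N \<Longrightarrow> hnorm ?D (s m \<ominus>\<^bsub>?D\<^esub> s n) < r / (hnorm H y + 1)"
          using Cauchy[OF pos] by blast
        have "cmod (s m y - s n y) < r" if "m \<ge> N" "n \<ge> N" for m n
        proof -
          have "cmod (s m y - s n y) \<le> r / (hnorm H y + 1) * hnorm H y"
            using bound[OF y, of m n] mult_right_mono[OF less_imp_le[OF N[OF that]] hnorm_nonneg[OF y]] by linarith
          also have "\<dots> < r" using r hnorm_nonneg[OF y] by (simp add: field_simps)
          finally show ?thesis .
        qed
        then show "\<exists>M. \<forall>m\<ge>M. \<forall>n\<ge>M. cmod (s m y - s n y) < r" by blast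
      qed
      then show ?thesis by (rule Cauchy_convergent)
    next
      case False
      then have "(\<lambda>n. s n y) = (\<lambda>_. 0)" using s by (auto simp: dual_carrier_iff)
      then show ?thesis by (simp add: convergent_const)
    qed
    define \<phi> where "\<phi> y = lim (\<lambda>n. s n y)" for y
    have lim: "(\<lambda>n. s n y) \<longlonglongrightarrow> \<phi> y" for y
      using conv[of y] by (simp add: convergent_LIMSEQ_iff \<phi>_def)
    have uniform: "\<exists>N. \<forall>n\<ge>N. \<forall>y\<in>carrier H. cmod (s n y - \<phi> y) \<le> e * hnorm H y" if "0 < e" for e
    proof -
      obtain N where N: "\<And>m n. m \<ge> N \<Longrightarrow> n \<ge> N \<Longrightarrow> hnorm ?D (s m \<ominus>\<^bsub>?D\<^esub> s n) < e"
        using Cauchy[OF \<open>0 < e\<close>] by blast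
      have "cmod (s n y - \<phi> y) \<le> e * hnorm H y" if n: "n \<ge> N" and y: "y \<in> carrier H" for n y
      proof (rule LIMSEQ_le_const2)
        show "(\<lambda>m. cmod (s n y - s m y)) \<longlonglongrightarrow> cmod (s n y - \<phi> y)"
          by (intro tendsto_intros lim)
        have "cmod (s n y - s m y) \<le> e * hnorm H y" if "m \<ge> N" for m
          using bound[OF y, of n m] mult_right_mono[OF less_imp_le[OF N[OF n that]] hnorm_nonneg[OF y]] by linarith
        then show "\<exists>N. \<forall>m\<ge>N. cmod (s n y - s m y) \<le> e * hnorm H y" by blast
      qed
      then show ?thesis by blast
    qed
    have \<phi>: "\<phi> \<in> carrier ?D"
      unfolding dual_carrier_iff
    proof
      have "\<phi> y = 0" if "y \<notin> carrier H" for y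
        using lim[of y] s that by (simp add: dual_carrier_iff LIMSEQ_const_iff)
      then show "\<forall>y. y \<notin> carrier H \<longrightarrow> \<phi> y = 0" by blast
      obtain N where N: "\<And>y. y \<in> carrier H \<Longrightarrow> cmod (s N y - \<phi> y) \<le> 1 * hnorm H y"
        using uniform[of 1] by auto
      have sN: "bounded_antilinear H (s n)" for n using s by (simp add: dual_carrier_iff)
      obtain M where M: "\<And>y. y \<in> carrier H \<Longrightarrow> cmod (s N y) \<le> M * hnorm H y"
        using sN[of N] unfolding bounded_antilinear_def by blast
      show "bounded_antilinear H \<phi>"
      proof (rule bounded_antilinearI[of _ _ "M + 1"])
        fix x y assume x: "x \<in> carrier H" and y: "y \<in> carrier H"
        have "(\<lambda>n. s n (x \<oplus>\<^bsub>H\<^esub> y)) = (\<lambda>n. s n x + s n y)"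
          using sN x y by (auto simp: bounded_antilinear_def)
        then show "\<phi> (x \<oplus>\<^bsub>H\<^esub> y) = \<phi> x + \<phi> y"
          using lim[of "x \<oplus>\<^bsub>H\<^esub> y"] tendsto_add[OF lim[of x] lim[of y]] by (simp add: LIMSEQ_unique)
      next
        fix a x assume x: "x \<in> carrier H"
        have "(\<lambda>n. s n (a \<odot>\<^bsub>H\<^esub> x)) = (\<lambda>n. cnj a * s n x)"
          using sN x by (auto simp: bounded_antilinear_def)
        then show "\<phi> (a \<odot>\<^bsub>H\<^esub> x) = cnj a * \<phi> x"
          using lim[of "a \<odot>\<^bsub>H\<^esub> x"] tendsto_mult_left[OF lim[of x], of "cnj a"] by (simp add: LIMSEQ_unique)
      next
        fix y assume y: "y \<in> carrier H"
        show "cmod (\<phi> y) \<le> (M + 1) * hnorm H y"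
          using M[OF y] N[OF y] norm_triangle_ineq4[of "s N y" "s N y - \<phi> y"] by (simp add: algebra_simps)
      qed
    qed
    have "(\<lambda>n. hnorm ?D (s n \<ominus>\<^bsub>?D\<^esub> \<phi>)) \<longlonglongrightarrow> 0"
    proof (rule LIMSEQ_I)
      fix r :: real assume r: "0 < r"
      obtain N where N: "\<And>n y. n \<ge> N \<Longrightarrow> y \<in> carrier H \<Longrightarrow> cmod (s n y - \<phi> y) \<le> r / 2 * hnorm H y"
        using uniform[of "r / 2"] r by auto
      have "hnorm ?D (s n \<ominus>\<^bsub>?D\<^esub> \<phi>) \<le> r / 2" if "n \<ge> N" for n
        using r N[OF that] s \<phi> D.diff_in_carrier[OF s \<phi>, of n] by (intro dual_norm_least) (auto simp: D.diff_eq_smult)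
      then show "\<exists>N. \<forall>n\<ge>N. norm (hnorm ?D (s n \<ominus>\<^bsub>?D\<^esub> \<phi>) - 0) < r"
        using r D.hnorm_nonneg[OF D.diff_in_carrier[OF s \<phi>]] by (intro exI[of _ N]) fastforce
    qed
    with \<phi> show "\<exists>x\<in>carrier ?D. (\<lambda>n. hnorm ?D (s n \<ominus>\<^bsub>?D\<^esub> x)) \<longlonglongrightarrow> 0" by blast
  qed
qed

end

section \<open>Bounded operators and their adjoints\<close>

definition adjoint_pair :: "'a inner_module \<Rightarrow> ('a \<Rightarrow> 'a) \<Rightarrow> ('a \<Rightarrow> 'a) \<Rightarrow> bool" where
  "adjoint_pair H S T \<longleftrightarrow> linear_op H H S \<and> linear_op H H T \<and>
     (\<forall>x\<in>carrier H. \<forall>y\<in>carrier H. cinner H (S x) y = cinner H x (T y))"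

lemma linear_op_carrier: "linear_op H K T \<Longrightarrow> x \<in> carrier H \<Longrightarrow> T x \<in> carrier K"
  by (auto simp: linear_op_def)

lemma linear_op_add:
  "linear_op H K T \<Longrightarrow> x \<in> carrier H \<Longrightarrow> y \<in> carrier H \<Longrightarrow> T (x \<oplus>\<^bsub>H\<^esub> y) = T x \<oplus>\<^bsub>K\<^esub> T y"
  by (auto simp: linear_op_def)

lemma linear_op_smult:
  "linear_op H K T \<Longrightarrow> x \<in> carrier H \<Longrightarrow> T (a \<odot>\<^bsub>H\<^esub> x) = a \<odot>\<^bsub>K\<^esub> T x"
  by (auto simp: linear_op_def)

lemma linear_opI:
  assumes "\<And>x. x \<in> carrier H \<Longrightarrow> T x \<in> carrier K"
    and "\<And>x y. x \<in> carrier H \<Longrightarrow> y \<in> carrier H \<Longrightarrow> T (x \<oplus>\<^bsub>H\<^esub> y) = T x \<oplus>\<^bsub>K\<^esub> T y"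
    and "\<And>a x. x \<in> carrier H \<Longrightarrow> T (a \<odot>\<^bsub>H\<^esub> x) = a \<odot>\<^bsub>K\<^esub> T x"
  shows "linear_op H K T"
  using assms unfolding linear_op_def by auto

lemma linear_op_compose:
  "linear_op H K S \<Longrightarrow> linear_op K L T \<Longrightarrow> linear_op H L (\<lambda>x. T (S x))"
  unfolding linear_op_def by (auto simp: Pi_iff)

lemma linear_op_diff:
  assumes "inner_product_module H" "inner_product_module K" "linear_op H K T" "x \<in> carrier H" "y \<in> carrier H"
  shows "T (x \<ominus>\<^bsub>H\<^esub> y) = T x \<ominus>\<^bsub>K\<^esub> T y"
proof -
  interpret H: inner_product_module H by fact
  interpret K: inner_product_module K by fact
  show ?thesis
    using assms by (simp add: H.diff_eq_smult K.diff_eq_smult linear_op_add linear_op_smult linear_op_carrier)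
qed

lemma adjoint_pairD:
  assumes "adjoint_pair H S T" "x \<in> carrier H" "y \<in> carrier H"
  shows "S x \<in> carrier H" "T x \<in> carrier H" "cinner H (S x) y = cinner H x (T y)"
  using assms by (auto simp: adjoint_pair_def linear_op_carrier)

lemma (in inner_product_module) adjoint_pair_swap:
  assumes "adjoint_pair H S T"
  shows "adjoint_pair H T S"
proof -
  have "cinner H (T x) y = cinner H x (S y)" if "x \<in> carrier H" "y \<in> carrier H" for x y
    using that adjoint_pairD[OF assms] cinner_commute[of "T x" y] cinner_commute[of x "S y"] by simp
  then show ?thesis using assms by (simp add: adjoint_pair_def)
qed

text \<open>The supremum that defines the operator norm is over a bounded set, as the operator is bounded.\<close>

lemma hnorm_le_opnorm:
  assumes H: "inner_product_module H" and T: "bounded_op H T" and x: "x \<in> carrier H" "hnorm H x \<le> 1"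
  shows "hnorm H (T x) \<le> opnorm H T"
proof -
  interpret inner_product_module H by fact
  from T obtain C where C: "\<And>x. x \<in> carrier H \<Longrightarrow> hnorm H (T x) \<le> C * hnorm H x"
    unfolding bounded_op_def by blast
  have "bdd_above {hnorm H (T x) | x. x \<in> carrier H \<and> hnorm H x \<le> 1}"
  proof (rule bdd_aboveI[of _ "\<bar>C\<bar>"])
    fix r assume "r \<in> {hnorm H (T x) | x. x \<in> carrier H \<and> hnorm H x \<le> 1}"
    then obtain y where y: "y \<in> carrier H" "hnorm H y \<le> 1" "r = hnorm H (T y)" by blast
    have "hnorm H (T y) \<le> \<bar>C\<bar> * hnorm H y"
      using C[OF y(1)] mult_right_mono[OF abs_ge_self hnorm_nonneg[OF y(1)], of C] by linarith
    also have "\<dots> \<le> \<bar>C\<bar>" using y(2) by (simp add: mult_left_le)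
    finally show "r \<le> \<bar>C\<bar>" using y(3) by simp
  qed
  then show ?thesis unfolding opnorm_def using x by (intro cSup_upper) auto
qed

lemma opnorm_nonneg:
  assumes H: "inner_product_module H" and T: "bounded_op H T"
  shows "0 \<le> opnorm H T"
proof -
  interpret inner_product_module H by fact
  have "T \<zero>\<^bsub>H\<^esub> \<in> carrier H" using T by (auto simp: bounded_op_def linear_op_carrier)
  then have "0 \<le> hnorm H (T \<zero>\<^bsub>H\<^esub>)" by (rule hnorm_nonneg)
  also have "\<dots> \<le> opnorm H T" using H T by (rule hnorm_le_opnorm) simp_all
  finally show ?thesis .
qed

lemma opnorm_bound:
  assumes H: "inner_product_module H" and T: "bounded_op H T" and x: "x \<in> carrier H"
  shows "hnorm H (T x) \<le> opnorm H T * hnorm H x"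
proof -
  interpret inner_product_module H by fact
  from T obtain C where lin: "linear_op H H T" and C: "\<And>x. x \<in> carrier H \<Longrightarrow> hnorm H (T x) \<le> C * hnorm H x"
    unfolding bounded_op_def by blast
  show ?thesis
  proof (cases "hnorm H x = 0")
    case True
    then show ?thesis using C[OF x] by simp
  next
    case False
    then have pos: "0 < hnorm H x" using hnorm_nonneg[OF x] by simp
    define y where "y = of_real (1 / hnorm H x) \<odot>\<^bsub>H\<^esub> x"
    have y: "y \<in> carrier H" "hnorm H y = 1" using x pos by (simp_all add: y_def hnorm_smult norm_divide)
    have "hnorm H (T y) \<le> opnorm H T" using H T y by (intro hnorm_le_opnorm) simp_all
    moreover have "hnorm H (T y) = hnorm H (T x) / hnorm H x"
      using x pos linear_op_carrier[OF lin x] by (simp add: y_def linear_op_smult[OF lin] hnorm_smult norm_divide)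
    ultimately show ?thesis using pos by (simp add: field_simps)
  qed
qed

lemma contraction_bound:
  assumes "inner_product_module H" "contraction H T" "x \<in> carrier H"
  shows "hnorm H (T x) \<le> hnorm H x"
proof -
  have "hnorm H (T x) \<le> opnorm H T * hnorm H x"
    using assms by (intro opnorm_bound) (auto simp: contraction_def)
  also have "\<dots> \<le> 1 * hnorm H x"
    using assms by (intro mult_right_mono inner_product_module.hnorm_nonneg) (auto simp: contraction_def)
  finally show ?thesis by simp
qed

context hilbert_module
begin

lemma Riesz_representation:
  assumes "bounded_antilinear H \<phi>"
  obtains z where "z \<in> carrier H" "\<And>y. y \<in> carrier H \<Longrightarrow> \<phi> y = cinner H y z"
proof -
  obtain x where "represented_by \<phi> x" using represented_by_dual_seq[OF assms] by blast
  then obtain e where e: "e \<longlonglongrightarrow> 0" "\<And>n. 0 \<le> e n" "\<And>n. represents_within H \<phi> (e n) (x n)"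
    unfolding represented_by_def by blast
  have x: "x n \<in> carrier H" for n using e(3)[of n] by (simp add: represents_within_def)
  have "\<exists>z\<in>carrier H. (\<lambda>n. hnorm H (x n \<ominus>\<^bsub>H\<^esub> z)) \<longlonglongrightarrow> 0"
  proof (rule Cauchy_limit)
    fix r :: real assume "0 < r"
    then obtain N where N: "\<And>n. n \<ge> N \<Longrightarrow> \<bar>e n\<bar> < r / 2" using LIMSEQ_D[OF e(1), of "r / 2"] by auto
    have "hnorm H (x m \<ominus>\<^bsub>H\<^esub> x n) < r" if "m \<ge> N" "n \<ge> N" for m n
      using represents_within_close[OF e(3) e(3) e(2) e(2), of m n] N[OF that(1)] N[OF that(2)] by linarith
    then show "\<exists>N. \<forall>m\<ge>N. \<forall>n\<ge>N. hnorm H (x m \<ominus>\<^bsub>H\<^esub> x n) < r" by blast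
  qed (rule x)
  then obtain z where z: "z \<in> carrier H" "(\<lambda>n. hnorm H (x n \<ominus>\<^bsub>H\<^esub> z)) \<longlonglongrightarrow> 0" by blast
  have "\<phi> y = cinner H y z" if y: "y \<in> carrier H" for y
  proof -
    have "cmod (\<phi> y - cinner H y z) \<le> e n * hnorm H y + hnorm H y * hnorm H (x n \<ominus>\<^bsub>H\<^esub> z)" for n
    proof -
      have "\<phi> y - cinner H y z = (\<phi> y - cinner H y (x n)) + cinner H y (x n \<ominus>\<^bsub>H\<^esub> z)"
        using y x z by (simp add: cinner_diff_right)
      then have "cmod (\<phi> y - cinner H y z) \<le> cmod (\<phi> y - cinner H y (x n)) + cmod (cinner H y (x n \<ominus>\<^bsub>H\<^esub> z))"
        by (metis norm_triangle_ineq)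
      also have "\<dots> \<le> e n * hnorm H y + hnorm H y * hnorm H (x n \<ominus>\<^bsub>H\<^esub> z)"
        using e(3)[of n] y x z by (intro add_mono Cauchy_Schwarz) (auto simp: represents_within_def)
      finally show ?thesis .
    qed
    moreover have "(\<lambda>n. e n * hnorm H y + hnorm H y * hnorm H (x n \<ominus>\<^bsub>H\<^esub> z)) \<longlonglongrightarrow> 0 * hnorm H y + hnorm H y * 0"
      by (intro tendsto_intros e z)
    ultimately have "cmod (\<phi> y - cinner H y z) \<le> 0 * hnorm H y + hnorm H y * 0"
      by (intro LIMSEQ_le_const) auto
    then show ?thesis by simp
  qed
  then show ?thesis using that z by blast
qed

text \<open>The vector \<open>T y\<close> represents the functional \<open>x \<mapsto> \<langle>S x, y\<rangle>\<close>.\<close>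

lemma adjoint_exists:
  assumes lin: "linear_op H H S" and M: "\<And>x. x \<in> carrier H \<Longrightarrow> hnorm H (S x) \<le> M * hnorm H x"
  obtains T where "adjoint_pair H S T"
proof -
  have "\<exists>z. z \<in> carrier H \<and> (\<forall>x\<in>carrier H. cinner H (S x) y = cinner H x z)" if y: "y \<in> carrier H" for y
  proof -
    have "bounded_antilinear H (\<lambda>x. cinner H (S x) y)"
    proof (rule bounded_antilinearI[of _ _ "M * hnorm H y"])
      fix x assume x: "x \<in> carrier H"
      have "cmod (cinner H (S x) y) \<le> hnorm H (S x) * hnorm H y"
        using x y lin by (intro Cauchy_Schwarz) (auto simp: linear_op_carrier)
      also have "\<dots> \<le> M * hnorm H x * hnorm H y"
        using M[OF x] hnorm_nonneg[OF y] by (rule mult_right_mono)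
      finally show "cmod (cinner H (S x) y) \<le> M * hnorm H y * hnorm H x" by (simp add: mult_ac)
    qed (use lin y in \<open>auto simp: linear_op_add linear_op_smult linear_op_carrier cinner_simps\<close>)
    then show ?thesis by (rule Riesz_representation) blast
  qed
  then obtain T where T: "\<And>y. y \<in> carrier H \<Longrightarrow> T y \<in> carrier H"
    "\<And>x y. y \<in> carrier H \<Longrightarrow> x \<in> carrier H \<Longrightarrow> cinner H (S x) y = cinner H x (T y)"
    by metis
  have S: "S x \<in> carrier H" if "x \<in> carrier H" for x using lin that by (rule linear_op_carrier)
  have "linear_op H H T"
  proof (rule linear_opI)
    show "T (x \<oplus>\<^bsub>H\<^esub> y) = T x \<oplus>\<^bsub>H\<^esub> T y" if "x \<in> carrier H" "y \<in> carrier H" for x y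
      using that T S by (intro cinner_ext) (auto simp: cinner_add_right simp flip: T(2))
    show "T (a \<odot>\<^bsub>H\<^esub> x) = a \<odot>\<^bsub>H\<^esub> T x" if "x \<in> carrier H" for a x
      using that T S by (intro cinner_ext) (auto simp: cinner_smult_right simp flip: T(2))
  qed (rule T)
  then show ?thesis using that lin T unfolding adjoint_pair_def by blast
qed

end

lemma (in inner_product_module) adjoint_bound:
  assumes adj: "adjoint_pair H S T" and S: "\<And>x. x \<in> carrier H \<Longrightarrow> hnorm H (S x) \<le> hnorm H x" and x: "x \<in> carrier H"
  shows "hnorm H (T x) \<le> hnorm H x"
proof -
  have Tx: "T x \<in> carrier H" "S (T x) \<in> carrier H" using adjoint_pairD[OF adj] x by blast+
  have "(hnorm H (T x))\<^sup>2 = Re (cinner H (S (T x)) x)"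
    using adjoint_pairD[OF adj Tx(1) x] Tx by (simp add: hnorm_sq)
  also have "\<dots> \<le> hnorm H (S (T x)) * hnorm H x"
    using Cauchy_Schwarz[OF Tx(2) x] complex_Re_le_cmod order_trans by blast
  also have "\<dots> \<le> hnorm H (T x) * hnorm H x"
    using S[OF Tx(1)] hnorm_nonneg[OF x] by (rule mult_right_mono)
  finally have "hnorm H (T x) * hnorm H (T x) \<le> hnorm H (T x) * hnorm H x"
    by (simp add: power2_eq_square)
  then show ?thesis
    using hnorm_nonneg[OF Tx(1)] hnorm_nonneg[OF x] by (cases "hnorm H (T x) = 0") (auto simp: mult_le_cancel_left)
qed

text \<open>A contraction \<open>A\<close> acts on functionals by \<open>\<phi> \<mapsto> \<phi> \<circ> A\<close>; the adjoint of this map on the dual extends \<open>A\<close>.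
  So contractions of an inner product module extend to its completion.\<close>

lemma (in inner_product_module) contraction_extends_to_dual:
  assumes lin: "linear_op H H A" and A: "\<And>x. x \<in> carrier H \<Longrightarrow> hnorm H (A x) \<le> hnorm H x"
  obtains S T where "adjoint_pair (dual_space H) S T"
    "\<And>\<phi>. \<phi> \<in> carrier (dual_space H) \<Longrightarrow> hnorm (dual_space H) (S \<phi>) \<le> hnorm (dual_space H) \<phi>"
    "\<And>x. x \<in> carrier H \<Longrightarrow> S (dual_embedding H x) = dual_embedding H (A x)"
proof -
  let ?D = "dual_space H"
  interpret D: hilbert_module ?D by (rule dual_hilbert_module)
  define T where "T \<phi> y = (if y \<in> carrier H then \<phi> (A y) else 0)" for \<phi> :: "'a \<Rightarrow> complex" and y
  have A_in: "A y \<in> carrier H" if "y \<in> carrier H" for y using lin that by (rule linear_op_carrier)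
  have T_in: "T \<phi> \<in> carrier ?D" and T_le: "hnorm ?D (T \<phi>) \<le> hnorm ?D \<phi>" if \<phi>: "\<phi> \<in> carrier ?D" for \<phi>
  proof -
    have bound: "cmod (T \<phi> y) \<le> hnorm ?D \<phi> * hnorm H y" if y: "y \<in> carrier H" for y
    proof -
      have "cmod (T \<phi> y) \<le> hnorm ?D \<phi> * hnorm H (A y)"
        using dual_norm_bound[OF \<phi> A_in[OF y]] y by (simp add: T_def)
      also have "\<dots> \<le> hnorm ?D \<phi> * hnorm H y"
        using A[OF y] D.hnorm_nonneg[OF \<phi>] by (rule mult_left_mono)
      finally show ?thesis .
    qed
    have \<phi>': "bounded_antilinear H \<phi>" using \<phi> by (simp add: dual_carrier_iff)
    have "bounded_antilinear H (T \<phi>)"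
    proof (rule bounded_antilinearI)
      show "cmod (T \<phi> y) \<le> hnorm ?D \<phi> * hnorm H y" if "y \<in> carrier H" for y using bound[OF that] .
    qed (use \<phi>' A_in in \<open>auto simp: T_def linear_op_add[OF lin] linear_op_smult[OF lin] bounded_antilinear_def\<close>)
    then show "T \<phi> \<in> carrier ?D" by (simp add: dual_carrier_iff T_def)
    then show "hnorm ?D (T \<phi>) \<le> hnorm ?D \<phi>"
      using bound D.hnorm_nonneg[OF \<phi>] by (intro dual_norm_least)
  qed
  have "linear_op ?D ?D T"
    by (rule linear_opI) (auto simp: T_in T_def)
  then obtain S where adj: "adjoint_pair ?D T S"
    using D.adjoint_exists[of T 1] T_le by auto
  show ?thesis
  proof (rule that)
    show "adjoint_pair ?D S T" using adj by (rule D.adjoint_pair_swap)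
    show "hnorm ?D (S \<phi>) \<le> hnorm ?D \<phi>" if "\<phi> \<in> carrier ?D" for \<phi>
      using adj T_le that by (rule D.adjoint_bound)
    fix x assume x: "x \<in> carrier H"
    show "S (dual_embedding H x) = dual_embedding H (A x)"
    proof (rule D.cinner_ext)
      fix \<phi> assume \<phi>: "\<phi> \<in> carrier ?D"
      have ev: "cinner ?D \<psi> (dual_embedding H y) = cnj (\<psi> y)" if "\<psi> \<in> carrier ?D" "y \<in> carrier H" for \<psi> y
        using that D.cinner_commute[OF that(1) dual_embedding_carrier[OF that(2)]] by (simp add: cinner_dual_embedding)
      have "cinner ?D \<phi> (S (dual_embedding H x)) = cinner ?D (T \<phi>) (dual_embedding H x)"
        using adjoint_pairD(3)[OF adj \<phi> dual_embedding_carrier[OF x]] by simp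
      also have "\<dots> = cnj (\<phi> (A x))" using x by (simp add: ev T_in[OF \<phi>] T_def)
      finally show "cinner ?D \<phi> (S (dual_embedding H x)) = cinner ?D \<phi> (dual_embedding H (A x))"
        using ev[OF \<phi> A_in[OF x]] by simp
    qed (use x A_in adjoint_pairD(2)[OF adj] dual_embedding_carrier in auto)
  qed
qed

section \<open>Square-summable families\<close>

definition square_summable :: "'a inner_module \<Rightarrow> ('j \<Rightarrow> 'a) \<Rightarrow> bool" where
  "square_summable H F \<longleftrightarrow> (\<forall>j. F j \<in> carrier H) \<and> (\<lambda>j. (hnorm H (F j))\<^sup>2) summable_on UNIV"

definition l2 :: "'a inner_module \<Rightarrow> ('j \<Rightarrow> 'a) inner_module" where
  "l2 H = \<lparr>carrier = Collect (square_summable H), mult = undefined, one = undefined,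
     zero = (\<lambda>_. \<zero>\<^bsub>H\<^esub>), add = (\<lambda>F G j. F j \<oplus>\<^bsub>H\<^esub> G j), smult = (\<lambda>a F j. a \<odot>\<^bsub>H\<^esub> F j),
     cinner = (\<lambda>F G. \<Sum>\<^sub>\<infinity>j. cinner H (F j) (G j))\<rparr>"

lemma l2_simps [simp]:
  "\<zero>\<^bsub>l2 H\<^esub> = (\<lambda>_. \<zero>\<^bsub>H\<^esub>)"
  "F \<oplus>\<^bsub>l2 H\<^esub> G = (\<lambda>j. F j \<oplus>\<^bsub>H\<^esub> G j)"
  "a \<odot>\<^bsub>l2 H\<^esub> F = (\<lambda>j. a \<odot>\<^bsub>H\<^esub> F j)"
  by (simp_all add: l2_def)

lemma l2_carrier_iff: "F \<in> carrier (l2 H) \<longleftrightarrow> square_summable H F"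
  by (simp add: l2_def)

lemma cinner_l2: "cinner (l2 H) F G = (\<Sum>\<^sub>\<infinity>j. cinner H (F j) (G j))"
  by (simp add: l2_def)

lemma l2_coordinate: "F \<in> carrier (l2 H) \<Longrightarrow> F j \<in> carrier H"
  by (simp add: l2_carrier_iff square_summable_def)

definition l2_single :: "'a inner_module \<Rightarrow> 'j \<Rightarrow> 'a \<Rightarrow> 'j \<Rightarrow> 'a" where
  "l2_single H i x = (\<lambda>j. if j = i then x else \<zero>\<^bsub>H\<^esub>)"

context inner_product_module
begin

lemma square_summable_bound:
  assumes "square_summable H F" "g summable_on UNIV" "\<And>j. G j \<in> carrier H"
    and "\<And>j. (hnorm H (G j))\<^sup>2 \<le> c * (hnorm H (F j))\<^sup>2 + g j"
  shows "square_summable H G"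
proof -
  have "(\<lambda>j. c * (hnorm H (F j))\<^sup>2 + g j) summable_on UNIV"
    using assms by (intro summable_on_add summable_on_cmult_right) (auto simp: square_summable_def)
  then have "(\<lambda>j. (hnorm H (G j))\<^sup>2) summable_on UNIV"
    by (rule summable_on_comparison_test) (use assms in auto)
  with assms show ?thesis by (simp add: square_summable_def)
qed

lemma square_summable_add:
  assumes F: "square_summable H F" and G: "square_summable H G"
  shows "square_summable H (\<lambda>j. F j \<oplus>\<^bsub>H\<^esub> G j)"
proof (rule square_summable_bound[OF F, where c = 2 and g = "\<lambda>j. 2 * (hnorm H (G j))\<^sup>2"])
  show "(\<lambda>j. 2 * (hnorm H (G j))\<^sup>2) summable_on UNIV"
    using G by (intro summable_on_cmult_right) (auto simp: square_summable_def)
  have in_H: "F j \<in> carrier H" "G j \<in> carrier H" for j using F G by (auto simp: square_summable_def)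
  then show "F j \<oplus>\<^bsub>H\<^esub> G j \<in> carrier H" for j by simp
  show "(hnorm H (F j \<oplus>\<^bsub>H\<^esub> G j))\<^sup>2 \<le> 2 * (hnorm H (F j))\<^sup>2 + 2 * (hnorm H (G j))\<^sup>2" for j
  proof -
    have "0 \<le> (hnorm H (F j \<ominus>\<^bsub>H\<^esub> G j))\<^sup>2" by simp
    then show ?thesis using in_H by (simp add: hnorm_add_sq hnorm_diff_sq)
  qed
qed

lemma square_summable_smult:
  assumes F: "square_summable H F"
  shows "square_summable H (\<lambda>j. a \<odot>\<^bsub>H\<^esub> F j)"
proof (rule square_summable_bound[OF F, where c = "(cmod a)\<^sup>2" and g = "\<lambda>_. 0"])
  have in_H: "F j \<in> carrier H" for j using F by (auto simp: square_summable_def)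
  then show "a \<odot>\<^bsub>H\<^esub> F j \<in> carrier H" for j by simp
  show "(hnorm H (a \<odot>\<^bsub>H\<^esub> F j))\<^sup>2 \<le> (cmod a)\<^sup>2 * (hnorm H (F j))\<^sup>2 + 0" for j
    using in_H by (simp add: hnorm_smult power_mult_distrib)
qed simp

lemma l2_cinner_summable:
  assumes F: "square_summable H F" and G: "square_summable H G"
  shows "(\<lambda>j. cinner H (F j) (G j)) summable_on UNIV"
proof (rule abs_summable_summable)
  have in_H: "F j \<in> carrier H" "G j \<in> carrier H" for j using F G by (auto simp: square_summable_def)
  have "(\<lambda>j. (hnorm H (F j))\<^sup>2 + (hnorm H (G j))\<^sup>2) summable_on UNIV"
    using F G by (intro summable_on_add) (auto simp: square_summable_def)
  then show "(\<lambda>j. cmod (cinner H (F j) (G j))) summable_on UNIV"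
  proof (rule summable_on_comparison_test)
    show "cmod (cinner H (F j) (G j)) \<le> (hnorm H (F j))\<^sup>2 + (hnorm H (G j))\<^sup>2" for j
    proof -
      have "2 * cmod (cinner H (F j) (G j)) \<le> 2 * hnorm H (F j) * hnorm H (G j)"
        using Cauchy_Schwarz[OF in_H] by simp
      also have "\<dots> \<le> (hnorm H (F j))\<^sup>2 + (hnorm H (G j))\<^sup>2" by (rule sum_squares_bound)
      finally show ?thesis by (smt (verit) norm_ge_zero)
    qed
  qed simp
qed

lemma square_summable_zero: "square_summable H (\<lambda>_. \<zero>\<^bsub>H\<^esub>)"
  by (simp add: square_summable_def)

lemma l2_module: "module complex_ring (l2 H)"
proof (rule moduleI[OF cring_complex_ring])
  have car: "F \<in> carrier (l2 H) \<longleftrightarrow> square_summable H F" for F :: "'j \<Rightarrow> 'a" by (rule l2_carrier_iff)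
  show "abelian_group (l2 H)"
  proof (rule abelian_groupI)
    fix F :: "'j \<Rightarrow> 'a" assume F: "F \<in> carrier (l2 H)"
    then have "(\<lambda>j. (-1) \<odot>\<^bsub>H\<^esub> F j) \<oplus>\<^bsub>l2 H\<^esub> F = \<zero>\<^bsub>l2 H\<^esub>"
      by (auto simp: l2_coordinate l_neg simp flip: minus_eq_smult)
    then show "\<exists>G\<in>carrier (l2 H). G \<oplus>\<^bsub>l2 H\<^esub> F = \<zero>\<^bsub>l2 H\<^esub>"
      using F by (intro bexI[of _ "\<lambda>j. (-1) \<odot>\<^bsub>H\<^esub> F j"]) (auto simp: car square_summable_smult)
  next
    fix F G :: "'j \<Rightarrow> 'a" assume "F \<in> carrier (l2 H)" "G \<in> carrier (l2 H)"
    then show "F \<oplus>\<^bsub>l2 H\<^esub> G \<in> carrier (l2 H)" by (simp add: car square_summable_add)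
  qed (auto simp: car square_summable_zero intro!: ext a_assoc a_comm l_zero simp: square_summable_def)
next
  fix a and F :: "'j \<Rightarrow> 'a" assume "F \<in> carrier (l2 H)"
  then show "a \<odot>\<^bsub>l2 H\<^esub> F \<in> carrier (l2 H)" by (simp add: l2_carrier_iff square_summable_smult)
qed (auto simp: l2_carrier_iff square_summable_def fun_eq_iff smult_l_distr[simplified]
    smult_r_distr[simplified] smult_assoc1[simplified] smult_one[simplified])

lemma hnorm_l2_sq:
  assumes "F \<in> carrier (l2 H)"
  shows "cinner (l2 H) F F = of_real (\<Sum>\<^sub>\<infinity>j. (hnorm H (F j))\<^sup>2)"
proof -
  have "((\<lambda>j. (hnorm H (F j))\<^sup>2) has_sum (\<Sum>\<^sub>\<infinity>j. (hnorm H (F j))\<^sup>2)) UNIV"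
    using assms by (intro has_sum_infsum) (auto simp: l2_carrier_iff square_summable_def)
  then have "(\<Sum>\<^sub>\<infinity>j. complex_of_real ((hnorm H (F j))\<^sup>2)) = of_real (\<Sum>\<^sub>\<infinity>j. (hnorm H (F j))\<^sup>2)"
    by (intro infsumI) (simp only: has_sum_of_real_iff)
  moreover have "cinner (l2 H) F F = (\<Sum>\<^sub>\<infinity>j. of_real ((hnorm H (F j))\<^sup>2))"
    unfolding cinner_l2 using assms by (intro infsum_cong) (auto simp: cinner_self l2_coordinate)
  ultimately show ?thesis by simp
qed

lemma l2_norm_coordinate:
  assumes "F \<in> carrier (l2 H)" "finite S"
  shows "(\<Sum>j\<in>S. (hnorm H (F j))\<^sup>2) \<le> (hnorm (l2 H) F)\<^sup>2"
proof -
  have "(\<Sum>j\<in>S. (hnorm H (F j))\<^sup>2) \<le> (\<Sum>\<^sub>\<infinity>j. (hnorm H (F j))\<^sup>2)"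
    using assms by (intro finite_sum_le_infsum) (auto simp: l2_carrier_iff square_summable_def)
  moreover have "0 \<le> (\<Sum>\<^sub>\<infinity>j. (hnorm H (F j))\<^sup>2)" by (rule infsum_nonneg) simp
  ultimately show ?thesis using assms by (simp add: hnorm_def hnorm_l2_sq)
qed

lemma l2_inner_product_module: "inner_product_module (l2 H)"
  unfolding inner_product_module_def inner_product_module_axioms_def
proof (intro conjI allI impI l2_module)
  fix F G K :: "'j \<Rightarrow> 'a" assume F: "F \<in> carrier (l2 H)"
  {
    assume G: "G \<in> carrier (l2 H)" and K: "K \<in> carrier (l2 H)"
    have "cinner (l2 H) F (G \<oplus>\<^bsub>l2 H\<^esub> K) = (\<Sum>\<^sub>\<infinity>j. cinner H (F j) (G j) + cinner H (F j) (K j))"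
      unfolding cinner_l2 using F G K by (intro infsum_cong) (auto simp: l2_coordinate cinner_add_right)
    then show "cinner (l2 H) F (G \<oplus>\<^bsub>l2 H\<^esub> K) = cinner (l2 H) F G + cinner (l2 H) F K"
      unfolding cinner_l2 using F G K by (simp add: infsum_add l2_cinner_summable l2_carrier_iff)
  }
  {
    assume G: "G \<in> carrier (l2 H)"
    have "cinner (l2 H) F (a \<odot>\<^bsub>l2 H\<^esub> G) = (\<Sum>\<^sub>\<infinity>j. a * cinner H (F j) (G j))" for a
      unfolding cinner_l2 using F G by (intro infsum_cong) (auto simp: l2_coordinate cinner_smult_right)
    then show "cinner (l2 H) F (a \<odot>\<^bsub>l2 H\<^esub> G) = a * cinner (l2 H) F G" for a
      unfolding cinner_l2 by (simp add: infsum_cmult_right')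
    have "cinner (l2 H) F G = (\<Sum>\<^sub>\<infinity>j. cnj (cinner H (G j) (F j)))"
      unfolding cinner_l2 using F G by (intro infsum_cong cinner_commute) (auto simp: l2_coordinate)
    then show "cinner (l2 H) F G = cnj (cinner (l2 H) G F)"
      unfolding cinner_l2 by (simp add: infsum_cnj)
  }
  {
    assume "F \<noteq> \<zero>\<^bsub>l2 H\<^esub>"
    then obtain j where j: "F j \<noteq> \<zero>\<^bsub>H\<^esub>" by auto
    have "0 < (hnorm H (F j))\<^sup>2" using F j hnorm_eq_0_iff[OF l2_coordinate[OF F]] by simp
    also have "\<dots> \<le> (hnorm (l2 H) F)\<^sup>2" using l2_norm_coordinate[OF F, of "{j}"] by simp
    also have "\<dots> = Re (cinner (l2 H) F F)"
      using F by (simp add: hnorm_def hnorm_l2_sq infsum_nonneg)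
    finally show "0 < Re (cinner (l2 H) F F)" .
  }
qed

lemma cinner_l2_finite:
  assumes "finite S" "F \<in> carrier (l2 H)" "G \<in> carrier (l2 H)" "\<And>j. j \<notin> S \<Longrightarrow> F j = \<zero>\<^bsub>H\<^esub>"
  shows "cinner (l2 H) F G = (\<Sum>j\<in>S. cinner H (F j) (G j))"
proof -
  have "cinner (l2 H) F G = (\<Sum>\<^sub>\<infinity>j\<in>S. cinner H (F j) (G j))"
    unfolding cinner_l2 using assms by (intro infsum_cong_neutral) (auto simp: l2_coordinate)
  then show ?thesis using assms by simp
qed

lemma finite_support_l2_carrier:
  assumes "finite S" "\<And>j. F j \<in> carrier H" "\<And>j. j \<notin> S \<Longrightarrow> F j = \<zero>\<^bsub>H\<^esub>"
  shows "F \<in> carrier (l2 H)"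
proof -
  have "(\<lambda>j. (hnorm H (F j))\<^sup>2) summable_on UNIV \<longleftrightarrow> (\<lambda>j. (hnorm H (F j))\<^sup>2) summable_on S"
    using assms by (intro summable_on_cong_neutral) auto
  with assms show ?thesis by (auto simp: l2_carrier_iff square_summable_def)
qed

lemma l2_single_carrier: "x \<in> carrier H \<Longrightarrow> l2_single H i x \<in> carrier (l2 H)"
  by (rule finite_support_l2_carrier[of "{i}"]) (auto simp: l2_single_def)

end

text \<open>The limit is taken in every coordinate; finite partial sums of the squared norms pass to the limit and give the
  tail estimates.\<close>

theorem (in hilbert_module) l2_hilbert_module: "hilbert_module (l2 H)"
proof -
  interpret L: inner_product_module "l2 H" by (rule l2_inner_product_module)
  show ?thesis
  proof (unfold_locales)
    fix s :: "nat \<Rightarrow> 'j \<Rightarrow> 'a"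
    assume s: "\<And>n. s n \<in> carrier (l2 H)"
      and Cauchy: "\<And>e. 0 < e \<Longrightarrow> \<exists>N. \<forall>m\<ge>N. \<forall>n\<ge>N. hnorm (l2 H) (s m \<ominus>\<^bsub>l2 H\<^esub> s n) < e"
    have sj: "s n j \<in> carrier H" for n j using s by (rule l2_coordinate)
    have diff: "(F \<ominus>\<^bsub>l2 H\<^esub> G) j = F j \<ominus>\<^bsub>H\<^esub> G j" if "F \<in> carrier (l2 H)" "G \<in> carrier (l2 H)"
      for F G :: "'j \<Rightarrow> 'a" and j
      using that by (simp add: L.diff_eq_smult diff_eq_smult l2_coordinate)
    have "\<exists>x\<in>carrier H. (\<lambda>n. hnorm H (s n j \<ominus>\<^bsub>H\<^esub> x)) \<longlonglongrightarrow> 0" for j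
    proof (rule Cauchy_limit)
      fix e :: real assume "0 < e"
      then obtain N where N: "\<And>m n. m \<ge> N \<Longrightarrow> n \<ge> N \<Longrightarrow> hnorm (l2 H) (s m \<ominus>\<^bsub>l2 H\<^esub> s n) < e"
        using Cauchy by blast
      have "hnorm H (s m j \<ominus>\<^bsub>H\<^esub> s n j) \<le> hnorm (l2 H) (s m \<ominus>\<^bsub>l2 H\<^esub> s n)" for m n
        using l2_norm_coordinate[OF L.diff_in_carrier[OF s s], of "{j}" m n] L.hnorm_nonneg[OF L.diff_in_carrier[OF s s]]
        by (simp add: diff s power2_le_iff_abs_le)
      with N show "\<exists>N. \<forall>m\<ge>N. \<forall>n\<ge>N. hnorm H (s m j \<ominus>\<^bsub>H\<^esub> s n j) < e"
        by (meson le_less_trans)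
    qed (rule sj)
    then obtain G where G: "\<And>j. G j \<in> carrier H" and lim: "\<And>j. (\<lambda>n. hnorm H (s n j \<ominus>\<^bsub>H\<^esub> G j)) \<longlonglongrightarrow> 0"
      by metis
    have lim_diff: "(\<lambda>m. hnorm H (s n j \<ominus>\<^bsub>H\<^esub> s m j)) \<longlonglongrightarrow> hnorm H (s n j \<ominus>\<^bsub>H\<^esub> G j)" for n j
    proof -
      have "(\<lambda>m. hnorm H (s n j \<ominus>\<^bsub>H\<^esub> s m j) - hnorm H (s n j \<ominus>\<^bsub>H\<^esub> G j)) \<longlonglongrightarrow> 0"
      proof (rule Lim_null_comparison[OF _ lim[of j]])
        have "\<bar>hnorm H (s n j \<ominus>\<^bsub>H\<^esub> s m j) - hnorm H (s n j \<ominus>\<^bsub>H\<^esub> G j)\<bar> \<le> hnorm H (s m j \<ominus>\<^bsub>H\<^esub> G j)" for m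
          using hnorm_diff_triangle[OF sj[of n j] G[of j] sj[of m j]] hnorm_diff_triangle[OF sj[of n j] sj[of m j] G[of j]]
            hnorm_diff_commute[OF sj[of m j] G[of j]] by linarith
        then show "\<forall>\<^sub>F m in sequentially. norm (hnorm H (s n j \<ominus>\<^bsub>H\<^esub> s m j) - hnorm H (s n j \<ominus>\<^bsub>H\<^esub> G j))
            \<le> hnorm H (s m j \<ominus>\<^bsub>H\<^esub> G j)" by simp
      qed
      then show ?thesis by (simp add: LIM_zero_iff)
    qed
    have tail: "\<exists>N. \<forall>n\<ge>N. \<forall>S. finite S \<longrightarrow> (\<Sum>j\<in>S. (hnorm H (s n j \<ominus>\<^bsub>H\<^esub> G j))\<^sup>2) \<le> e\<^sup>2" if "0 < e" for e
    proof -
      obtain N where N: "\<And>m n. m \<ge> N \<Longrightarrow> n \<ge> N \<Longrightarrow> hnorm (l2 H) (s m \<ominus>\<^bsub>l2 H\<^esub> s n) < e"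
        using Cauchy[OF \<open>0 < e\<close>] by blast
      have "(\<Sum>j\<in>S. (hnorm H (s n j \<ominus>\<^bsub>H\<^esub> G j))\<^sup>2) \<le> e\<^sup>2" if n: "n \<ge> N" and S: "finite S" for n S
      proof (rule LIMSEQ_le_const2)
        show "(\<lambda>m. \<Sum>j\<in>S. (hnorm H (s n j \<ominus>\<^bsub>H\<^esub> s m j))\<^sup>2) \<longlonglongrightarrow> (\<Sum>j\<in>S. (hnorm H (s n j \<ominus>\<^bsub>H\<^esub> G j))\<^sup>2)"
          by (intro tendsto_intros lim_diff)
        have "(\<Sum>j\<in>S. (hnorm H (s n j \<ominus>\<^bsub>H\<^esub> s m j))\<^sup>2) \<le> e\<^sup>2" if "m \<ge> N" for m
        proof -
          have "(\<Sum>j\<in>S. (hnorm H (s n j \<ominus>\<^bsub>H\<^esub> s m j))\<^sup>2) \<le> (hnorm (l2 H) (s n \<ominus>\<^bsub>l2 H\<^esub> s m))\<^sup>2"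
            using l2_norm_coordinate[OF L.diff_in_carrier[OF s s] S, of n m] by (simp add: diff s)
          also have "\<dots> \<le> e\<^sup>2"
            using N[OF n that] by (intro power_mono L.hnorm_nonneg L.diff_in_carrier s) auto
          finally show ?thesis .
        qed
        then show "\<exists>N. \<forall>m\<ge>N. (\<Sum>j\<in>S. (hnorm H (s n j \<ominus>\<^bsub>H\<^esub> s m j))\<^sup>2) \<le> e\<^sup>2" by blast
      qed
      then show ?thesis by blast
    qed
    have tail_l2: "square_summable H (\<lambda>j. s n j \<ominus>\<^bsub>H\<^esub> G j)"
      if "\<And>S. finite S \<Longrightarrow> (\<Sum>j\<in>S. (hnorm H (s n j \<ominus>\<^bsub>H\<^esub> G j))\<^sup>2) \<le> e\<^sup>2" for n e
      unfolding square_summable_def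
      using that sj G by (auto intro!: nonneg_bdd_above_summable_on bdd_aboveI2[of _ _ "e\<^sup>2"])
    obtain N where N: "\<And>S. finite S \<Longrightarrow> (\<Sum>j\<in>S. (hnorm H (s N j \<ominus>\<^bsub>H\<^esub> G j))\<^sup>2) \<le> 1\<^sup>2"
      using tail[of 1] by auto
    have "G = (\<lambda>j. s N j \<oplus>\<^bsub>H\<^esub> (-1) \<odot>\<^bsub>H\<^esub> (s N j \<ominus>\<^bsub>H\<^esub> G j))"
      using sj G by (intro ext cinner_ext) (auto simp: cinner_simps)
    moreover have "square_summable H (\<lambda>j. s N j \<oplus>\<^bsub>H\<^esub> (-1) \<odot>\<^bsub>H\<^esub> (s N j \<ominus>\<^bsub>H\<^esub> G j))"
      using s[of N] tail_l2[OF N] by (intro square_summable_add square_summable_smult) (auto simp: l2_carrier_iff)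
    ultimately have G_in: "G \<in> carrier (l2 H)" by (simp add: l2_carrier_iff)
    have "(\<lambda>n. hnorm (l2 H) (s n \<ominus>\<^bsub>l2 H\<^esub> G)) \<longlonglongrightarrow> 0"
    proof (rule LIMSEQ_I)
      fix r :: real assume r: "0 < r"
      obtain N where N: "\<And>n S. n \<ge> N \<Longrightarrow> finite S \<Longrightarrow> (\<Sum>j\<in>S. (hnorm H (s n j \<ominus>\<^bsub>H\<^esub> G j))\<^sup>2) \<le> (r / 2)\<^sup>2"
        using tail[of "r / 2"] r by auto
      have "hnorm (l2 H) (s n \<ominus>\<^bsub>l2 H\<^esub> G) \<le> r / 2" if n: "n \<ge> N" for n
      proof -
        have in_l2: "s n \<ominus>\<^bsub>l2 H\<^esub> G \<in> carrier (l2 H)" using s G_in by simp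
        have "(\<Sum>\<^sub>\<infinity>j. (hnorm H (s n j \<ominus>\<^bsub>H\<^esub> G j))\<^sup>2) \<le> (r / 2)\<^sup>2"
          using N[OF n] tail_l2[OF N[OF n]] by (intro infsum_le_finite_sums) (auto simp: square_summable_def)
        then have "(hnorm (l2 H) (s n \<ominus>\<^bsub>l2 H\<^esub> G))\<^sup>2 \<le> (r / 2)\<^sup>2"
          using in_l2 by (simp add: L.hnorm_sq hnorm_l2_sq diff s G_in)
        then show ?thesis by (rule power2_le_imp_le) (use r in simp)
      qed
      then show "\<exists>N. \<forall>n\<ge>N. norm (hnorm (l2 H) (s n \<ominus>\<^bsub>l2 H\<^esub> G) - 0) < r"
        using r L.hnorm_nonneg[OF L.diff_in_carrier[OF s G_in]] by (intro exI[of _ N]) fastforce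
    qed
    with G_in show "\<exists>x\<in>carrier (l2 H). (\<lambda>n. hnorm (l2 H) (s n \<ominus>\<^bsub>l2 H\<^esub> x)) \<longlonglongrightarrow> 0" by blast
  qed
qed

section \<open>The defect of a contraction\<close>

text \<open>The product of \<open>k\<close> factors that alternate between \<open>S\<close> and \<open>T\<close>, with \<open>S\<close> applied first. If \<open>T\<close> is the adjoint of
  \<open>S\<close>, then its Gram operator is \<open>(T S)^k\<close>.\<close>

fun alternating :: "('a \<Rightarrow> 'a) \<Rightarrow> ('a \<Rightarrow> 'a) \<Rightarrow> nat \<Rightarrow> 'a \<Rightarrow> 'a" where
  "alternating S T 0 x = x"
| "alternating S T (Suc k) x = alternating T S k (S x)"

text \<open>If \<open>S\<close> is a contraction with adjoint \<open>T\<close>, this map into square-summable sequences has the Gram operator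
  \<open>1 - T S\<close>, like the square root of \<open>1 - T S\<close>.\<close>

definition defect :: "'a inner_module \<Rightarrow> ('a \<Rightarrow> 'a) \<Rightarrow> ('a \<Rightarrow> 'a) \<Rightarrow> 'a \<Rightarrow> nat \<Rightarrow> 'a" where
  "defect H S T x = (\<lambda>k. alternating S T k (x \<ominus>\<^bsub>H\<^esub> T (S x)))"

lemma alternating_linear:
  assumes "linear_op H H S" "linear_op H H T"
  shows "linear_op H H (alternating S T k)"
  using assms
proof (induction k arbitrary: S T)
  case 0
  then show ?case by (simp add: linear_op_def)
next
  case (Suc k)
  then show ?case using linear_op_compose[OF Suc.prems(1) Suc.IH[OF Suc.prems(2,1)]] by simp
qed

lemma isometric_embeddingD:
  assumes "isometric_embedding H K V"
  shows "linear_op H K V" "\<lbrakk>x \<in> carrier H; y \<in> carrier H\<rbrakk> \<Longrightarrow> cinner K (V x) (V y) = cinner H x y"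
  using assms by (auto simp: isometric_embedding_def)

text \<open>By polarisation, preserving norms is enough.\<close>

lemma isometric_embeddingI:
  assumes H: "inner_product_module H" and K: "inner_product_module K" and lin: "linear_op H K V"
    and norm: "\<And>x. x \<in> carrier H \<Longrightarrow> (hnorm K (V x))\<^sup>2 = (hnorm H x)\<^sup>2"
  shows "isometric_embedding H K V"
proof -
  interpret H: inner_product_module H by fact
  interpret K: inner_product_module K by fact
  have V: "V x \<in> carrier K" if "x \<in> carrier H" for x using lin that by (rule linear_op_carrier)
  have Re: "Re (cinner K (V x) (V y)) = Re (cinner H x y)" if x: "x \<in> carrier H" and y: "y \<in> carrier H" for x y
    using norm[OF x] norm[OF y] norm[OF H.a_closed[OF x y]] x y
    by (simp add: linear_op_add[OF lin] H.hnorm_add_sq K.hnorm_add_sq V)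
  have "cinner K (V x) (V y) = cinner H x y" if x: "x \<in> carrier H" and y: "y \<in> carrier H" for x y
  proof (rule complex_eqI)
    show "Re (cinner K (V x) (V y)) = Re (cinner H x y)" using x y by (rule Re)
    have "Re (cinner K (V x) (V (\<i> \<odot>\<^bsub>H\<^esub> y))) = Re (cinner H x (\<i> \<odot>\<^bsub>H\<^esub> y))"
      using x y by (intro Re) auto
    then show "Im (cinner K (V x) (V y)) = Im (cinner H x y)"
      using x y by (simp add: linear_op_smult[OF lin] H.cinner_smult_right K.cinner_smult_right V)
  qed
  with lin show ?thesis by (simp add: isometric_embedding_def)
qed

context inner_product_module
begin

lemma alternating_decreasing:
  assumes S: "\<And>x. x \<in> carrier H \<Longrightarrow> S x \<in> carrier H \<and> hnorm H (S x) \<le> hnorm H x"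
    and T: "\<And>x. x \<in> carrier H \<Longrightarrow> T x \<in> carrier H \<and> hnorm H (T x) \<le> hnorm H x"
    and x: "x \<in> carrier H"
  shows "hnorm H (alternating S T (Suc k) x) \<le> hnorm H (alternating S T k x)"
  using assms
proof (induction k arbitrary: S T x)
  case (Suc k)
  have "hnorm H (alternating T S (Suc k) (S x)) \<le> hnorm H (alternating T S k (S x))"
    by (rule Suc.IH) (use Suc.prems in auto)
  then show ?case by simp
qed simp

lemma cinner_alternating:
  assumes "adjoint_pair H S T" "x \<in> carrier H"
  shows "cinner H (alternating S T k x) (alternating S T k (T (S x)))
    = of_real ((hnorm H (alternating S T (Suc k) x))\<^sup>2)"
  using assms
proof (induction k arbitrary: S T x)
  case 0
  then show ?case using adjoint_pairD[OF 0(1), of x "S x"] adjoint_pairD(1)[OF 0(1)] by (simp add: cinner_self)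
next
  case (Suc k)
  have Sx: "S x \<in> carrier H" using adjoint_pairD(1)[OF Suc.prems(1)] Suc.prems(2) by blast
  show ?case using Suc.IH[OF adjoint_pair_swap[OF Suc.prems(1)] Sx] by simp
qed

text \<open>Since \<open>\<Sum>k. t^k * (1 - t)\<^sup>2 = 1 - t\<close>, the components \<open>alternating S T k (x - T (S x))\<close>, whose squared norms
  are \<open>\<langle>(T S)^k (1 - T S)\<^sup>2 x, x\<rangle>\<close>, add up to \<open>\<langle>(1 - T S) x, x\<rangle>\<close>:
  the squared norms are second differences of the decreasing sequence \<open>\<langle>(T S)^k x, x\<rangle>\<close>, and the sum telescopes.\<close>

lemma defect_has_sum:
  assumes adj: "adjoint_pair H S T" and S: "\<And>x. x \<in> carrier H \<Longrightarrow> hnorm H (S x) \<le> hnorm H x"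
    and x: "x \<in> carrier H"
  shows "((\<lambda>k. (hnorm H (defect H S T x k))\<^sup>2) has_sum ((hnorm H x)\<^sup>2 - (hnorm H (S x))\<^sup>2)) UNIV"
proof -
  note car = adjoint_pairD(1,2)[OF adj]
  have T: "hnorm H (T y) \<le> hnorm H y" if "y \<in> carrier H" for y
    using adj S that by (rule adjoint_bound)
  have alt: "linear_op H H (alternating S T k)" for k
    using adj by (auto simp: adjoint_pair_def intro: alternating_linear)
  have alt_car: "alternating S T k y \<in> carrier H" if "y \<in> carrier H" for k y
    using alt that by (rule linear_op_carrier)
  define b where "b k = (hnorm H (alternating S T k x))\<^sup>2" for k
  have second_difference: "(hnorm H (defect H S T x k))\<^sup>2 = (b k - b (Suc k)) - (b (Suc k) - b (Suc (Suc k)))" for k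
  proof -
    have TSx: "T (S x) \<in> carrier H" using car x by blast
    have "defect H S T x k = alternating S T k x \<ominus>\<^bsub>H\<^esub> alternating S T k (T (S x))"
      unfolding defect_def using alt x TSx inner_product_module_axioms by (intro linear_op_diff)
    then have "(hnorm H (defect H S T x k))\<^sup>2
        = (hnorm H (alternating S T k x))\<^sup>2 - 2 * (hnorm H (alternating S T (Suc k) x))\<^sup>2
          + (hnorm H (alternating S T k (T (S x))))\<^sup>2"
      using x TSx alt_car cinner_alternating[OF adj x, of k] by (simp add: hnorm_diff_sq del: alternating.simps)
    then show ?thesis by (simp add: b_def)
  qed
  have "decseq b"
  proof (rule decseq_SucI)
    have "hnorm H (alternating S T (Suc k) x) \<le> hnorm H (alternating S T k x)" for k
      by (rule alternating_decreasing) (use S T car x in simp_all)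
    then show "b (Suc k) \<le> b k" for k
      unfolding b_def by (rule power_mono) (rule hnorm_nonneg[OF alt_car[OF x]])
  qed
  moreover have "0 \<le> b k" for k by (simp add: b_def)
  ultimately obtain L where L: "b \<longlonglongrightarrow> L" using decseq_convergent[of b 0] by blast
  have "(\<lambda>k. b k - b (Suc k)) \<longlonglongrightarrow> L - L" by (intro tendsto_diff L LIMSEQ_Suc)
  then have "(\<lambda>k. b k - b (Suc k)) \<longlonglongrightarrow> 0" by simp
  from telescope_sums'[OF this] have "(\<lambda>k. (hnorm H (defect H S T x k))\<^sup>2) sums ((b 0 - b (Suc 0)) - 0)"
    unfolding second_difference .
  then show ?thesis by (intro sums_nonneg_imp_has_sum) (simp_all add: b_def)
qed

lemma defect_isometry:
  assumes adj: "adjoint_pair H S T" and S: "\<And>x. x \<in> carrier H \<Longrightarrow> hnorm H (S x) \<le> hnorm H x"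
  shows "linear_op H (l2 H) (defect H S T)"
    and "x \<in> carrier H \<Longrightarrow> (hnorm (l2 H) (defect H S T x))\<^sup>2 = (hnorm H x)\<^sup>2 - (hnorm H (S x))\<^sup>2"
proof -
  interpret L: inner_product_module "l2 H :: (nat \<Rightarrow> 'a) inner_module" by (rule l2_inner_product_module)
  have linST: "linear_op H H S" "linear_op H H T" using adj by (auto simp: adjoint_pair_def)
  have alt: "linear_op H H (alternating S T k)" for k using linST by (rule alternating_linear)
  have car: "S x \<in> carrier H" "T x \<in> carrier H" if "x \<in> carrier H" for x using adjoint_pairD[OF adj] that by blast+
  have lin_diff: "linear_op H H (\<lambda>x. x \<ominus>\<^bsub>H\<^esub> T (S x))"
  proof (rule linear_opI)
    show "x \<oplus>\<^bsub>H\<^esub> y \<ominus>\<^bsub>H\<^esub> T (S (x \<oplus>\<^bsub>H\<^esub> y)) = (x \<ominus>\<^bsub>H\<^esub> T (S x)) \<oplus>\<^bsub>H\<^esub> (y \<ominus>\<^bsub>H\<^esub> T (S y))"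
      if "x \<in> carrier H" "y \<in> carrier H" for x y
      using that car by (intro cinner_ext) (auto simp: cinner_simps linear_op_add[OF linST(1)] linear_op_add[OF linST(2)])
    show "a \<odot>\<^bsub>H\<^esub> x \<ominus>\<^bsub>H\<^esub> T (S (a \<odot>\<^bsub>H\<^esub> x)) = a \<odot>\<^bsub>H\<^esub> (x \<ominus>\<^bsub>H\<^esub> T (S x))" if "x \<in> carrier H" for a x
      using that car by (intro cinner_ext)
        (auto simp: cinner_simps linear_op_smult[OF linST(1)] linear_op_smult[OF linST(2)] algebra_simps)
  qed (use car in auto)
  have coord: "linear_op H H (\<lambda>x. defect H S T x k)" for k
    unfolding defect_def using linear_op_compose[OF lin_diff alt] .
  have mem: "defect H S T x \<in> carrier (l2 H)" if "x \<in> carrier H" for x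
    using defect_has_sum[OF adj S that] linear_op_carrier[OF coord that]
    by (auto simp: l2_carrier_iff square_summable_def summable_on_def)
  then show "linear_op H (l2 H) (defect H S T)"
    using coord by (intro linear_opI) (auto simp: fun_eq_iff linear_op_add[OF coord] linear_op_smult[OF coord])
  show "(hnorm (l2 H) (defect H S T x))\<^sup>2 = (hnorm H x)\<^sup>2 - (hnorm H (S x))\<^sup>2" if "x \<in> carrier H"
    using mem[OF that] infsumI[OF defect_has_sum[OF adj S that]] by (simp add: L.hnorm_sq hnorm_l2_sq)
qed

text \<open>One step of a Gram--Schmidt process: given an isometry \<open>X\<close> there is another isometry \<open>Y\<close> with prescribed
  Gram operator \<open>X\<^sup>* Y = S\<close>. The part of \<open>Y\<close> in the range of \<open>X\<close> is \<open>X S\<close>, and the defect of \<open>S\<close> goes into a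
  coordinate that \<open>X\<close> does not use.\<close>

lemma isometry_extension_step:
  fixes X :: "'a \<Rightarrow> nat \<Rightarrow> nat \<Rightarrow> 'a"
  assumes X: "isometric_embedding H (l2 (l2 H)) X"
    and unused: "\<And>x b. x \<in> carrier H \<Longrightarrow> m \<le> b \<Longrightarrow> X x b = \<zero>\<^bsub>l2 H\<^esub>"
    and adj: "adjoint_pair H S T" and S: "\<And>x. x \<in> carrier H \<Longrightarrow> hnorm H (S x) \<le> hnorm H x"
  obtains Y where "isometric_embedding H (l2 (l2 H)) Y"
    "\<And>x b. x \<in> carrier H \<Longrightarrow> Suc m \<le> b \<Longrightarrow> Y x b = \<zero>\<^bsub>l2 H\<^esub>"
    "\<And>x y. x \<in> carrier H \<Longrightarrow> y \<in> carrier H \<Longrightarrow> cinner (l2 (l2 H)) (X x) (Y y) = cinner H x (S y)"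
proof -
  let ?L = "l2 H :: (nat \<Rightarrow> 'a) inner_module"
  let ?M = "l2 ?L :: (nat \<Rightarrow> nat \<Rightarrow> 'a) inner_module"
  interpret L: inner_product_module ?L by (rule l2_inner_product_module)
  interpret M: inner_product_module ?M by (rule L.l2_inner_product_module)
  have linS: "linear_op H H S" using adj by (simp add: adjoint_pair_def)
  have S_car: "S x \<in> carrier H" if "x \<in> carrier H" for x using linS that by (rule linear_op_carrier)
  note X_lin = isometric_embeddingD(1)[OF X] and X_inner = isometric_embeddingD(2)[OF X]
  have X_car: "X x \<in> carrier ?M" if "x \<in> carrier H" for x using X_lin that by (rule linear_op_carrier)
  define D where "D x = l2_single ?L m (defect H S T x)" for x
  note D_lin = defect_isometry(1)[OF adj S]
  have d_car: "defect H S T x \<in> carrier ?L" if "x \<in> carrier H" for x using D_lin that by (rule linear_op_carrier)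
  have D_car: "D x \<in> carrier ?M" if "x \<in> carrier H" for x
    unfolding D_def using d_car[OF that] by (rule L.l2_single_carrier)
  have "linear_op H ?M D"
    using D_car d_car by (intro linear_opI)
      (auto simp: D_def l2_single_def fun_eq_iff linear_op_add[OF D_lin, simplified] linear_op_smult[OF D_lin, simplified])
  have D_inner: "cinner ?M (D x) F = cinner ?L (defect H S T x) (F m)" if "x \<in> carrier H" "F \<in> carrier ?M" for x F
    using L.cinner_l2_finite[of "{m}", OF _ D_car[OF that(1)] that(2)] by (simp add: D_def l2_single_def)
  have ortho: "cinner ?M (D x) (X y) = 0" if "x \<in> carrier H" "y \<in> carrier H" for x y
    using that d_car by (simp add: D_inner X_car unused del: l2_simps)
  have ortho': "cinner ?M (X y) (D x) = 0" if "x \<in> carrier H" "y \<in> carrier H" for x y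
    using that ortho M.cinner_commute[OF X_car[OF that(2)] D_car[OF that(1)]] by simp
  have D_norm: "(hnorm ?M (D x))\<^sup>2 = (hnorm H x)\<^sup>2 - (hnorm H (S x))\<^sup>2" if "x \<in> carrier H" for x
    using that D_inner[OF that D_car[OF that]] defect_isometry(2)[OF adj S that] d_car D_car
    by (simp add: M.hnorm_sq L.hnorm_sq) (simp add: D_def l2_single_def)
  have X_norm: "(hnorm ?M (X x))\<^sup>2 = (hnorm H x)\<^sup>2" if "x \<in> carrier H" for x
    using that X_inner X_car by (simp add: M.hnorm_sq hnorm_sq)
  define Y where "Y x = X (S x) \<oplus>\<^bsub>?M\<^esub> D x" for x
  have Y_car: "Y x \<in> carrier ?M" if "x \<in> carrier H" for x
    unfolding Y_def using that X_car S_car D_car by blast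
  have Y_lin: "linear_op H ?M Y"
  proof (rule linear_opI)
    have lin: "linear_op H ?M (\<lambda>x. X (S x))" using linS X_lin by (rule linear_op_compose)
    show "Y (x \<oplus>\<^bsub>H\<^esub> y) = Y x \<oplus>\<^bsub>?M\<^esub> Y y" if "x \<in> carrier H" "y \<in> carrier H" for x y
      unfolding Y_def linear_op_add[OF lin that] linear_op_add[OF \<open>linear_op H ?M D\<close> that]
      using that X_car S_car D_car by (intro M.cinner_ext) (auto simp: M.cinner_add_right simp del: l2_simps)
    show "Y (a \<odot>\<^bsub>H\<^esub> x) = a \<odot>\<^bsub>?M\<^esub> Y x" if "x \<in> carrier H" for a x
      unfolding Y_def linear_op_smult[OF lin that] linear_op_smult[OF \<open>linear_op H ?M D\<close> that]
      using that X_car S_car D_car by (intro M.smult_r_distr[symmetric]) auto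
  qed (rule Y_car)
  have "isometric_embedding H ?M Y"
  proof (rule isometric_embeddingI[OF inner_product_module_axioms M.inner_product_module_axioms Y_lin])
    fix x assume x: "x \<in> carrier H"
    show "(hnorm ?M (Y x))\<^sup>2 = (hnorm H x)\<^sup>2"
      unfolding Y_def using x S_car X_car D_car
      by (simp add: M.hnorm_add_sq ortho' D_norm X_norm del: l2_simps)
  qed
  moreover have "Y x b = \<zero>\<^bsub>?L\<^esub>" if "x \<in> carrier H" "Suc m \<le> b" for x b
    using that unused[OF S_car[OF that(1)], of b] by (simp add: Y_def D_def l2_single_def)
  moreover have "cinner ?M (X x) (Y y) = cinner H x (S y)" if "x \<in> carrier H" "y \<in> carrier H" for x y
    unfolding Y_def using that S_car X_car D_car
    by (simp add: M.cinner_add_right ortho' X_inner del: l2_simps)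
  ultimately show ?thesis by (rule that)
qed

end

section \<open>Induced trees in the cubic lattice\<close>

type_synonym point = "int \<times> int \<times> int"

definition unit_vec :: "nat \<Rightarrow> point" where
  "unit_vec i = (if i = 0 then (1, 0, 0) else if i = 1 then (0, 1, 0) else (0, 0, 1))"

definition neighbours :: "point \<Rightarrow> point \<Rightarrow> bool" where
  "neighbours p q \<longleftrightarrow> (\<exists>i<3. q = p + unit_vec i \<or> p = q + unit_vec i)"

text \<open>These are the finite sets of lattice points that induce a tree in the lattice graph. That the new point \<open>m\<close> has
  only one neighbour in \<open>N\<close> ensures that two adjacent points of the set are always joined by an edge of the tree.\<close>

inductive lattice_tree :: "point set \<Rightarrow> bool" where
  single: "lattice_tree {p}"
| grow: "\<lbrakk>lattice_tree N; p \<in> N; m \<notin> N; neighbours p m; \<And>q. q \<in> N \<Longrightarrow> neighbours q m \<Longrightarrow> q = p\<rbrakk>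
    \<Longrightarrow> lattice_tree (insert m N)"

lemma less_3_cases: "(i::nat) < 3 \<longleftrightarrow> i = 0 \<or> i = 1 \<or> i = 2"
  by auto

lemma ex_less_3: "(\<exists>i<3. P (i::nat)) \<longleftrightarrow> P 0 \<or> P 1 \<or> P 2"
  by (auto simp: less_3_cases)

lemma abs_sum_eq_1_cases:
  fixes x y z x' y' z' :: int
  assumes "\<bar>x - x'\<bar> + \<bar>y - y'\<bar> + \<bar>z - z'\<bar> = 1"
  obtains "\<bar>x - x'\<bar> = 1" "y = y'" "z = z'" | "\<bar>y - y'\<bar> = 1" "x = x'" "z = z'"
    | "\<bar>z - z'\<bar> = 1" "x = x'" "y = y'"
proof -
  have "a = 1 \<and> b = 0 \<and> c = 0 \<or> a = 0 \<and> b = 1 \<and> c = 0 \<or> a = 0 \<and> b = 0 \<and> c = 1"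
    if "a + b + c = 1" "0 \<le> a" "0 \<le> b" "0 \<le> c" for a b c :: int
    using that by linarith
  from this[OF assms] that show ?thesis by (metis abs_ge_zero abs_0_eq eq_iff_diff_eq_0)
qed

lemma neighbours_coords:
  "neighbours (x, y, z) (x', y', z') \<longleftrightarrow> \<bar>x - x'\<bar> + \<bar>y - y'\<bar> + \<bar>z - z'\<bar> = 1"
proof
  assume "\<bar>x - x'\<bar> + \<bar>y - y'\<bar> + \<bar>z - z'\<bar> = 1"
  then consider "\<bar>x - x'\<bar> = 1" "y = y'" "z = z'" | "\<bar>y - y'\<bar> = 1" "x = x'" "z = z'"
    | "\<bar>z - z'\<bar> = 1" "x = x'" "y = y'" by (rule abs_sum_eq_1_cases)
  then show "neighbours (x, y, z) (x', y', z')"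
    by cases (auto simp: neighbours_def ex_less_3 unit_vec_def abs_if split: if_splits)
qed (auto simp: neighbours_def ex_less_3 unit_vec_def)

lemma neighbours_sym: "neighbours p q \<Longrightarrow> neighbours q p"
  by (auto simp: neighbours_def)

lemma neighbours_translate: "neighbours (r + p) (r + q) \<longleftrightarrow> neighbours p q"
  by (simp add: neighbours_def add.assoc)

lemma double_inject: "p + p = q + q \<longleftrightarrow> p = (q :: point)"
  by (cases p; cases q) auto

definition level :: "point \<Rightarrow> int" where
  "level p = fst p + fst (snd p) + snd (snd p)"

lemma level_add: "level (p + q) = level p + level q"
  by (simp add: level_def)

lemma level_unit_vec: "level (unit_vec i) = 1"
  by (simp add: level_def unit_vec_def)

text \<open>The cubic lattice is bipartite.\<close>

lemma neighbours_odd_level: "neighbours p q \<Longrightarrow> odd (level p + level q)"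
  by (auto simp: neighbours_def level_add level_unit_vec)

lemma double_neq_midpoint:
  assumes "neighbours p q"
  shows "p + q \<noteq> r + r"
proof
  assume "p + q = r + r"
  then have "level p + level q = 2 * level r" by (metis level_add mult_2)
  then show False using neighbours_odd_level[OF assms] by simp
qed

lemma doubles_not_neighbours: "\<not> neighbours (p + p) (q + q)"
  using neighbours_odd_level[of "p + p" "q + q"] by (auto simp: level_add)

lemma midpoints_not_neighbours:
  assumes "neighbours p q" "neighbours r s"
  shows "\<not> neighbours (p + q) (r + s)"
  using neighbours_odd_level[OF assms(1)] neighbours_odd_level[OF assms(2)]
    neighbours_odd_level[of "p + q" "r + s"] by (auto simp: level_add)

lemma double_between_consecutive:
  fixes u x x' :: int
  assumes "\<bar>x - x'\<bar> = 1"
  shows "1 \<le> \<bar>u + u - (x + x')\<bar>" "\<bar>u + u - (x + x')\<bar> = 1 \<Longrightarrow> u = x \<or> u = x'"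
  using assms by presburger+

text \<open>Doubling the coordinates subdivides every edge of the lattice graph by one midpoint, which has the two ends of the
  edge as its only neighbours among the doubled points.\<close>

lemma midpoint_neighbours_iff:
  assumes "neighbours p q"
  shows "neighbours (r + r) (p + q) \<longleftrightarrow> r = p \<or> r = q"
proof
  obtain x y z x' y' z' u v w where eq: "p = (x, y, z)" "q = (x', y', z')" "r = (u, v, w)"
    by (cases p; cases q; cases r) blast
  assume "neighbours (r + r) (p + q)"
  then have n: "\<bar>u + u - (x + x')\<bar> + \<bar>v + v - (y + y')\<bar> + \<bar>w + w - (z + z')\<bar> = 1"
    by (simp add: eq neighbours_coords)
  have "\<bar>x - x'\<bar> + \<bar>y - y'\<bar> + \<bar>z - z'\<bar> = 1" using assms by (simp add: eq neighbours_coords)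
  then consider "\<bar>x - x'\<bar> = 1" "y = y'" "z = z'" | "\<bar>y - y'\<bar> = 1" "x = x'" "z = z'"
    | "\<bar>z - z'\<bar> = 1" "x = x'" "y = y'" by (rule abs_sum_eq_1_cases)
  then show "r = p \<or> r = q"
  proof cases
    case 1
    note d = double_between_consecutive[OF 1(1), of u]
    have "v = y" "w = z" "\<bar>u + u - (x + x')\<bar> = 1" using n d(1) 1(2,3) by linarith+
    with d(2) 1(2,3) show ?thesis unfolding eq by blast
  next
    case 2
    note d = double_between_consecutive[OF 2(1), of v]
    have "u = x" "w = z" "\<bar>v + v - (y + y')\<bar> = 1" using n d(1) 2(2,3) by linarith+
    with d(2) 2(2,3) show ?thesis unfolding eq by blast
  next
    case 3
    note d = double_between_consecutive[OF 3(1), of w]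
    have "u = x" "v = y" "\<bar>w + w - (z + z')\<bar> = 1" using n d(1) 3(2,3) by linarith+
    with d(2) 3(2,3) show ?thesis unfolding eq by blast
  qed
next
  assume "r = p \<or> r = q"
  then show "neighbours (r + r) (p + q)"
  proof
    assume "r = q"
    then show ?thesis using neighbours_sym[OF assms] neighbours_translate[of q q p] by (simp add: add.commute)
  qed (use assms in \<open>simp add: neighbours_translate\<close>)
qed

lemma midpoint_inject:
  assumes "neighbours p q" "neighbours r s" "p + q = r + s"
  shows "p = r \<and> q = s \<or> p = s \<and> q = r"
proof -
  have "neighbours (r + r) (p + q)"
    unfolding assms(3) using assms(2) by (simp add: midpoint_neighbours_iff)
  then consider "r = p" | "r = q" using assms(1) by (auto simp: midpoint_neighbours_iff)
  then show ?thesis using assms(3) by cases (simp_all add: add.commute)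
qed

text \<open>In doubled coordinates \<open>p + q\<close> is the midpoint of \<open>p\<close> and \<open>q\<close>. The midpoints of the edges that leave
  \<open>N\<close> become leaves.\<close>

definition subdivision :: "point set \<Rightarrow> point set" where
  "subdivision N = {p + p | p. p \<in> N} \<union> {p + q | p q. p \<in> N \<and> neighbours p q}"

lemma subdivision_cases:
  assumes "x \<in> subdivision N"
  obtains (double) r where "x = r + r" "r \<in> N" | (midpoint) r s where "x = r + s" "r \<in> N" "neighbours r s"
  using assms unfolding subdivision_def by blast

lemma subdivision_midpoint: "p \<in> N \<Longrightarrow> neighbours p q \<Longrightarrow> p + q \<in> subdivision N"
  unfolding subdivision_def by blast

lemma lattice_tree_finite: "lattice_tree N \<Longrightarrow> finite N"
  by (induction rule: lattice_tree.induct) auto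

lemma lattice_tree_add_leaves:
  assumes "finite F" "lattice_tree N" "p \<in> N" "F \<inter> N = {}"
    and "\<And>m. m \<in> F \<Longrightarrow> neighbours p m" "\<And>m q. m \<in> F \<Longrightarrow> q \<in> N \<Longrightarrow> neighbours q m \<Longrightarrow> q = p"
    and "\<And>m m'. m \<in> F \<Longrightarrow> m' \<in> F \<Longrightarrow> \<not> neighbours m m'"
  shows "lattice_tree (F \<union> N)"
  using assms
proof (induction F rule: finite_induct)
  case empty
  show ?case using empty(1) by (simp only: Un_empty_left)
next
  case (insert m F)
  have disjoint: "F \<inter> N = {}" "m \<notin> N" using insert.prems(3) by blast+
  have IH: "lattice_tree (F \<union> N)"
  proof (rule insert.IH[OF insert.prems(1,2) disjoint(1)])
    show "neighbours p v" if "v \<in> F" for v using that by (intro insert.prems(4) insertI2)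
    show "q = p" if "v \<in> F" "q \<in> N" "neighbours q v" for v q
      by (rule insert.prems(5)[OF insertI2[OF that(1)] that(2,3)])
    show "\<not> neighbours v v'" if "v \<in> F" "v' \<in> F" for v v'
      by (rule insert.prems(6)[OF insertI2[OF that(1)] insertI2[OF that(2)]])
  qed
  have "lattice_tree (insert m (F \<union> N))"
  proof (rule lattice_tree.grow[OF IH, of p])
    show "p \<in> F \<union> N" using insert.prems(2) by (rule UnI2)
    show "m \<notin> F \<union> N" using insert.hyps(2) disjoint(2) by simp
    show "neighbours p m" by (rule insert.prems(4)[OF insertI1])
    fix q assume q: "q \<in> F \<union> N" "neighbours q m"
    have "q \<notin> F" using insert.prems(6)[OF insertI2 insertI1] q(2) by blast
    then have "q \<in> N" using q(1) by simp
    then show "q = p" using q(2) by (rule insert.prems(5)[OF insertI1])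
  qed
  then show ?case by (simp only: Un_insert_left)
qed

lemma finite_neighbours: "finite {q. neighbours p q}"
proof (rule finite_subset)
  show "{q. neighbours p q} \<subseteq> (\<lambda>i. p + unit_vec i) ` {..<3} \<union> (\<lambda>i. p - unit_vec i) ` {..<3}"
  proof
    fix q assume "q \<in> {q. neighbours p q}"
    then obtain i where i: "i < 3" "q = p + unit_vec i \<or> p = q + unit_vec i"
      unfolding neighbours_def by blast
    from i(2) have "q = p + unit_vec i \<or> q = p - unit_vec i" by (metis add_diff_cancel_right')
    then show "q \<in> (\<lambda>i. p + unit_vec i) ` {..<3} \<union> (\<lambda>i. p - unit_vec i) ` {..<3}"
      using i(1) by blast
  qed
qed simp

text \<open>Growing the tree by a point \<open>m\<close> next to \<open>p\<close> grows the subdivision by the point \<open>m + m\<close>, which is attached to the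
  midpoint \<open>m + p\<close> that is already there, and then by the other five midpoints around \<open>m + m\<close>, which are leaves.\<close>

lemma lattice_tree_subdivision: "lattice_tree N \<Longrightarrow> lattice_tree (subdivision N)"
proof (induction rule: lattice_tree.induct)
  case (single p)
  have "lattice_tree ((+) p ` {q. neighbours p q} \<union> {p + p})"
  proof (rule lattice_tree_add_leaves[OF _ lattice_tree.single, of _ "p + p"])
    show "finite ((+) p ` {q. neighbours p q})" by (simp add: finite_neighbours)
    show "(+) p ` {q. neighbours p q} \<inter> {p + p} = {}"
      using double_neq_midpoint[of p _ p] by blast
    show "neighbours (p + p) m" if "m \<in> (+) p ` {q. neighbours p q}" for m
      using that by (elim imageE) (simp add: midpoint_neighbours_iff)
    show "\<not> neighbours m m'"
      if "m \<in> (+) p ` {q. neighbours p q}" "m' \<in> (+) p ` {q. neighbours p q}" for m m'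
      using that midpoints_not_neighbours by blast
  qed simp_all
  also have "(+) p ` {q. neighbours p q} \<union> {p + p} = subdivision {p}"
    unfolding subdivision_def by blast
  finally show ?case .
next
  case (grow N p m)
  have pm: "neighbours m p" using grow.hyps by (blast intro: neighbours_sym)
  have old_midpoint: "q = p" if "neighbours m q" "m + q \<in> subdivision N" for q
  proof -
    from that(2) have "q \<in> N"
    proof (cases rule: subdivision_cases)
      case (double r)
      then show ?thesis using double_neq_midpoint[OF that(1)] by blast
    next
      case (midpoint r s)
      then show ?thesis using midpoint_inject[OF that(1) midpoint(3,1)] grow.hyps(3) by blast
    qed
    then show ?thesis using grow.hyps(5) neighbours_sym[OF that(1)] by blast
  qed
  have double_in: "q \<in> N" if "q + q \<in> subdivision N" for q
    using that
  proof (cases rule: subdivision_cases)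
    case (double r)
    then show ?thesis using double by (simp only: double_inject)
  next
    case (midpoint r s)
    then show ?thesis using double_neq_midpoint[OF midpoint(3), of q] by simp
  qed
  have pm_in: "m + p \<in> subdivision N"
    using subdivision_midpoint[OF grow.hyps(2,4)] by (simp only: add.commute)
  have tree1: "lattice_tree (insert (m + m) (subdivision N))"
  proof (rule lattice_tree.grow[OF grow.IH pm_in])
    show "m + m \<notin> subdivision N" using double_in grow.hyps by blast
    show "neighbours (m + p) (m + m)"
      using pm by (intro neighbours_sym[of "m + m"]) (simp add: midpoint_neighbours_iff)
    fix q assume q: "q \<in> subdivision N" "neighbours q (m + m)"
    from q(1) show "q = m + p"
    proof (cases rule: subdivision_cases)
      case (double r)
      then show ?thesis using q(2) doubles_not_neighbours by simp
    next
      case (midpoint r s)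
      then have "m = r \<or> m = s"
        using neighbours_sym[OF q(2)] midpoint_neighbours_iff[OF midpoint(3)] by simp
      then have "m = s" using midpoint(2) grow.hyps(3) by blast
      then have q_eq: "q = m + r" and r: "neighbours m r"
        using midpoint(1) neighbours_sym[OF midpoint(3)] by (simp_all only: add.commute)
      then show ?thesis using old_midpoint[OF r] q(1) by simp
    qed
  qed
  define F where "F = (+) m ` {q. neighbours m q} - {m + p}"
  have F: "\<exists>q. v = m + q \<and> neighbours m q \<and> q \<noteq> p" if "v \<in> F" for v
    using that unfolding F_def by blast
  have "lattice_tree (F \<union> insert (m + m) (subdivision N))"
  proof (rule lattice_tree_add_leaves[OF _ tree1, of _ "m + m"])
    show "finite F" by (simp add: F_def finite_neighbours)
    show "F \<inter> insert (m + m) (subdivision N) = {}"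
    proof -
      have "v \<notin> insert (m + m) (subdivision N)" if v: "v \<in> F" for v
      proof -
        obtain q where q: "v = m + q" "neighbours m q" "q \<noteq> p" using F[OF v] by blast
        have "m + q \<notin> insert (m + m) (subdivision N)"
          using q(2,3) old_midpoint[of q] double_neq_midpoint[of m q m] by blast
        then show ?thesis unfolding q(1) .
      qed
      then show ?thesis by blast
    qed
    show "neighbours (m + m) v" if "v \<in> F" for v
      using F[OF that] by (elim exE) (simp add: midpoint_neighbours_iff)
    show "\<not> neighbours v v'" if "v \<in> F" "v' \<in> F" for v v'
      using F[OF that(1)] F[OF that(2)] midpoints_not_neighbours by blast
    fix v r assume v: "v \<in> F" and r: "r \<in> insert (m + m) (subdivision N)" "neighbours r v"
    obtain q where q: "v = m + q" "neighbours m q" "q \<noteq> p" using F[OF v] by blast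
    show "r = m + m"
    proof (rule ccontr)
      assume "r \<noteq> m + m"
      then have "r \<in> subdivision N" using r(1) by blast
      then show False
      proof (cases rule: subdivision_cases)
        case (double s)
        then have "s = m \<or> s = q" using r(2) q midpoint_neighbours_iff[OF q(2)] by simp
        then have "q \<in> N" using double \<open>r \<noteq> m + m\<close> by blast
        then show False using grow.hyps(5) q neighbours_sym by blast
      next
        case (midpoint s t)
        then show False using r(2) q midpoints_not_neighbours by simp
      qed
    qed
  qed simp
  also have "F \<union> insert (m + m) (subdivision N) = subdivision (insert m N)"
  proof
    show "F \<union> insert (m + m) (subdivision N) \<subseteq> subdivision (insert m N)"
      unfolding F_def subdivision_def by blast
    show "subdivision (insert m N) \<subseteq> F \<union> insert (m + m) (subdivision N)"
    proof
      fix x assume "x \<in> subdivision (insert m N)"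
      then show "x \<in> F \<union> insert (m + m) (subdivision N)"
      proof (cases rule: subdivision_cases)
        case (midpoint r s)
        show ?thesis
        proof (cases "r = m")
          case True
          then show ?thesis using midpoint pm_in unfolding F_def by blast
        next
          case False
          then show ?thesis using midpoint unfolding subdivision_def by blast
        qed
      next
        case (double r)
        then show ?thesis unfolding subdivision_def by blast
      qed
    qed
  qed
  finally show ?case .
qed

section \<open>Weights on induced trees\<close>

text \<open>Compressed along the weights \<open>c\<close>, the three lattice shifts become \<open>\<kappa>\<close> times the given contractions, so a large
  \<open>\<kappa>\<close> means a dilation of small norm.\<close>

definition tree_weight :: "real \<Rightarrow> point set \<Rightarrow> (point \<Rightarrow> real) \<Rightarrow> bool" where
  "tree_weight \<kappa> N c \<longleftrightarrow> lattice_tree N \<and> (\<forall>p. p \<notin> N \<longrightarrow> c p = 0) \<and> (\<Sum>p\<in>N. (c p)\<^sup>2) = 1 \<and>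
     (\<forall>i<3. (\<Sum>p\<in>N. c p * c (p + unit_vec i)) = \<kappa>)"

definition half :: "point \<Rightarrow> point" where
  "half p = (case p of (x, y, z) \<Rightarrow> (x div 2, y div 2, z div 2))"

definition parity :: "point \<Rightarrow> point" where
  "parity p = (case p of (x, y, z) \<Rightarrow> (x mod 2, y mod 2, z mod 2))"

text \<open>In terms of doubled coordinates, \<open>a * c p\<close> at \<open>p + p\<close> and \<open>b * (c p + c q)\<close> at the midpoint \<open>p + q\<close> of adjacent
  points: \<open>half p + half p + parity p\<close> is \<open>p\<close>, and it is a midpoint if \<open>parity p\<close> is a unit vector.\<close>

definition subdivided_weight :: "real \<Rightarrow> real \<Rightarrow> (point \<Rightarrow> real) \<Rightarrow> point \<Rightarrow> real" where
  "subdivided_weight a b c p =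
     (if parity p = 0 then a * c (half p)
      else if \<exists>i<3. parity p = unit_vec i then b * (c (half p) + c (half p + parity p)) else 0)"

lemma unit_vec_coords: "unit_vec 0 = (1, 0, 0)" "unit_vec (Suc 0) = (0, 1, 0)" "unit_vec 2 = (0, 0, 1)"
  by (auto simp: unit_vec_def)

lemma zero_point: "0 = (0, 0, 0 :: int)"
  by (simp add: zero_prod_def)

lemma half_double: "half (p + p) = p" "parity (p + p) = 0"
  by (cases p; simp add: half_def parity_def zero_point; presburger)+

lemma half_midpoint: "i < 3 \<Longrightarrow> half (p + p + unit_vec i) = p" "i < 3 \<Longrightarrow> parity (p + p + unit_vec i) = unit_vec i"
  by (cases p; auto simp: less_3_cases half_def parity_def unit_vec_coords; presburger)+

lemma half_parity: "p = half p + half p + parity p"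
  by (cases p; simp add: half_def parity_def; presburger)

lemma unit_vec_inject: "i < 3 \<Longrightarrow> j < 3 \<Longrightarrow> unit_vec i = unit_vec j \<longleftrightarrow> i = j"
  by (auto simp: less_3_cases unit_vec_coords)

lemma unit_vec_nonzero: "unit_vec i \<noteq> 0"
  by (auto simp: unit_vec_def zero_point)

lemma subdivided_weight_double: "subdivided_weight a b c (p + p) = a * c p"
  by (simp add: subdivided_weight_def half_double)

lemma subdivided_weight_midpoint:
  "i < 3 \<Longrightarrow> subdivided_weight a b c (p + p + unit_vec i) = b * (c p + c (p + unit_vec i))"
  by (auto simp: subdivided_weight_def half_midpoint unit_vec_nonzero)

lemma subdivided_weight_diagonal:
  assumes "i < 3" "j < 3" "i \<noteq> j"
  shows "subdivided_weight a b c (p + p + unit_vec i + unit_vec j) = 0"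
proof -
  have "parity (p + p + unit_vec i + unit_vec j) = unit_vec i + unit_vec j"
    using assms by (cases p; auto simp: less_3_cases parity_def unit_vec_coords; presburger)
  then show ?thesis using assms
    by (auto simp: less_3_cases subdivided_weight_def unit_vec_coords zero_point)
qed

lemma sum_supported_eq:
  assumes "finite A" "finite B" "\<And>p. f p \<noteq> 0 \<Longrightarrow> p \<in> A \<and> p \<in> B"
  shows "sum f A = sum f B"
proof -
  have "sum f A = sum f (A \<inter> B)" using assms by (intro sum.mono_neutral_right) auto
  also have "\<dots> = sum f B" using assms by (intro sum.mono_neutral_left) auto
  finally show ?thesis .
qed

lemma sum_shift_supported:
  fixes f :: "point \<Rightarrow> real"
  assumes "finite A" "finite B" "\<And>p. f p \<noteq> 0 \<Longrightarrow> p \<in> B \<and> p - v \<in> A"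
  shows "(\<Sum>p\<in>A. f (p + v)) = sum f B"
proof -
  have "(\<Sum>p\<in>A. f (p + v)) = sum f ((\<lambda>p. p + v) ` A)"
    by (subst sum.reindex) (auto simp: inj_on_def)
  also have "\<dots> = sum f B"
    using assms by (intro sum_supported_eq) (force intro: image_eqI[where x = "_ - v"])+
  finally show ?thesis .
qed

lemma sum_subdivision:
  fixes g :: "point \<Rightarrow> real"
  assumes "finite S" "finite T" "\<And>p. g p \<noteq> 0 \<Longrightarrow> p \<in> T"
    and "\<And>p. g p \<noteq> 0 \<Longrightarrow> half p \<in> S \<and> (parity p = 0 \<or> (\<exists>i<3. parity p = unit_vec i))"
  shows "sum g T = (\<Sum>p\<in>S. g (p + p)) + (\<Sum>i<3. \<Sum>p\<in>S. g (p + p + unit_vec i))"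
proof -
  let ?D = "(\<lambda>p. p + p) ` S" and ?M = "\<lambda>i. (\<lambda>p. p + p + unit_vec i) ` S"
  have par: "q \<in> ?M i \<Longrightarrow> parity q = unit_vec i" if "i < 3" for q i
    using that by (elim imageE) (simp add: half_midpoint)
  have "sum g T = sum g (?D \<union> (\<Union>i<3. ?M i))"
  proof (rule sum_supported_eq)
    fix p assume p: "g p \<noteq> 0"
    have "p \<in> ?D \<union> (\<Union>i<3. ?M i)"
    proof (cases "parity p = 0")
      case True
      then have "p = half p + half p" using half_parity[of p] by simp
      then show ?thesis using assms(4)[OF p] by blast
    next
      case False
      then obtain i where "i < 3" "parity p = unit_vec i" using assms(4)[OF p] by blast
      then have "p = half p + half p + unit_vec i" using half_parity[of p] by simp
      then show ?thesis using assms(4)[OF p] \<open>i < 3\<close> by blast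
    qed
    then show "p \<in> T \<and> p \<in> ?D \<union> (\<Union>i<3. ?M i)" using assms(3)[OF p] by blast
  qed (use assms in auto)
  also have "\<dots> = sum g ?D + sum g (\<Union>i<3. ?M i)"
  proof (rule sum.union_disjoint)
    show "?D \<inter> (\<Union>i<3. ?M i) = {}"
    proof -
      have "parity q = 0" if "q \<in> ?D" for q using that by (elim imageE) (simp add: half_double)
      then show ?thesis using par unit_vec_nonzero by (metis (no_types, lifting) UN_E disjoint_iff lessThan_iff)
    qed
  qed (use assms in auto)
  also have "sum g (\<Union>i<3. ?M i) = (\<Sum>i<3. sum g (?M i))"
  proof (rule sum.UNION_disjoint)
    have "?M i \<inter> ?M j = {}" if "i < 3" "j < 3" "i \<noteq> j" for i j
    proof (rule Int_emptyI)
      fix q assume "q \<in> ?M i" "q \<in> ?M j"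
      then have "unit_vec i = unit_vec j"
        using par[OF that(1), of q] par[OF that(2), of q] by (simp only:)
      then show False using unit_vec_inject[OF that(1,2)] that(3) by blast
    qed
    then show "\<forall>i\<in>{..<3}. \<forall>j\<in>{..<3}. i \<noteq> j \<longrightarrow> ?M i \<inter> ?M j = {}" by blast
  qed (use assms(1) in simp_all)
  also have "sum g ?D = (\<Sum>p\<in>S. g (p + p))"
    by (subst sum.reindex) (simp_all add: inj_on_def double_inject)
  also have "(\<Sum>i<3. sum g (?M i)) = (\<Sum>i<3. \<Sum>p\<in>S. g (p + p + unit_vec i))"
  proof (rule sum.cong[OF refl])
    show "sum g (?M i) = (\<Sum>p\<in>S. g (p + p + unit_vec i))" for i
      by (subst sum.reindex) (simp_all add: inj_on_def double_inject)
  qed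
  finally show ?thesis .
qed

text \<open>Both the norm and the correlations of the new weights reduce to \<open>\<Sum>p. (c p + c (p + e i))\<^sup>2 = 2 + 2 \<kappa>\<close>: the squares
  add up to \<open>a\<^sup>2 + b\<^sup>2 (6 + 6 \<kappa>)\<close>, and every correlation is \<open>a b (2 + 2 \<kappa>)\<close>. The correlation is largest if the two
  parts of the norm are equal.\<close>

lemma tree_weight_subdivision:
  assumes w: "tree_weight \<kappa> N c" and \<kappa>: "0 \<le> \<kappa>"
  obtains c' where "tree_weight (sqrt (6 + 6 * \<kappa>) / 6) (subdivision N) c'"
proof -
  have tree: "lattice_tree N" and off: "\<And>p. p \<notin> N \<Longrightarrow> c p = 0"
    and norm: "(\<Sum>p\<in>N. (c p)\<^sup>2) = 1" and corr: "\<And>i. i < 3 \<Longrightarrow> (\<Sum>p\<in>N. c p * c (p + unit_vec i)) = \<kappa>"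
    using w by (auto simp: tree_weight_def)
  have fin: "finite N" using tree by (rule lattice_tree_finite)
  \<comment> \<open>the two kinds of points carry half of the norm each\<close>
  define a b where "a = 1 / sqrt 2" and "b = 1 / (sqrt 2 * sqrt (6 + 6 * \<kappa>))"
  define c' where "c' = subdivided_weight a b c"
  \<comment> \<open>contains \<open>p\<close> whenever \<open>c p\<close> or \<open>c (p + unit_vec i)\<close> is nonzero\<close>
  define S where "S = N \<union> (\<Union>i<3. (\<lambda>p. p - unit_vec i) ` N)"
  have S: "finite S" "N \<subseteq> S" "\<And>p i. i < 3 \<Longrightarrow> p \<in> N \<Longrightarrow> p - unit_vec i \<in> S"
    using fin by (auto simp: S_def)
  have c_supp: "c p \<noteq> 0 \<Longrightarrow> p \<in> N" for p using off by blast
  have square: "(\<Sum>p\<in>S. (c p + c (p + unit_vec i))\<^sup>2) = 2 + 2 * \<kappa>" if i: "i < 3" for i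
  proof -
    have "(\<Sum>p\<in>S. (c p + c (p + unit_vec i))\<^sup>2)
        = (\<Sum>p\<in>S. (c p)\<^sup>2) + (\<Sum>p\<in>S. (c (p + unit_vec i))\<^sup>2) + 2 * (\<Sum>p\<in>S. c p * c (p + unit_vec i))"
      by (simp add: power2_sum sum.distrib sum_distrib_left mult.assoc)
    also have "(\<Sum>p\<in>S. (c p)\<^sup>2) = (\<Sum>p\<in>N. (c p)\<^sup>2)"
      using S fin c_supp by (intro sum_supported_eq) auto
    also have "(\<Sum>p\<in>S. (c (p + unit_vec i))\<^sup>2) = (\<Sum>p\<in>N. (c p)\<^sup>2)"
      using S fin c_supp i by (intro sum_shift_supported) auto
    also have "(\<Sum>p\<in>S. c p * c (p + unit_vec i)) = (\<Sum>p\<in>N. c p * c (p + unit_vec i))"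
      using S fin c_supp by (intro sum_supported_eq) auto
    finally show ?thesis using norm corr[OF i] by simp
  qed
  have b: "b\<^sup>2 * (6 + 6 * \<kappa>) = 1 / 2" and a: "a\<^sup>2 = 1 / 2"
    using \<kappa> by (simp_all add: a_def b_def power_divide power_mult_distrib)
  have supp: "p \<in> subdivision N \<and> half p \<in> S \<and> (parity p = 0 \<or> (\<exists>i<3. parity p = unit_vec i))"
    if p: "c' p \<noteq> 0" for p
  proof -
    consider (double) "parity p = 0" "half p \<in> N"
      | (midpoint) i where "i < 3" "parity p = unit_vec i" "half p \<in> N \<or> half p + unit_vec i \<in> N"
      using p off[of "half p"] off[of "half p + parity p"] unfolding c'_def subdivided_weight_def
      by (metis add.right_neutral mult_zero_right)
    then show ?thesis
    proof cases
      case double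
      then have "p = half p + half p" using half_parity[of p] by simp
      then show ?thesis using double S(2) unfolding subdivision_def by blast
    next
      case (midpoint i)
      let ?q = "half p + unit_vec i"
      have p_eq: "p = half p + ?q" "p = ?q + half p"
        using half_parity[of p] midpoint(2) by (simp_all add: algebra_simps)
      have nb: "neighbours (half p) ?q" using midpoint(1) unfolding neighbours_def by blast
      have "p \<in> subdivision N"
        using midpoint(3) subdivision_midpoint[OF _ nb] subdivision_midpoint[OF _ neighbours_sym[OF nb]] p_eq
        by metis
      moreover have "half p \<in> S"
        using midpoint(3) S(2) S(3)[OF midpoint(1), of ?q] by (metis add_diff_cancel_right' subsetD)
      ultimately show ?thesis using midpoint(1,2) by blast
    qed
  qed
  have tree': "lattice_tree (subdivision N)" using tree by (rule lattice_tree_subdivision)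
  have fin': "finite (subdivision N)" using tree' by (rule lattice_tree_finite)
  have "tree_weight (sqrt (6 + 6 * \<kappa>) / 6) (subdivision N) c'"
    unfolding tree_weight_def
  proof (intro conjI allI impI tree')
    show "c' p = 0" if "p \<notin> subdivision N" for p using that supp by blast
    have "(\<Sum>p\<in>subdivision N. (c' p)\<^sup>2)
        = (\<Sum>p\<in>S. (c' (p + p))\<^sup>2) + (\<Sum>i<3. \<Sum>p\<in>S. (c' (p + p + unit_vec i))\<^sup>2)"
      using supp by (intro sum_subdivision S fin') (metis zero_power2)+
    also have "(\<Sum>p\<in>S. (c' (p + p))\<^sup>2) = a\<^sup>2 * (\<Sum>p\<in>S. (c p)\<^sup>2)"
      by (simp add: c'_def subdivided_weight_double power_mult_distrib sum_distrib_left)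
    also have "(\<Sum>p\<in>S. (c p)\<^sup>2) = (\<Sum>p\<in>N. (c p)\<^sup>2)"
      using S fin c_supp by (intro sum_supported_eq) auto
    also have "(\<Sum>i<3. \<Sum>p\<in>S. (c' (p + p + unit_vec i))\<^sup>2) = (\<Sum>i<(3::nat). b\<^sup>2 * (2 + 2 * \<kappa>))"
    proof (rule sum.cong[OF refl])
      fix i :: nat assume "i \<in> {..<3}"
      then have i: "i < 3" by simp
      have "(\<Sum>p\<in>S. (c' (p + p + unit_vec i))\<^sup>2) = b\<^sup>2 * (\<Sum>p\<in>S. (c p + c (p + unit_vec i))\<^sup>2)"
        by (simp add: c'_def subdivided_weight_midpoint[OF i] power_mult_distrib sum_distrib_left)
      then show "(\<Sum>p\<in>S. (c' (p + p + unit_vec i))\<^sup>2) = b\<^sup>2 * (2 + 2 * \<kappa>)" by (simp add: square[OF i])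
    qed
    finally show "(\<Sum>p\<in>subdivision N. (c' p)\<^sup>2) = 1"
      using a b norm by (simp add: algebra_simps)
    fix i :: nat assume i: "i < 3"
    have "(\<Sum>p\<in>subdivision N. c' p * c' (p + unit_vec i))
        = (\<Sum>p\<in>S. c' (p + p) * c' (p + p + unit_vec i))
          + (\<Sum>j<3. \<Sum>p\<in>S. c' (p + p + unit_vec j) * c' (p + p + unit_vec j + unit_vec i))"
      using supp by (intro sum_subdivision S fin') (metis mult_zero_left)+
    also have "(\<Sum>j<3. \<Sum>p\<in>S. c' (p + p + unit_vec j) * c' (p + p + unit_vec j + unit_vec i))
        = (\<Sum>j<3. if j = i then \<Sum>p\<in>S. c' (p + p + unit_vec i) * c' ((p + unit_vec i) + (p + unit_vec i)) else 0)"
    proof (rule sum.cong[OF refl])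
      fix j :: nat assume "j \<in> {..<3}"
      then have j: "j < 3" by simp
      show "(\<Sum>p\<in>S. c' (p + p + unit_vec j) * c' (p + p + unit_vec j + unit_vec i))
          = (if j = i then \<Sum>p\<in>S. c' (p + p + unit_vec i) * c' ((p + unit_vec i) + (p + unit_vec i)) else 0)"
      proof (cases "j = i")
        case True
        have shift: "p + p + unit_vec i + unit_vec i = (p + unit_vec i) + (p + unit_vec i)" for p
          by (simp only: add_ac)
        show ?thesis unfolding True shift by simp
      next
        case False
        then show ?thesis by (simp add: c'_def subdivided_weight_diagonal[OF j i])
      qed
    qed
    also have "\<dots> = (\<Sum>p\<in>S. c' (p + p + unit_vec i) * c' ((p + unit_vec i) + (p + unit_vec i)))"
      using i by simp
    also have "(\<Sum>p\<in>S. c' (p + p) * c' (p + p + unit_vec i)) + \<dots> = a * b * (\<Sum>p\<in>S. (c p + c (p + unit_vec i))\<^sup>2)"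
      unfolding c'_def subdivided_weight_double subdivided_weight_midpoint[OF i]
      by (simp add: sum_distrib_left power2_eq_square algebra_simps flip: sum.distrib)
    also have "\<dots> = a * b * (2 + 2 * \<kappa>)" by (simp only: square[OF i])
    also have "a * b = 1 / (2 * sqrt (6 + 6 * \<kappa>))"
      unfolding a_def b_def by (simp flip: mult.assoc)
    also have "1 / (2 * sqrt (6 + 6 * \<kappa>)) * (2 + 2 * \<kappa>) = sqrt (6 + 6 * \<kappa>) / 6"
    proof -
      have "0 < sqrt (6 + 6 * \<kappa>)" using \<kappa> by simp
      moreover have "sqrt (6 + 6 * \<kappa>) * sqrt (6 + 6 * \<kappa>) = 6 + 6 * \<kappa>" using \<kappa> by simp
      ultimately show ?thesis by (simp add: field_simps)
    qed
    finally show "(\<Sum>p\<in>subdivision N. c' p * c' (p + unit_vec i)) = sqrt (6 + 6 * \<kappa>) / 6" .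
  qed
  then show ?thesis by (rule that)
qed

lemma tree_weight_single: "tree_weight 0 {0} (\<lambda>p. if p = 0 then 1 else 0)"
  unfolding tree_weight_def
  by (simp add: lattice_tree.single unit_vec_nonzero)

lemma tree_weight_three_subdivisions:
  obtains N c where "tree_weight (sqrt (6 + sqrt (6 + sqrt 6)) / 6) N c"
proof -
  obtain c1 where 1: "tree_weight (sqrt 6 / 6) (subdivision {0}) c1"
    using tree_weight_subdivision[OF tree_weight_single] by auto
  obtain c2 where 2: "tree_weight (sqrt (6 + sqrt 6) / 6) (subdivision (subdivision {0})) c2"
    using tree_weight_subdivision[OF 1] by auto
  obtain c3 where "tree_weight (sqrt (6 + sqrt (6 + sqrt 6)) / 6) (subdivision (subdivision (subdivision {0}))) c3"
    using tree_weight_subdivision[OF 2] by auto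
  then show ?thesis by (rule that)
qed

section \<open>Isometries along a tree\<close>

lemma (in inner_product_module) isometric_l2_single: "isometric_embedding H (l2 H) (l2_single H i)"
proof -
  have "cinner (l2 H) (l2_single H i x) (l2_single H i y) = cinner H x y" if "x \<in> carrier H" "y \<in> carrier H" for x y
    using cinner_l2_finite[of "{i}", OF _ l2_single_carrier[OF that(1), of i] l2_single_carrier[OF that(2), of i]]
    by (simp add: l2_single_def)
  moreover have "linear_op H (l2 H) (l2_single H i)"
    by (rule linear_opI[OF l2_single_carrier]) (auto simp: l2_single_def fun_eq_iff)
  ultimately show ?thesis by (simp add: isometric_embedding_def)
qed

lemma isometric_embedding_compose:
  assumes "isometric_embedding H K V" "isometric_embedding K L W"
  shows "isometric_embedding H L (\<lambda>x. W (V x))"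
  using assms linear_op_compose[of H K V L W] linear_op_carrier[of H K V]
  by (simp add: isometric_embedding_def)

lemma unit_vec_sum_nonzero: "unit_vec i + unit_vec j \<noteq> 0"
proof
  assume "unit_vec i + unit_vec j = 0"
  then have "level 0 = 2" using level_add[of "unit_vec i" "unit_vec j"] by (simp add: level_unit_vec)
  then show False by (simp add: level_def)
qed

text \<open>One Gram--Schmidt step for every point of the tree. The number \<open>m\<close> in the induction bounds the coordinates that
  are in use. If the new point \<open>q\<close> precedes its neighbour \<open>p\<close>, the prescribed inner product is read from the other
  side, and the adjoint of \<open>A i\<close> takes the place of \<open>A i\<close>.\<close>

lemma (in inner_product_module) tree_isometries:
  assumes adj: "\<And>i. i < 3 \<Longrightarrow> adjoint_pair H (A i) (A' i)"
    and contr: "\<And>i x. i < 3 \<Longrightarrow> x \<in> carrier H \<Longrightarrow> hnorm H (A i x) \<le> hnorm H x"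
    and tree: "lattice_tree N"
  obtains X :: "point \<Rightarrow> 'a \<Rightarrow> nat \<Rightarrow> nat \<Rightarrow> 'a"
    where "\<And>p. p \<in> N \<Longrightarrow> isometric_embedding H (l2 (l2 H)) (X p)"
    and "\<And>p i x y. \<lbrakk>i < 3; p \<in> N; p + unit_vec i \<in> N; x \<in> carrier H; y \<in> carrier H\<rbrakk>
      \<Longrightarrow> cinner (l2 (l2 H)) (X p x) (X (p + unit_vec i) y) = cinner H x (A i y)"
proof -
  let ?L = "l2 H :: (nat \<Rightarrow> 'a) inner_module"
  let ?M = "l2 ?L :: (nat \<Rightarrow> nat \<Rightarrow> 'a) inner_module"
  interpret L: inner_product_module ?L by (rule l2_inner_product_module)
  interpret M: inner_product_module ?M by (rule L.l2_inner_product_module)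
  have "\<exists>(X :: point \<Rightarrow> 'a \<Rightarrow> nat \<Rightarrow> nat \<Rightarrow> 'a) m.
      (\<forall>p\<in>N. isometric_embedding H ?M (X p)) \<and>
      (\<forall>p\<in>N. \<forall>x\<in>carrier H. \<forall>b\<ge>m. X p x b = \<zero>\<^bsub>?L\<^esub>) \<and>
      (\<forall>i<3. \<forall>p\<in>N. p + unit_vec i \<in> N \<longrightarrow>
        (\<forall>x\<in>carrier H. \<forall>y\<in>carrier H. cinner ?M (X p x) (X (p + unit_vec i) y) = cinner H x (A i y)))"
    using tree
  proof (induction rule: lattice_tree.induct)
    case (single p)
    have "isometric_embedding H ?M (\<lambda>x. l2_single ?L 0 (l2_single H 0 x))"
      by (rule isometric_embedding_compose[OF isometric_l2_single L.isometric_l2_single])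
    then show ?case
      by (intro exI[of _ "\<lambda>_ x. l2_single ?L 0 (l2_single H 0 x)"] exI[of _ 1])
        (auto simp: l2_single_def unit_vec_nonzero simp del: l2_simps)
  next
    case (grow N p q)
    then obtain X m where X: "\<And>p. p \<in> N \<Longrightarrow> isometric_embedding H ?M (X p)"
      and unused: "\<And>p x b. p \<in> N \<Longrightarrow> x \<in> carrier H \<Longrightarrow> m \<le> b \<Longrightarrow> X p x b = \<zero>\<^bsub>?L\<^esub>"
      and edge: "\<And>i p x y. \<lbrakk>i < 3; p \<in> N; p + unit_vec i \<in> N; x \<in> carrier H; y \<in> carrier H\<rbrakk>
        \<Longrightarrow> cinner ?M (X p x) (X (p + unit_vec i) y) = cinner H x (A i y)"
      by blast
    have unique: "r = p" if "r \<in> N" "neighbours r q" for r using grow.hyps(5) that by blast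
    obtain i where i: "i < 3" "q = p + unit_vec i \<or> p = q + unit_vec i"
      using grow.hyps(4) unfolding neighbours_def by blast
    have contr': "hnorm H (A' i x) \<le> hnorm H x" if "x \<in> carrier H" for x
      using adj[OF i(1)] contr[OF i(1)] that by (rule adjoint_bound)
    define S T where "S = (if q = p + unit_vec i then A i else A' i)" and "T = (if q = p + unit_vec i then A' i else A i)"
    have ST: "adjoint_pair H S T" "\<And>x. x \<in> carrier H \<Longrightarrow> hnorm H (S x) \<le> hnorm H x"
      using adj[OF i(1)] adjoint_pair_swap[OF adj[OF i(1)]] contr[OF i(1)] contr' by (simp_all add: S_def T_def)
    obtain Y where Y: "isometric_embedding H ?M Y"
      "\<And>x b. x \<in> carrier H \<Longrightarrow> Suc m \<le> b \<Longrightarrow> Y x b = \<zero>\<^bsub>?L\<^esub>"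
      "\<And>x y. x \<in> carrier H \<Longrightarrow> y \<in> carrier H \<Longrightarrow> cinner ?M (X p x) (Y y) = cinner H x (S y)"
      using isometry_extension_step[OF X[OF grow.hyps(2)] unused[OF grow.hyps(2)] ST] by blast
    have car: "X r x \<in> carrier ?M" "Y x \<in> carrier ?M" if "r \<in> N" "x \<in> carrier H" for r x
      using linear_op_carrier[OF isometric_embeddingD(1)[OF X[OF that(1)]] that(2)]
        linear_op_carrier[OF isometric_embeddingD(1)[OF Y(1)] that(2)] by blast+
    have edge': "cinner ?M ((X(q := Y)) r x) ((X(q := Y)) (r + unit_vec j) y) = cinner H x (A j y)"
      if j: "j < 3" and r: "r \<in> insert q N" "r + unit_vec j \<in> insert q N"
        and xy: "x \<in> carrier H" "y \<in> carrier H" for j r x y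
    proof -
      have no_loop: "r \<noteq> r + unit_vec j" using unit_vec_nonzero[of j] by simp
      consider (old) "r \<in> N" "r \<noteq> q" "r + unit_vec j \<in> N" "r + unit_vec j \<noteq> q"
        | (head) "r \<in> N" "r \<noteq> q" "r + unit_vec j = q" | (tail) "r = q" "r + unit_vec j \<in> N" "r + unit_vec j \<noteq> q"
        using r no_loop grow.hyps(3) by (metis insertE)
      then show ?thesis
      proof cases
        case old
        then show ?thesis using edge[OF j old(1,3) xy] by simp
      next
        case head
        have "neighbours r q" using j head(3) unfolding neighbours_def by blast
        then have rp: "r = p" using unique head(1) by blast
        have "q \<noteq> p + unit_vec i \<Longrightarrow> False"
        proof -
          assume "q \<noteq> p + unit_vec i"
          then have "p = p + unit_vec j + unit_vec i" using i(2) head(3) rp by simp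
          then have "unit_vec j + unit_vec i = 0" by (metis add.assoc add_cancel_right_right)
          then show False using unit_vec_sum_nonzero by blast
        qed
        then have qi: "q = p + unit_vec i" by blast
        then have "unit_vec j = unit_vec i" using head(3) rp by simp
        then have "j = i" using unit_vec_inject[OF j i(1)] by blast
        then show ?thesis using head rp qi Y(3)[OF xy] by (simp add: S_def)
      next
        case tail
        have "neighbours (r + unit_vec j) q" using j tail(1) unfolding neighbours_def by blast
        then have rp: "p = q + unit_vec j" using unique[OF tail(2)] tail(1) by simp
        have qi: "q \<noteq> p + unit_vec i"
        proof
          assume "q = p + unit_vec i"
          then have "q = q + unit_vec j + unit_vec i" using rp by simp
          then have "unit_vec j + unit_vec i = 0" by (metis add.assoc add_cancel_right_right)
          then show False using unit_vec_sum_nonzero by blast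
        qed
        then have "unit_vec j = unit_vec i" using i(2) rp by simp
        then have ji: "j = i" using unit_vec_inject[OF j i(1)] by blast
        have "cinner ?M (Y x) (X p y) = cnj (cinner ?M (X p y) (Y x))"
          using car grow.hyps(2) xy by (intro M.cinner_commute)
        also have "\<dots> = cnj (cinner H y (A' i x))" using Y(3)[OF xy(2,1)] qi by (simp add: S_def)
        also have "\<dots> = cinner H (A' i x) y"
          using xy adjoint_pairD(2)[OF adj[OF i(1)]] by (intro cinner_commute[symmetric])
        also have "\<dots> = cinner H x (A i y)"
          using adjoint_pairD(3)[OF adjoint_pair_swap[OF adj[OF i(1)]] xy] .
        finally show ?thesis using tail rp ji by simp
      qed
    qed
    show ?case
    proof (intro exI[of _ "X(q := Y)"] exI[of _ "Suc m"] conjI)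
      show "\<forall>r\<in>insert q N. isometric_embedding H ?M ((X(q := Y)) r)" using X Y(1) by simp
      show "\<forall>r\<in>insert q N. \<forall>x\<in>carrier H. \<forall>b\<ge>Suc m. (X(q := Y)) r x b = \<zero>\<^bsub>?L\<^esub>"
        using unused Y(2) by (simp del: l2_simps)
    qed (use edge' in blast)
  qed
  then show ?thesis using that by blast
qed

section \<open>The lattice shifts\<close>

definition shift :: "point \<Rightarrow> (point \<Rightarrow> 'b) \<Rightarrow> point \<Rightarrow> 'b" where
  "shift v F = (\<lambda>p. F (p + v))"

lemma shift_shift: "shift u (shift v F) = shift (u + v) F"
  by (simp add: shift_def add_ac)

lemma shift_0: "shift 0 F = F"
  by (simp add: shift_def)

lemma bij_plus: "bij (\<lambda>p::point. p + v)"
  by (rule bij_betw_byWitness[of _ "\<lambda>p. p - v"]) auto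

lemma (in inner_product_module) shift_adjoint:
  "adjoint_pair (l2 H) (shift v) (shift (- v))"
proof -
  have mem: "shift v F \<in> carrier (l2 H)" if "F \<in> carrier (l2 H)" for v and F :: "point \<Rightarrow> 'a"
    unfolding l2_carrier_iff square_summable_def
  proof (intro conjI allI)
    show "shift v F p \<in> carrier H" for p unfolding shift_def using that by (rule l2_coordinate)
    show "(\<lambda>p. (hnorm H (shift v F p))\<^sup>2) summable_on UNIV"
      using that summable_on_reindex_bij_betw[OF bij_plus, of "\<lambda>p. (hnorm H (F p))\<^sup>2" v]
      by (simp add: l2_carrier_iff square_summable_def shift_def)
  qed
  then have lin: "linear_op (l2 H) (l2 H) (shift v)" for v
    by (intro linear_opI) (auto simp: shift_def)
  have "cinner (l2 H) (shift v F) G = cinner (l2 H) F (shift (- v) G)" for F G :: "point \<Rightarrow> 'a"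
    using infsum_reindex_bij_betw[OF bij_plus, of "\<lambda>p. cinner H (F p) (G (p - v))" v]
    by (simp add: cinner_l2 shift_def)
  with lin show ?thesis by (simp add: adjoint_pair_def)
qed

text \<open>The weighted isometries along a tree assemble to an isometry \<open>V\<close>; the shifts multiply \<open>c p\<close> with the weight of the
  next point, and on edges of the tree the inner products are those of \<open>A i\<close>.\<close>

lemma (in inner_product_module) weighted_tree_compression:
  assumes adj: "\<And>i. i < 3 \<Longrightarrow> adjoint_pair H (A i) (A' i)"
    and contr: "\<And>i x. i < 3 \<Longrightarrow> x \<in> carrier H \<Longrightarrow> hnorm H (A i x) \<le> hnorm H x"
    and weight: "tree_weight \<kappa> N c"
  obtains V :: "'a \<Rightarrow> point \<Rightarrow> nat \<Rightarrow> nat \<Rightarrow> 'a"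
    where "isometric_embedding H (l2 (l2 (l2 H))) V"
    and "\<And>i x y. \<lbrakk>i < 3; x \<in> carrier H; y \<in> carrier H\<rbrakk>
      \<Longrightarrow> cinner (l2 (l2 (l2 H))) (V x) (shift (unit_vec i) (V y)) = of_real \<kappa> * cinner H x (A i y)"
proof -
  let ?L = "l2 H :: (nat \<Rightarrow> 'a) inner_module"
  let ?M = "l2 ?L :: (nat \<Rightarrow> nat \<Rightarrow> 'a) inner_module"
  let ?K = "l2 ?M :: (point \<Rightarrow> nat \<Rightarrow> nat \<Rightarrow> 'a) inner_module"
  interpret L: inner_product_module ?L by (rule l2_inner_product_module)
  interpret M: inner_product_module ?M by (rule L.l2_inner_product_module)
  interpret K: inner_product_module ?K by (rule M.l2_inner_product_module)
  have tree: "lattice_tree N" and off: "\<And>p. p \<notin> N \<Longrightarrow> c p = 0"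
    and norm: "(\<Sum>p\<in>N. (c p)\<^sup>2) = 1" and corr: "\<And>i. i < 3 \<Longrightarrow> (\<Sum>p\<in>N. c p * c (p + unit_vec i)) = \<kappa>"
    using weight by (auto simp: tree_weight_def)
  have fin: "finite N" using tree by (rule lattice_tree_finite)
  obtain X where X: "\<And>p. p \<in> N \<Longrightarrow> isometric_embedding H ?M (X p)"
    and edge: "\<And>p i x y. \<lbrakk>i < 3; p \<in> N; p + unit_vec i \<in> N; x \<in> carrier H; y \<in> carrier H\<rbrakk>
      \<Longrightarrow> cinner ?M (X p x) (X (p + unit_vec i) y) = cinner H x (A i y)"
    by (rule tree_isometries[of A A' N]) (use adj contr tree in blast)+
  have X_car: "X p x \<in> carrier ?M" if "p \<in> N" "x \<in> carrier H" for p x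
    using linear_op_carrier[OF isometric_embeddingD(1)[OF X[OF that(1)]] that(2)] .
  define V where "V x p = (if p \<in> N then of_real (c p) \<odot>\<^bsub>?M\<^esub> X p x else \<zero>\<^bsub>?M\<^esub>)" for x p
  have Vp: "V x p \<in> carrier ?M" if "x \<in> carrier H" for x p
    unfolding V_def using that X_car by (auto simp del: l2_simps)
  have V_off: "V x p = \<zero>\<^bsub>?M\<^esub>" if "p \<notin> N" for x p using that by (simp add: V_def)
  have V_car: "V x \<in> carrier ?K" if "x \<in> carrier H" for x
    by (rule M.finite_support_l2_carrier[OF fin]) (use that Vp V_off in blast)+
  have "linear_op H ?K V"
  proof (rule linear_opI[OF V_car])
    show "V (x \<oplus>\<^bsub>H\<^esub> y) = V x \<oplus>\<^bsub>?K\<^esub> V y" if "x \<in> carrier H" "y \<in> carrier H" for x y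
    proof
      fix p
      have "V (x \<oplus>\<^bsub>H\<^esub> y) p = V x p \<oplus>\<^bsub>?M\<^esub> V y p"
      proof (cases "p \<in> N")
        case True
        then show ?thesis
          using that X_car M.smult_r_distr[of "of_real (c p)" "X p x" "X p y"]
          by (simp add: V_def linear_op_add[OF isometric_embeddingD(1)[OF X[OF True]]] del: l2_simps)
      qed (simp add: V_def del: l2_simps)
      then show "V (x \<oplus>\<^bsub>H\<^esub> y) p = (V x \<oplus>\<^bsub>?K\<^esub> V y) p" by (simp only: l2_simps(2)[where H = ?M])
    qed
    show "V (a \<odot>\<^bsub>H\<^esub> x) = a \<odot>\<^bsub>?K\<^esub> V x" if "x \<in> carrier H" for a x
    proof
      fix p
      have "V (a \<odot>\<^bsub>H\<^esub> x) p = a \<odot>\<^bsub>?M\<^esub> V x p"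
      proof (cases "p \<in> N")
        case True
        then show ?thesis
          using that X_car[OF True that] M.smult_assoc1[of "of_real (c p)" a "X p x"] M.smult_assoc1[of a "of_real (c p)" "X p x"]
          by (simp add: V_def linear_op_smult[OF isometric_embeddingD(1)[OF X[OF True]]] mult.commute del: l2_simps)
      qed (simp add: V_def M.smult_r_null del: l2_simps)
      then show "V (a \<odot>\<^bsub>H\<^esub> x) p = (a \<odot>\<^bsub>?K\<^esub> V x) p" by (simp only: l2_simps(3)[where H = ?M])
    qed
  qed
  moreover have "cinner ?K (V x) (V y) = cinner H x y" if x: "x \<in> carrier H" and y: "y \<in> carrier H" for x y
  proof -
    have "cinner ?K (V x) (V y) = (\<Sum>p\<in>N. cinner ?M (V x p) (V y p))"
      using fin V_car[OF x] V_car[OF y] V_off by (rule M.cinner_l2_finite)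
    also have "\<dots> = (\<Sum>p\<in>N. of_real ((c p)\<^sup>2) * cinner H x y)"
    proof (rule sum.cong[OF refl])
      fix p assume p: "p \<in> N"
      show "cinner ?M (V x p) (V y p) = of_real ((c p)\<^sup>2) * cinner H x y"
        using p x y X_car[OF p] isometric_embeddingD(2)[OF X[OF p] x y]
        by (simp add: V_def M.cinner_smult_left M.cinner_smult_right power2_eq_square del: l2_simps)
    qed
    also have "\<dots> = of_real (\<Sum>p\<in>N. (c p)\<^sup>2) * cinner H x y" by (simp add: sum_distrib_right)
    finally show ?thesis using norm by simp
  qed
  ultimately have V: "isometric_embedding H ?K V" by (simp add: isometric_embedding_def)
  have "cinner ?K (V x) (shift (unit_vec i) (V y)) = of_real \<kappa> * cinner H x (A i y)"
    if i: "i < 3" and x: "x \<in> carrier H" and y: "y \<in> carrier H" for i x y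
  proof -
    have "cinner ?K (V x) (shift (unit_vec i) (V y)) = (\<Sum>p\<in>N. cinner ?M (V x p) (shift (unit_vec i) (V y) p))"
      using fin V_car[OF x] adjoint_pairD(1)[OF M.shift_adjoint V_car[OF y] V_car[OF y]] V_off
      by (rule M.cinner_l2_finite)
    also have "\<dots> = (\<Sum>p\<in>N. of_real (c p * c (p + unit_vec i)) * cinner H x (A i y))"
    proof (rule sum.cong[OF refl])
      fix p assume p: "p \<in> N"
      show "cinner ?M (V x p) (shift (unit_vec i) (V y) p) = of_real (c p * c (p + unit_vec i)) * cinner H x (A i y)"
      proof (cases "p + unit_vec i \<in> N")
        case q: True
        show ?thesis
          using p q x y X_car[OF p x] X_car[OF q y] edge[OF i p q x y]
          by (simp add: V_def shift_def M.cinner_smult_left M.cinner_smult_right del: l2_simps)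
      next
        case False
        then show ?thesis using Vp[OF x] by (simp add: shift_def V_off off del: l2_simps)
      qed
    qed
    also have "\<dots> = of_real (\<Sum>p\<in>N. c p * c (p + unit_vec i)) * cinner H x (A i y)"
      by (simp add: sum_distrib_right)
    finally show ?thesis using corr[OF i] by simp
  qed
  with V show ?thesis by (rule that)
qed

section \<open>Transport of a Hilbert space to another type\<close>

definition transport_decode :: "('b \<Rightarrow> 'c) \<Rightarrow> 'b inner_module \<Rightarrow> 'c \<Rightarrow> 'b" where
  "transport_decode E K g = (if g \<in> E ` carrier K then inv_into (carrier K) E g else \<zero>\<^bsub>K\<^esub>)"

text \<open>Points outside the carrier are treated as copies of the zero vector. Then the distance function is
  nonnegative and symmetric on the whole type, as the locale of metric spaces demands.\<close>

definition transport :: "('b \<Rightarrow> 'c) \<Rightarrow> 'b inner_module \<Rightarrow> 'c inner_module" where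
  "transport E K =
    \<lparr>carrier = E ` carrier K, mult = undefined, one = undefined, zero = E \<zero>\<^bsub>K\<^esub>,
     add = (\<lambda>x y. E (transport_decode E K x \<oplus>\<^bsub>K\<^esub> transport_decode E K y)),
     smult = (\<lambda>a x. E (a \<odot>\<^bsub>K\<^esub> transport_decode E K x)),
     cinner = (\<lambda>x y. cinner K (transport_decode E K x) (transport_decode E K y))\<rparr>"

lemma transport_simps [simp]:
  "carrier (transport E K) = E ` carrier K"
  "\<zero>\<^bsub>transport E K\<^esub> = E \<zero>\<^bsub>K\<^esub>"
  "x \<oplus>\<^bsub>transport E K\<^esub> y = E (transport_decode E K x \<oplus>\<^bsub>K\<^esub> transport_decode E K y)"
  "a \<odot>\<^bsub>transport E K\<^esub> x = E (a \<odot>\<^bsub>K\<^esub> transport_decode E K x)"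
  "cinner (transport E K) x y = cinner K (transport_decode E K x) (transport_decode E K y)"
  by (simp_all add: transport_def)

lemma hnorm_transport: "hnorm (transport E K) x = hnorm K (transport_decode E K x)"
  by (simp add: hnorm_def)

lemma transport_decode_encode: "inj_on E (carrier K) \<Longrightarrow> x \<in> carrier K \<Longrightarrow> transport_decode E K (E x) = x"
  by (simp add: transport_decode_def)

context inner_product_module
begin

lemma transport_decode_carrier: "transport_decode E H g \<in> carrier H"
  by (auto simp: transport_decode_def inv_into_into)

lemma transport_module:
  assumes inj: "inj_on E (carrier H)"
  shows "module complex_ring (transport E H)"
proof (rule moduleI[OF cring_complex_ring])
  note dec = transport_decode_encode[OF inj]
  show "abelian_group (transport E H)"
  proof (rule abelian_groupI)
    fix g assume "g \<in> carrier (transport E H)"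
    then obtain x where x: "x \<in> carrier H" "g = E x" by auto
    show "\<exists>h\<in>carrier (transport E H). h \<oplus>\<^bsub>transport E H\<^esub> g = \<zero>\<^bsub>transport E H\<^esub>"
      by (rule bexI[of _ "E (\<ominus>\<^bsub>H\<^esub> x)"]) (use x in \<open>simp_all add: dec l_neg\<close>)
  qed (auto simp: dec a_ac)
qed (auto simp: transport_decode_encode[OF inj] smult_l_distr[simplified] smult_r_distr[simplified] smult_assoc1[simplified] smult_one[simplified])

lemma transport_inner_product_module:
  assumes inj: "inj_on E (carrier H)"
  shows "inner_product_module (transport E H)"
  unfolding inner_product_module_def inner_product_module_axioms_def
proof (intro conjI allI impI transport_module[OF inj])
  note dec = transport_decode_encode[OF inj]
  show "0 < Re (cinner (transport E H) g g)" if g: "g \<in> carrier (transport E H)" and "g \<noteq> \<zero>\<^bsub>transport E H\<^esub>" for g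
  proof -
    obtain x where "x \<in> carrier H" "g = E x" using g by auto
    then show ?thesis using that cinner_pos[of x] by (auto simp: dec)
  qed
  show "cinner (transport E H) x y = cnj (cinner (transport E H) y x)" for x y
    unfolding transport_simps by (rule cinner_commute[OF transport_decode_carrier transport_decode_carrier])
qed (auto simp: transport_decode_encode[OF inj] cinner_add_right cinner_smult_right)

text \<open>This holds for all points of the type: a point outside the carrier acts as the zero vector, so the zero
  vector is the only vector that adds up to zero with it, and hence its negative.\<close>

lemma transport_decode_diff:
  assumes inj: "inj_on E (carrier H)"
  shows "transport_decode E H (g \<ominus>\<^bsub>transport E H\<^esub> h) = transport_decode E H g \<ominus>\<^bsub>H\<^esub> transport_decode E H h"
proof -
  note dec = transport_decode_encode[OF inj] and car = transport_decode_carrier[of E]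
  have "\<ominus>\<^bsub>transport E H\<^esub> h = E (\<ominus>\<^bsub>H\<^esub> transport_decode E H h)"
    unfolding a_inv_def[of "transport E H"] m_inv_def[of "add_monoid (transport E H)"]
  proof (rule the_equality)
    show "E (\<ominus>\<^bsub>H\<^esub> transport_decode E H h) \<in> carrier (add_monoid (transport E H)) \<and>
        h \<otimes>\<^bsub>add_monoid (transport E H)\<^esub> E (\<ominus>\<^bsub>H\<^esub> transport_decode E H h) = \<one>\<^bsub>add_monoid (transport E H)\<^esub> \<and>
        E (\<ominus>\<^bsub>H\<^esub> transport_decode E H h) \<otimes>\<^bsub>add_monoid (transport E H)\<^esub> h = \<one>\<^bsub>add_monoid (transport E H)\<^esub>"
      using car[of h] by (simp add: dec l_neg r_neg)
    fix g assume "g \<in> carrier (add_monoid (transport E H)) \<and>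
        h \<otimes>\<^bsub>add_monoid (transport E H)\<^esub> g = \<one>\<^bsub>add_monoid (transport E H)\<^esub> \<and>
        g \<otimes>\<^bsub>add_monoid (transport E H)\<^esub> h = \<one>\<^bsub>add_monoid (transport E H)\<^esub>"
    then obtain x where x: "x \<in> carrier H" "g = E x" "E (x \<oplus>\<^bsub>H\<^esub> transport_decode E H h) = E \<zero>\<^bsub>H\<^esub>"
      by (auto simp: dec)
    then have "x \<oplus>\<^bsub>H\<^esub> transport_decode E H h = \<zero>\<^bsub>H\<^esub>"
      using inj car[of h] by (auto dest: inj_onD)
    then show "g = E (\<ominus>\<^bsub>H\<^esub> transport_decode E H h)"
      using x car[of h] minus_equality[of x "transport_decode E H h"] by simp
  qed
  then show ?thesis using car[of g] car[of h] by (simp add: a_minus_def dec)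
qed

end

lemma complex_hilbert_spaceI:
  assumes "inner_product_module H" "Metric_space.mcomplete (carrier H) (\<lambda>x y. hnorm H (x \<ominus>\<^bsub>H\<^esub> y))"
  shows "complex_hilbert_space H"
  using assms unfolding complex_hilbert_space_def complex_hilbert_space_axioms_def
    inner_product_module_def inner_product_module_axioms_def by blast

lemma (in hilbert_module) transport_hilbert_space:
  assumes inj: "inj_on E (carrier H)"
  shows "complex_hilbert_space (transport E H)"
proof -
  let ?K = "transport E H" and ?D = "transport_decode E H"
  interpret K: inner_product_module ?K by (rule transport_inner_product_module[OF inj])
  note dec = transport_decode_encode[OF inj] and car = transport_decode_carrier[of E]
  have dist: "hnorm ?K (g \<ominus>\<^bsub>?K\<^esub> h) = hnorm H (?D g \<ominus>\<^bsub>H\<^esub> ?D h)" for g h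
    unfolding hnorm_transport transport_decode_diff[OF inj] by (rule refl)
  interpret metric: Metric_space "carrier ?K" "\<lambda>x y. hnorm ?K (x \<ominus>\<^bsub>?K\<^esub> y)"
  proof
    fix g h k
    show "0 \<le> hnorm ?K (g \<ominus>\<^bsub>?K\<^esub> h)" unfolding dist by (intro hnorm_nonneg diff_in_carrier car)
    show "hnorm ?K (g \<ominus>\<^bsub>?K\<^esub> h) = hnorm ?K (h \<ominus>\<^bsub>?K\<^esub> g)" unfolding dist by (rule hnorm_diff_commute[OF car car])
    assume g: "g \<in> carrier ?K" and h: "h \<in> carrier ?K"
    show "hnorm ?K (g \<ominus>\<^bsub>?K\<^esub> h) = 0 \<longleftrightarrow> g = h"
      using K.hnorm_eq_0_iff[OF K.diff_in_carrier[OF g h]] K.diff_eq_zero_iff[OF g h] by simp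
    assume k: "k \<in> carrier ?K"
    show "hnorm ?K (g \<ominus>\<^bsub>?K\<^esub> k) \<le> hnorm ?K (g \<ominus>\<^bsub>?K\<^esub> h) + hnorm ?K (h \<ominus>\<^bsub>?K\<^esub> k)"
      using g h k by (rule K.hnorm_diff_triangle)
  qed
  have "metric.mcomplete"
    unfolding metric.mcomplete_def
  proof (intro allI impI)
    fix s assume "metric.MCauchy s"
    then have s: "range s \<subseteq> carrier ?K"
      and Cauchy: "\<And>e. 0 < e \<Longrightarrow> \<exists>N. \<forall>m n. N \<le> m \<longrightarrow> N \<le> n \<longrightarrow> hnorm ?K (s m \<ominus>\<^bsub>?K\<^esub> s n) < e"
      unfolding metric.MCauchy_def by blast+
    have "\<exists>x\<in>carrier H. (\<lambda>n. hnorm H (?D (s n) \<ominus>\<^bsub>H\<^esub> x)) \<longlonglongrightarrow> 0"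
    proof (rule Cauchy_limit)
      show "\<exists>N. \<forall>m\<ge>N. \<forall>n\<ge>N. hnorm H (?D (s m) \<ominus>\<^bsub>H\<^esub> ?D (s n)) < e" if "0 < e" for e
        using Cauchy[OF that] unfolding dist by blast
    qed (rule car)
    then obtain x where x: "x \<in> carrier H" "(\<lambda>n. hnorm H (?D (s n) \<ominus>\<^bsub>H\<^esub> x)) \<longlonglongrightarrow> 0" by blast
    have "limitin metric.mtopology s (E x) sequentially"
      unfolding metric.limitin_metric_dist_null
    proof (intro conjI)
      show "E x \<in> carrier ?K" using x(1) by simp
      show "\<forall>\<^sub>F n in sequentially. s n \<in> carrier ?K" using s by (auto simp: image_subset_iff)
      show "(\<lambda>n. hnorm ?K (s n \<ominus>\<^bsub>?K\<^esub> E x)) \<longlonglongrightarrow> 0" unfolding dist dec[OF x(1)] by (rule x(2))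
    qed
    then show "\<exists>l. limitin metric.mtopology s l sequentially" by blast
  qed
  with K.inner_product_module_axioms show ?thesis by (rule complex_hilbert_spaceI)
qed

lemma transport_embedding:
  assumes H: "inner_product_module H" and inj: "inj_on E (carrier H)"
  shows "isometric_embedding H (transport E H) E"
  using transport_decode_encode[OF inj] by (auto simp: isometric_embedding_def linear_op_def)

lemma transport_adjoint_pair:
  assumes H: "inner_product_module H" and inj: "inj_on E (carrier H)" and adj: "adjoint_pair H S T"
  shows "adjoint_pair (transport E H) (\<lambda>g. E (S (transport_decode E H g))) (\<lambda>g. E (T (transport_decode E H g)))"
proof -
  interpret inner_product_module H by fact
  note dec = transport_decode_encode[OF inj] and car = transport_decode_carrier[of E]
  have lin: "linear_op (transport E H) (transport E H) (\<lambda>g. E (R (transport_decode E H g)))"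
    if R: "linear_op H H R" for R
  proof (rule linear_opI)
    show "E (R (transport_decode E H g)) \<in> carrier (transport E H)" for g
      using linear_op_carrier[OF R car] by simp
  qed (simp_all add: dec car linear_op_carrier[OF R car] linear_op_add[OF R] linear_op_smult[OF R])
  show ?thesis
    unfolding adjoint_pair_def
  proof (intro conjI ballI lin)
    show "linear_op H H S" "linear_op H H T" using adj by (simp_all add: adjoint_pair_def)
    fix g h
    have "S (transport_decode E H g) \<in> carrier H" "T (transport_decode E H h) \<in> carrier H"
      using adjoint_pairD(1,2)[OF adj car car] by blast+
    then show "cinner (transport E H) (E (S (transport_decode E H g))) h = cinner (transport E H) g (E (T (transport_decode E H h)))"
      by (simp only: transport_simps dec) (rule adjoint_pairD(3)[OF adj car car])
  qed
qed

section \<open>Commuting unitary operators and dilations\<close>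

lemma adjoint_op_eq:
  assumes "inner_product_module K" and adj: "adjoint_pair K S T" and y: "y \<in> carrier K"
  shows "adjoint_op K S y = T y"
proof -
  interpret inner_product_module K by fact
  show ?thesis
    unfolding adjoint_op_def
  proof (rule the_equality)
    show "T y \<in> carrier K \<and> (\<forall>x\<in>carrier K. cinner K (S x) y = cinner K x (T y))"
      using adjoint_pairD[OF adj] y by blast
    fix z assume z: "z \<in> carrier K \<and> (\<forall>x\<in>carrier K. cinner K (S x) y = cinner K x z)"
    show "z = T y"
    proof (rule cinner_ext)
      show "cinner K x z = cinner K x (T y)" if "x \<in> carrier K" for x
        using z adjoint_pairD(3)[OF adj that y] that by simp
    qed (use z adjoint_pairD(2)[OF adj y y] in auto)
  qed
qed

text \<open>A compression can be recognised from inner products.\<close>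

lemma orth_proj_range_eq:
  assumes H: "inner_product_module H" and K: "inner_product_module K" and V: "isometric_embedding H K V"
    and k: "k \<in> carrier K" and z: "z \<in> carrier H"
    and inner: "\<And>x. x \<in> carrier H \<Longrightarrow> cinner K (V x) k = cinner H x z"
  shows "orth_proj K (V ` carrier H) k = V z"
proof -
  interpret H: inner_product_module H by fact
  interpret K: inner_product_module K by fact
  note V_inner = isometric_embeddingD(2)[OF V]
  have V_car: "V x \<in> carrier K" if "x \<in> carrier H" for x
    using isometric_embeddingD(1)[OF V] that by (rule linear_op_carrier)
  show ?thesis
    unfolding orth_proj_def
  proof (rule the_equality)
    show "V z \<in> V ` carrier H \<and> (\<forall>m\<in>V ` carrier H. cinner K m (k \<ominus>\<^bsub>K\<^esub> V z) = 0)"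
      using z k inner V_inner V_car by (auto simp: K.cinner_diff_right)
    fix p assume p: "p \<in> V ` carrier H \<and> (\<forall>m\<in>V ` carrier H. cinner K m (k \<ominus>\<^bsub>K\<^esub> p) = 0)"
    then obtain u where u: "u \<in> carrier H" "p = V u" by blast
    have "u = z"
    proof (rule H.cinner_ext[OF u(1) z])
      fix x assume x: "x \<in> carrier H"
      have "cinner K (V x) (k \<ominus>\<^bsub>K\<^esub> V u) = 0" using p u(2) x by simp
      then show "cinner H x u = cinner H x z"
        using x u k V_car inner V_inner by (simp add: K.cinner_diff_right)
    qed
    then show "p = V z" using u by simp
  qed
qed

text \<open>The dilation consists of multiples of the unitaries by \<open>1 / \<kappa>\<close>; these are normal, and their norm is \<open>1 / \<kappa>\<close> or \<open>0\<close>.\<close>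

lemma commuting_normal_dilationI:
  assumes H: "inner_product_module H" and K: "complex_hilbert_space K" and V: "isometric_embedding H K V"
    and adj: "\<And>i. i < d \<Longrightarrow> adjoint_pair K (U i) (W i)"
    and unitary: "\<And>i x. i < d \<Longrightarrow> x \<in> carrier K \<Longrightarrow> W i (U i x) = x" "\<And>i x. i < d \<Longrightarrow> x \<in> carrier K \<Longrightarrow> U i (W i x) = x"
    and commute: "\<And>i j x. i < d \<Longrightarrow> j < d \<Longrightarrow> x \<in> carrier K \<Longrightarrow> U i (U j x) = U j (U i x)"
    and compress: "\<And>i x y. i < d \<Longrightarrow> x \<in> carrier H \<Longrightarrow> y \<in> carrier H
      \<Longrightarrow> cinner K (V x) (U i (V y)) = of_real \<kappa> * cinner H x (A i y)"
    and A: "\<And>i x. i < d \<Longrightarrow> x \<in> carrier H \<Longrightarrow> A i x \<in> carrier H"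
    and \<kappa>: "0 < \<kappa>" and \<alpha>: "1 / \<kappa> \<le> \<alpha>"
  shows "commuting_normal_dilation H d A \<alpha> K V (\<lambda>i x. of_real (1 / \<kappa>) \<odot>\<^bsub>K\<^esub> U i x)"
proof -
  have K': "inner_product_module K" using K by (rule hilbert_space_inner_product_module)
  interpret K: inner_product_module K by fact
  let ?r = "complex_of_real (1 / \<kappa>)"
  let ?B = "\<lambda>i x. ?r \<odot>\<^bsub>K\<^esub> U i x" and ?C = "\<lambda>i x. ?r \<odot>\<^bsub>K\<^esub> W i x"
  have V_car: "V x \<in> carrier K" if "x \<in> carrier H" for x
    using isometric_embeddingD(1)[OF V] that by (rule linear_op_carrier)
  have lin: "linear_op K K (U i)" "linear_op K K (W i)" if "i < d" for i
    using adj[OF that] by (auto simp: adjoint_pair_def)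
  note car = linear_op_carrier[OF lin(1)] linear_op_carrier[OF lin(2)]
  have scaled: "linear_op K K (\<lambda>x. ?r \<odot>\<^bsub>K\<^esub> T x)" if T: "linear_op K K T" for T
  proof (rule linear_opI)
    fix x y a assume x: "x \<in> carrier K"
    note Tx = linear_op_carrier[OF T x]
    show "?r \<odot>\<^bsub>K\<^esub> T x \<in> carrier K" using Tx by simp
    show "?r \<odot>\<^bsub>K\<^esub> T (a \<odot>\<^bsub>K\<^esub> x) = a \<odot>\<^bsub>K\<^esub> (?r \<odot>\<^bsub>K\<^esub> T x)"
      unfolding linear_op_smult[OF T x] using Tx K.smult_assoc1[of ?r a "T x"] K.smult_assoc1[of a ?r "T x"]
      by (simp add: mult.commute)
    assume y: "y \<in> carrier K"
    show "?r \<odot>\<^bsub>K\<^esub> T (x \<oplus>\<^bsub>K\<^esub> y) = ?r \<odot>\<^bsub>K\<^esub> T x \<oplus>\<^bsub>K\<^esub> ?r \<odot>\<^bsub>K\<^esub> T y"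
      unfolding linear_op_add[OF T x y] using Tx linear_op_carrier[OF T y] by (intro K.smult_r_distr) auto
  qed
  have adj_BC: "adjoint_pair K (?B i) (?C i)" if i: "i < d" for i
    unfolding adjoint_pair_def
  proof (intro conjI ballI scaled lin[OF i])
    show "cinner K (?B i x) y = cinner K x (?C i y)" if x: "x \<in> carrier K" and y: "y \<in> carrier K" for x y
      using car[OF i x] car[OF i y] x y adjoint_pairD(3)[OF adj[OF i] x y]
      by (simp add: K.cinner_smult_left K.cinner_smult_right)
  qed
  have norm_B: "hnorm K (?B i x) = 1 / \<kappa> * hnorm K x" if i: "i < d" and x: "x \<in> carrier K" for i x
  proof -
    have "cinner K (U i x) (U i x) = cinner K x x"
      using adjoint_pairD(3)[OF adj[OF i] x car(1)[OF i x]] unitary(1)[OF i x] by simp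
    then have "hnorm K (U i x) = hnorm K x" by (simp add: hnorm_def)
    then show ?thesis using car(1)[OF i x] \<kappa> by (simp add: K.hnorm_smult norm_divide)
  qed
  have bounded: "bounded_op K (?B i)" if i: "i < d" for i
    unfolding bounded_op_def using scaled[OF lin(1)[OF i]] norm_B[OF i] by (metis order_refl)
  have UB: "U i (?r \<odot>\<^bsub>K\<^esub> x) = ?r \<odot>\<^bsub>K\<^esub> U i x" "W i (?r \<odot>\<^bsub>K\<^esub> x) = ?r \<odot>\<^bsub>K\<^esub> W i x"
    if "i < d" "x \<in> carrier K" for i x
    using that lin by (auto simp: linear_op_smult)
  show ?thesis
    unfolding commuting_normal_dilation_def
  proof (intro conjI allI impI ballI K V)
    fix i assume i: "i < d"
    show "normal_op K (?B i)"
      unfolding normal_op_def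
    proof (intro conjI ballI bounded[OF i])
      fix x assume x: "x \<in> carrier K"
      have "adjoint_op K (?B i) (?B i x) = ?C i (?B i x)"
        using car[OF i x] by (intro adjoint_op_eq[OF K' adj_BC[OF i]]) simp
      also have "\<dots> = ?B i (?C i x)"
        using car[OF i x] x by (simp only: UB[OF i] unitary[OF i])
      also have "\<dots> = ?B i (adjoint_op K (?B i) x)" by (simp only: adjoint_op_eq[OF K' adj_BC[OF i] x])
      finally show "adjoint_op K (?B i) (?B i x) = ?B i (adjoint_op K (?B i) x)" .
    qed
    show "opnorm K (?B i) \<le> \<alpha>"
      unfolding opnorm_def
    proof (rule cSup_least)
      show "{hnorm K (?B i x) | x. x \<in> carrier K \<and> hnorm K x \<le> 1} \<noteq> {}"
        using K.zero_closed K.hnorm_zero by (metis (mono_tags, lifting) Collect_empty_eq zero_le_one)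
      fix t assume "t \<in> {hnorm K (?B i x) | x. x \<in> carrier K \<and> hnorm K x \<le> 1}"
      then obtain x where x: "x \<in> carrier K" "hnorm K x \<le> 1" "t = hnorm K (?B i x)" by blast
      have "t = 1 / \<kappa> * hnorm K x" using norm_B[OF i x(1)] x(3) by simp
      also have "\<dots> \<le> 1 / \<kappa> * 1" using x(2) \<kappa> by (intro mult_left_mono) auto
      finally show "t \<le> \<alpha>" using \<alpha> by simp
    qed
    show "?B i (?B j x) = ?B j (?B i x)" if "j < d" "x \<in> carrier K" for j x
      using that i car commute[OF i that] by (simp only: UB)
    fix x assume x: "x \<in> carrier H"
    show "orth_proj K (V ` carrier H) (?B i (V x)) = V (A i x)"
    proof (rule orth_proj_range_eq[OF H K' V _ A[OF i x]])
      show "?B i (V x) \<in> carrier K" using car(1)[OF i V_car[OF x]] by simp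
      show "cinner K (V w) (?B i (V x)) = cinner H w (A i x)" if w: "w \<in> carrier H" for w
        using compress[OF i w x] V_car[OF w] car(1)[OF i V_car[OF x]] \<kappa> by (simp add: K.cinner_smult_right)
    qed
  qed
qed

section \<open>Dilating three contractions\<close>

definition encode_family :: "(point \<Rightarrow> nat \<Rightarrow> nat \<Rightarrow> 'a \<Rightarrow> complex) \<Rightarrow> nat \<times> 'a \<Rightarrow> complex" where
  "encode_family F = (\<lambda>(m, y). case from_nat m of (p, b, k) \<Rightarrow> F p b k y)"

lemma inj_encode_family: "inj encode_family"
proof (rule injI)
  fix F G :: "point \<Rightarrow> nat \<Rightarrow> nat \<Rightarrow> 'a \<Rightarrow> complex" assume eq: "encode_family F = encode_family G"
  have "F p b k y = G p b k y" for p b k y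
    using fun_cong[OF eq, of "(to_nat (p, b, k), y)"] by (simp add: encode_family_def)
  then show "F = G" by (intro ext)
qed

text \<open>Pass from \<open>H\<close> to its dual, compress the lattice shifts along the tree, and move the space of families to the
  type \<open>nat \<times> 'a \<Rightarrow> complex\<close>.\<close>

theorem tree_weight_dilates:
  assumes weight: "tree_weight \<kappa> N c" and \<kappa>: "0 < \<kappa>" and \<alpha>: "1 / \<kappa> \<le> \<alpha>"
  shows "dilates_all_contractions TYPE('a) 3 \<alpha>"
  unfolding dilates_all_contractions_def
proof (intro allI impI)
  fix H :: "'a inner_module" and A :: "nat \<Rightarrow> 'a \<Rightarrow> 'a"
  assume "complex_hilbert_space H" and A: "\<forall>i<3. contraction H (A i)"
  interpret H: inner_product_module H using \<open>complex_hilbert_space H\<close> by (rule hilbert_space_inner_product_module)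
  let ?D = "dual_space H" and ?\<iota> = "dual_embedding H"
  interpret D: hilbert_module ?D by (rule H.dual_hilbert_module)
  have A_lin: "linear_op H H (A i)" if "i < 3" for i
    using A that by (auto simp: contraction_def bounded_op_def)
  have A_contr: "hnorm H (A i x) \<le> hnorm H x" if "i < 3" "x \<in> carrier H" for i x
    using A that H.inner_product_module_axioms by (auto intro: contraction_bound)
  have \<iota>_car: "?\<iota> x \<in> carrier ?D" if "x \<in> carrier H" for x using that by (rule H.dual_embedding_carrier)
  have "linear_op H ?D ?\<iota>"
    by (rule linear_opI[OF \<iota>_car]) (auto simp: dual_embedding_def H.cinner_add_right H.cinner_smult_right)
  then have \<iota>: "isometric_embedding H ?D ?\<iota>"
    by (simp add: isometric_embedding_def H.cinner_dual_embedding_both)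
  have "\<exists>S T. adjoint_pair ?D S T \<and> (\<forall>\<phi>\<in>carrier ?D. hnorm ?D (S \<phi>) \<le> hnorm ?D \<phi>) \<and>
      (\<forall>x\<in>carrier H. S (?\<iota> x) = ?\<iota> (A i x))" if i: "i < 3" for i
    by (rule H.contraction_extends_to_dual[OF A_lin[OF i] A_contr[OF i]]) blast+
  then obtain S T where adj: "\<And>i. i < 3 \<Longrightarrow> adjoint_pair ?D (S i) (T i)"
    and contr: "\<And>i \<phi>. i < 3 \<Longrightarrow> \<phi> \<in> carrier ?D \<Longrightarrow> hnorm ?D (S i \<phi>) \<le> hnorm ?D \<phi>"
    and ext: "\<And>i x. i < 3 \<Longrightarrow> x \<in> carrier H \<Longrightarrow> S i (?\<iota> x) = ?\<iota> (A i x)"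
    by metis
  let ?L = "l2 ?D :: (nat \<Rightarrow> 'a \<Rightarrow> complex) inner_module"
  let ?M = "l2 ?L :: (nat \<Rightarrow> nat \<Rightarrow> 'a \<Rightarrow> complex) inner_module"
  let ?F = "l2 ?M :: (point \<Rightarrow> nat \<Rightarrow> nat \<Rightarrow> 'a \<Rightarrow> complex) inner_module"
  interpret L: hilbert_module ?L by (rule D.l2_hilbert_module)
  interpret M: hilbert_module ?M by (rule L.l2_hilbert_module)
  interpret F: hilbert_module ?F by (rule M.l2_hilbert_module)
  obtain V where V: "isometric_embedding ?D ?F V"
    and corr: "\<And>i x y. \<lbrakk>i < 3; x \<in> carrier ?D; y \<in> carrier ?D\<rbrakk>
      \<Longrightarrow> cinner ?F (V x) (shift (unit_vec i) (V y)) = of_real \<kappa> * cinner ?D x (S i y)"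
    by (rule D.weighted_tree_compression[of S T \<kappa> N c]) (use adj contr weight in blast)+
  let ?E = "encode_family :: (point \<Rightarrow> nat \<Rightarrow> nat \<Rightarrow> 'a \<Rightarrow> complex) \<Rightarrow> nat \<times> 'a \<Rightarrow> complex"
  let ?K = "transport ?E ?F" and ?dec = "transport_decode ?E ?F"
  have inj: "inj_on ?E (carrier ?F)" using inj_encode_family by (rule inj_on_subset) simp
  note dec = transport_decode_encode[OF inj] and dec_car = F.transport_decode_carrier[of ?E]
  define U where "U v g = ?E (shift v (?dec g))" for v g
  define W where "W x = ?E (V (?\<iota> x))" for x
  have shift_car: "shift v G \<in> carrier ?F" if "G \<in> carrier ?F" for v G
    using adjoint_pairD(1)[OF M.shift_adjoint that that] .
  have dec_U: "?dec (U v g) = shift v (?dec g)" for v g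
    unfolding U_def by (rule dec[OF shift_car[OF dec_car]])
  have U_U: "U u (U v g) = U (u + v) g" for u v g
    by (simp only: U_def[of u] U_def[of "u + v"] dec_U shift_shift)
  have U_0: "U 0 g = g" if "g \<in> carrier ?K" for g
    using that dec by (auto simp: U_def shift_0)
  have VI_car: "V (?\<iota> x) \<in> carrier ?F" if "x \<in> carrier H" for x
    using linear_op_carrier[OF isometric_embeddingD(1)[OF V] \<iota>_car[OF that]] .
  have "commuting_normal_dilation H 3 A \<alpha> ?K W (\<lambda>i x. of_real (1 / \<kappa>) \<odot>\<^bsub>?K\<^esub> U (unit_vec i) x)"
  proof (rule commuting_normal_dilationI[where W = "\<lambda>i. U (- unit_vec i)"])
    show "inner_product_module H" by (rule H.inner_product_module_axioms)
    show "complex_hilbert_space ?K" using inj by (rule F.transport_hilbert_space)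
    show "isometric_embedding H ?K W"
      unfolding W_def
      by (intro isometric_embedding_compose[OF isometric_embedding_compose[OF \<iota> V]]
          transport_embedding F.inner_product_module_axioms inj)
    show "adjoint_pair ?K (U (unit_vec i)) (U (- unit_vec i))" for i
      unfolding U_def by (rule transport_adjoint_pair[OF F.inner_product_module_axioms inj M.shift_adjoint])
    show "U (- unit_vec i) (U (unit_vec i) g) = g" "U (unit_vec i) (U (- unit_vec i) g) = g"
      if "g \<in> carrier ?K" for i g
      using U_0[OF that] by (simp_all add: U_U)
    show "U (unit_vec i) (U (unit_vec j) g) = U (unit_vec j) (U (unit_vec i) g)" for i j g
      by (simp add: U_U add.commute)
    show "cinner ?K (W x) (U (unit_vec i) (W y)) = of_real \<kappa> * cinner H x (A i y)"
      if "i < 3" "x \<in> carrier H" "y \<in> carrier H" for i x y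
    proof -
      have "cinner ?K (W x) (U (unit_vec i) (W y)) = cinner ?F (V (?\<iota> x)) (shift (unit_vec i) (V (?\<iota> y)))"
        using that by (simp add: dec_U W_def dec VI_car)
      also have "\<dots> = of_real \<kappa> * cinner ?D (?\<iota> x) (S i (?\<iota> y))"
        using that by (intro corr \<iota>_car)
      also have "cinner ?D (?\<iota> x) (S i (?\<iota> y)) = cinner H x (A i y)"
        using that linear_op_carrier[OF A_lin] by (simp add: ext H.cinner_dual_embedding_both)
      finally show ?thesis .
    qed
    show "A i x \<in> carrier H" if "i < 3" "x \<in> carrier H" for i x using A_lin[OF that(1)] that(2) by (rule linear_op_carrier)
  qed (rule \<kappa> \<alpha>)+
  then show "\<exists>(K :: (nat \<times> 'a \<Rightarrow> complex) inner_module) V B. commuting_normal_dilation H 3 A \<alpha> K V B"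
    by blast
qed

section \<open>The universal constant\<close>

definition zero_space :: "'a inner_module" where
  "zero_space = \<lparr>carrier = {undefined}, mult = undefined, one = undefined, zero = undefined,
     add = (\<lambda>_ _. undefined), smult = (\<lambda>_ _. undefined), cinner = (\<lambda>_ _. 0)\<rparr>"

lemma zero_space_simps [simp]:
  "carrier zero_space = {undefined}" "\<zero>\<^bsub>zero_space\<^esub> = undefined" "x \<oplus>\<^bsub>zero_space\<^esub> y = undefined"
  "a \<odot>\<^bsub>zero_space\<^esub> x = undefined" "cinner zero_space x y = 0" "hnorm zero_space x = 0"
  by (simp_all add: zero_space_def hnorm_def)

lemma mcomplete_singleton: "Metric_space.mcomplete {a} (\<lambda>x y. 0)"
proof -
  interpret Metric_space "{a}" "\<lambda>x y. 0" by unfold_locales auto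
  show ?thesis
    unfolding mcomplete_def MCauchy_def image_subset_iff by (metis UNIV_I limit_metric_sequentially)
qed

lemma zero_space_hilbert: "complex_hilbert_space zero_space"
  unfolding complex_hilbert_space_def complex_hilbert_space_axioms_def
proof (intro conjI)
  show "module complex_ring zero_space"
    by (rule moduleI[OF cring_complex_ring abelian_groupI]) auto
  show "Metric_space.mcomplete (carrier zero_space) (\<lambda>x y. hnorm zero_space (x \<ominus>\<^bsub>zero_space\<^esub> y))"
    by (simp add: mcomplete_singleton)
qed auto

text \<open>Operator norms are nonnegative, so one dilation suffices: that of the identity on the zero space.\<close>

lemma admissible_nonneg:
  assumes "dilates_all_contractions TYPE('a) d \<alpha>" "0 < d"
  shows "0 \<le> \<alpha>"
proof -
  have "contraction (zero_space :: 'a inner_module) (\<lambda>x. x)"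
    by (auto simp: contraction_def bounded_op_def linear_op_def opnorm_def)
  then obtain K :: "(nat \<times> 'a \<Rightarrow> complex) inner_module" and V B
    where dil: "commuting_normal_dilation (zero_space :: 'a inner_module) d (\<lambda>_ x. x) \<alpha> K V B"
    using assms(1) zero_space_hilbert unfolding dilates_all_contractions_def by metis
  then have "bounded_op K (B 0)" "opnorm K (B 0) \<le> \<alpha>" "inner_product_module K"
    using assms(2) by (auto simp: commuting_normal_dilation_def normal_op_def hilbert_space_inner_product_module)
  then show ?thesis using opnorm_nonneg order_trans by blast
qed

text \<open>After squaring, the claim is \<open>2 * (1 + sqrt (7 + 2 * sqrt 5)) \<le> 6 + sqrt (6 + sqrt 6)\<close>. The left side is at most
  \<open>8.8\<close>, and the right side is at least \<open>8.8\<close>; the exact values are about \<open>8.774\<close> and \<open>8.907\<close>.\<close>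

lemma three_subdivisions_bound:
  "1 / (sqrt (6 + sqrt (6 + sqrt 6)) / 6) \<le> 3 * sqrt (2 / (1 + sqrt (7 + 2 * sqrt 5)))"
proof -
  define s where "s = 6 + sqrt (6 + sqrt 6)"
  define t where "t = sqrt (7 + 2 * sqrt 5)"
  have "sqrt 5 \<le> 9 / 4" by (rule real_le_lsqrt) (simp_all add: power2_eq_square)
  then have t: "0 \<le> t" "t \<le> 17 / 5"
    unfolding t_def by (simp, intro real_le_lsqrt) (simp_all add: power2_eq_square)
  have "2 \<le> sqrt 6" by (rule real_le_rsqrt) simp
  then have "14 / 5 \<le> sqrt (6 + sqrt 6)" by (intro real_le_rsqrt) (simp add: power2_eq_square)
  then have s: "2 * (1 + t) \<le> s" "0 < s" using t by (simp_all add: s_def)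
  then have "4 / s \<le> 2 / (1 + t)" using t by (simp add: field_simps)
  then have "sqrt (4 / s) \<le> sqrt (2 / (1 + t))" by (rule real_sqrt_le_mono)
  then have "3 * (2 / sqrt s) \<le> 3 * sqrt (2 / (1 + t))" by (simp add: real_sqrt_divide)
  then show ?thesis by (simp add: s_def t_def)
qed

theorem corollary3p7:
  shows "dilates_all_contractions TYPE('a) 3 (3 * sqrt (2 / (1 + sqrt (7 + 2 * sqrt 5)))) \<and>
    universal_commuting_dilation_constant TYPE('a) 3 \<le> 3 * sqrt (2 / (1 + sqrt (7 + 2 * sqrt 5)))"
proof
  obtain N c where weight: "tree_weight (sqrt (6 + sqrt (6 + sqrt 6)) / 6) N c"
    by (rule tree_weight_three_subdivisions)
  have "0 < 6 + sqrt (6 + sqrt 6)" by (intro add_pos_nonneg) simp_all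
  then have "0 < sqrt (6 + sqrt (6 + sqrt 6)) / 6" by simp
  with weight show dilates: "dilates_all_contractions TYPE('a) 3 (3 * sqrt (2 / (1 + sqrt (7 + 2 * sqrt 5))))"
    using three_subdivisions_bound by (rule tree_weight_dilates)
  show "universal_commuting_dilation_constant TYPE('a) 3 \<le> 3 * sqrt (2 / (1 + sqrt (7 + 2 * sqrt 5)))"
    unfolding universal_commuting_dilation_constant_def
  proof (rule cInf_lower)
    show "bdd_below {\<alpha>. dilates_all_contractions TYPE('a) 3 \<alpha>}"
      by (rule bdd_belowI[of _ 0]) (auto intro: admissible_nonneg[of 3])
  qed (use dilates in simp)
qed

end
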